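(* The off-diagonal Ramsey numbers satisfy \[ R(3,k)\ \ge\ \left(\frac12+o(1)\right)\frac{k^2}{\log k}\qquad (k\to\infty). \] That is, for every $\delta>0$ there is a $k_0$ such that $R(3,k)\ge \left(\frac12-\delta\right)\frac{k^2}{\log k}$ for all integers $k\ge k_0$.
   Context: The Ramsey number $R(\ell,k)$ is the least $N$ such that every graph on $N$ vertices contains either a clique of size $\ell$ or an independent set of size $k$. The logarithm is natural. The term $o(1)$ denotes a quantity tending to $0$ as $k\to\infty$. *)

theory Defs
  imports Complex_Main "HOL-Library.Ramsey"
begin

text \<open>
  A graph is a finite vertex set \<open>V\<close> with an edge set \<open>E \<subseteq> [V]\<^bsup>2\<^esup>\<close>; the predicates
  \<^const>\<open>clique\<close> and \<^const>\<open>indep\<close> are those of \<^theory>\<open>HOL-Library.Ramsey\<close>.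
  Vertices are natural numbers, which loses no generality: see \<open>ramsey_arrows_any_graph\<close>.
\<close>

definition ramsey_arrows :: "nat \<Rightarrow> nat \<Rightarrow> nat \<Rightarrow> bool" where
  "ramsey_arrows N l k \<longleftrightarrow>
     (\<forall>(V :: nat set) E. finite V \<and> card V = N \<and> E \<subseteq> [V]\<^bsup>2\<^esup> \<longrightarrow>
        (\<exists>S \<subseteq> V. card S = l \<and> clique S E \<or> card S = k \<and> indep S E))"

definition ramsey_number :: "nat \<Rightarrow> nat \<Rightarrow> nat" where
  "ramsey_number l k = (LEAST N. ramsey_arrows N l k)"

lemma ramsey_arrows_any_graph:
  fixes V :: "'a set"
  assumes N: "ramsey_arrows N l k" and V: "finite V" "card V = N" and E: "E \<subseteq> [V]\<^bsup>2\<^esup>"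
  shows "\<exists>S \<subseteq> V. card S = l \<and> clique S E \<or> card S = k \<and> indep S E"
proof -
  obtain f :: "nat \<Rightarrow> 'a" where f: "bij_betw f {..<N} V"
    using ex_bij_betw_nat_finite[OF V(1)] V(2) by (auto simp: lessThan_atLeast0)
  define F where "F = {e \<in> [{..<N}]\<^bsup>2\<^esup>. f ` e \<in> E}"
  have "\<exists>S \<subseteq> {..<N}. card S = l \<and> clique S F \<or> card S = k \<and> indep S F"
    using N unfolding ramsey_arrows_def by (auto simp: F_def)
  then obtain S where S: "S \<subseteq> {..<N}"
    and "card S = l \<and> clique S F \<or> card S = k \<and> indep S F" by blast
  moreover have "inj_on f S"
    using f S by (auto simp: bij_betw_def intro: inj_on_subset)
  moreover have edge: "{f v, f w} \<in> E \<longleftrightarrow> {v, w} \<in> F" if "v \<in> S" "w \<in> S" "v \<noteq> w" for v w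
    using that S by (auto simp: F_def)
  have "clique S F \<Longrightarrow> clique (f ` S) E"
    unfolding clique_def using edge by (metis imageE)
  moreover have "indep S F \<Longrightarrow> indep (f ` S) E"
    unfolding indep_def using edge by (metis imageE)
  ultimately have "card (f ` S) = l \<and> clique (f ` S) E \<or> card (f ` S) = k \<and> indep (f ` S) E"
    by (metis card_image)
  moreover have "f ` S \<subseteq> V"
    using f S by (auto simp: bij_betw_def)
  ultimately show ?thesis by blast
qed

lemma ramsey_arrows_ramsey_number: "ramsey_arrows (ramsey_number l k) l k"
proof -
  obtain r where "\<forall>(V::nat set) E. finite V \<and> card V \<ge> r \<longrightarrow>
      (\<exists>S \<subseteq> V. card S = l \<and> clique S E \<or> card S = k \<and> indep S E)"
    using ramsey2[where 'a = nat and m = l and n = k] by blast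
  then have "ramsey_arrows r l k"
    unfolding ramsey_arrows_def by blast
  then show ?thesis
    unfolding ramsey_number_def by (rule LeastI)
qed

end

(*
  Let n be about (1/2 - d) k^2 / ln k. Take two independent random graphs of density p, where p is
  slightly larger than (ln k) / k, on a base set of N = k^2 / (ln k)^3 vertices, remove a maximal
  family of edge-disjoint triangles from each, and blow both up to the vertex set {..<n} along two
  independent random maps f1, f2 to the base set. The final graph consists of the pairs that are
  adjacent in one blow-up and have no common neighbour in the other; it is triangle-free. Because
  the blow-ups are coarse, a typical pair has no common neighbour, so few edges are lost.

  Let S be a set of k vertices with projections of size a k and b k. Up to factors k^{o(k)}, the
  number of such sets is k^{(a + b - 1) k}, and the edges inside the two projections are absent with
  probability k^{-(a^2 + b^2) k / 2}. Since a + b - 1 <= (a^2 + b^2) / 2, any surplus in p suffices.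
  The sets that contain large parts of the neighbourhoods of a few vertices are treated separately:
  there many pairs are closed, but the stars themselves are unlikely, and this pays for the loss as
  long as the degrees in each blow-up are smaller than k / 2, that is, n p < k / 2.
*)
theory Submission
  imports Defs "HOL-Real_Asymp.Real_Asymp"
begin

text \<open>The blow-ups resolve a conflict of densities. Placed directly on \<open>n\<close>
  vertices, a graph of density about (ln k) / k has about (ln k) / 2 common neighbours per pair, so
  most pairs would be closed; on the base set the number is only about 1 / (ln k). The price is that
  vertices of one fibre look alike: a set made of few fibres is cheaply independent in that blow-up.
  The second map repairs this, because few sets collapse under both maps. The inequality between a
  and b is (1 - a)^2 + (1 - b)^2 \<ge> 0, tight at a = b = 1. So typical sets leave no room at
  density (ln k) / k, and every loss is paid from the surplus \<open>\<eta>\<close>. Together with n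
  p < k / 2 this is the origin of the constant 1/2. Errors come in two sizes. For a fixed set, most
  failures have probability at most exp (-4 k ln k), which beats the number of \<open>k\<close>-sets
  outright. Only the main event, few edges on the projections given the star patterns, is of the
  same order as that number and needs a sum weighted by projection sizes.\<close>

section \<open>Random subsets\<close>

text \<open>
  Expectation over the random subset \<open>X\<close> of \<open>E\<close> that contains each element independently with
  probability \<open>p\<close>.
\<close>

definition rs_exp :: "'a set \<Rightarrow> real \<Rightarrow> ('a set \<Rightarrow> real) \<Rightarrow> real" where
  "rs_exp E p g = (\<Sum>X\<in>Pow E. p ^ card X * (1 - p) ^ card (E - X) * g X)"

abbreviation rs_prob :: "'a set \<Rightarrow> real \<Rightarrow> ('a set \<Rightarrow> bool) \<Rightarrow> real" where
  "rs_prob E p P \<equiv> rs_exp E p (\<lambda>X. of_bool (P X))"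

lemma rs_exp_add: "rs_exp E p (\<lambda>X. g X + h X) = rs_exp E p g + rs_exp E p h"
  by (simp add: rs_exp_def algebra_simps sum.distrib)

lemma rs_exp_cmult: "rs_exp E p (\<lambda>X. c * g X) = c * rs_exp E p g"
  by (simp add: rs_exp_def sum_distrib_left algebra_simps)

lemma rs_exp_cmult_right: "rs_exp E p (\<lambda>X. g X * c) = rs_exp E p g * c"
  using rs_exp_cmult[of E p c g] by (simp add: mult.commute)

lemma rs_exp_sum: "rs_exp E p (\<lambda>X. \<Sum>i\<in>I. g i X) = (\<Sum>i\<in>I. rs_exp E p (g i))"
  unfolding rs_exp_def by (subst sum.swap) (simp add: sum_distrib_left)

lemma rs_exp_mono:
  assumes "0 \<le> p" "p \<le> 1" "\<And>X. X \<subseteq> E \<Longrightarrow> g X \<le> h X"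
  shows "rs_exp E p g \<le> rs_exp E p h"
  unfolding rs_exp_def using assms by (intro sum_mono mult_left_mono) auto

lemma rs_exp_cong: "(\<And>X. X \<subseteq> E \<Longrightarrow> g X = h X) \<Longrightarrow> rs_exp E p g = rs_exp E p h"
  unfolding rs_exp_def by (intro sum.cong) auto

lemma rs_exp_nonneg:
  assumes "0 \<le> p" "p \<le> 1" "\<And>X. X \<subseteq> E \<Longrightarrow> 0 \<le> g X"
  shows "0 \<le> rs_exp E p g"
  unfolding rs_exp_def using assms by (intro sum_nonneg mult_nonneg_nonneg) auto

lemma rs_exp_swap:
  "rs_exp E p (\<lambda>X. rs_exp F q (\<lambda>Y. g X Y)) = rs_exp F q (\<lambda>Y. rs_exp E p (\<lambda>X. g X Y))"
  unfolding rs_exp_def sum_distrib_left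
  by (subst sum.swap) (simp add: mult.left_commute)

lemma rs_exp_Un:
  assumes fin: "finite E" "finite F" and disj: "E \<inter> F = {}"
  shows "rs_exp (E \<union> F) p g = rs_exp E p (\<lambda>X. rs_exp F p (\<lambda>Y. g (X \<union> Y)))"
proof -
  have bij: "bij_betw (\<lambda>(X, Y). X \<union> Y) (Pow E \<times> Pow F) (Pow (E \<union> F))"
    by (rule bij_betwI[where g = "\<lambda>Z. (Z \<inter> E, Z \<inter> F)"]) (use disj in auto)
  have "rs_exp (E \<union> F) p g = (\<Sum>(X, Y)\<in>Pow E \<times> Pow F.
      p ^ card (X \<union> Y) * (1 - p) ^ card ((E \<union> F) - (X \<union> Y)) * g (X \<union> Y))"
    unfolding rs_exp_def by (subst sum.reindex_bij_betw[OF bij, symmetric]) (simp add: case_prod_unfold)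
  also have "\<dots> = (\<Sum>(X, Y)\<in>Pow E \<times> Pow F.
      p ^ card X * (1 - p) ^ card (E - X) * (p ^ card Y * (1 - p) ^ card (F - Y) * g (X \<union> Y)))"
  proof (intro sum.cong refl)
    fix Z assume "Z \<in> Pow E \<times> Pow F"
    then obtain X Y where Z: "Z = (X, Y)" and XY: "X \<subseteq> E" "Y \<subseteq> F" by auto
    have "card (X \<union> Y) = card X + card Y"
      using XY fin disj by (intro card_Un_disjoint) (auto intro: finite_subset)
    moreover have "E \<union> F - (X \<union> Y) = (E - X) \<union> (F - Y)"
      using XY disj by auto
    moreover have "card ((E - X) \<union> (F - Y)) = card (E - X) + card (F - Y)"
      using fin disj by (intro card_Un_disjoint) auto
    ultimately show "(case Z of (X, Y) \<Rightarrow>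
          p ^ card (X \<union> Y) * (1 - p) ^ card (E \<union> F - (X \<union> Y)) * g (X \<union> Y)) =
        (case Z of (X, Y) \<Rightarrow>
          p ^ card X * (1 - p) ^ card (E - X) * (p ^ card Y * (1 - p) ^ card (F - Y) * g (X \<union> Y)))"
      by (simp add: power_add Z)
  qed
  also have "\<dots> = rs_exp E p (\<lambda>X. rs_exp F p (\<lambda>Y. g (X \<union> Y)))"
    unfolding rs_exp_def sum_distrib_left
    by (subst sum.cartesian_product) (simp add: case_prod_unfold)
  finally show ?thesis .
qed

lemma rs_exp_empty [simp]: "rs_exp {} p g = g {}"
  by (simp add: rs_exp_def)

lemma rs_exp_singleton: "rs_exp {e} p g = (1 - p) * g {} + p * g {e}"
  by (simp add: rs_exp_def Pow_insert)

lemma rs_exp_insert: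
  assumes "finite E" "e \<notin> E"
  shows "rs_exp (insert e E) p g = (1 - p) * rs_exp E p g + p * rs_exp E p (\<lambda>X. g (insert e X))"
proof -
  have "rs_exp ({e} \<union> E) p g = rs_exp {e} p (\<lambda>X. rs_exp E p (\<lambda>Y. g (X \<union> Y)))"
    using assms by (intro rs_exp_Un) auto
  then show ?thesis by (simp add: rs_exp_singleton)
qed

lemma rs_exp_const [simp]: "finite E \<Longrightarrow> rs_exp E p (\<lambda>_. c) = c"
  by (induction E rule: finite_induct) (auto simp: rs_exp_insert algebra_simps)

text \<open>All exponential moments below reduce to this factorisation; \<open>t\<close> and
  \<open>s\<close> are the factors of a present and of an absent element.\<close>

lemma rs_exp_prod:
  assumes "finite E"
  shows "rs_exp E p (\<lambda>X. \<Prod>e\<in>E. if e \<in> X then t e else s e) = (\<Prod>e\<in>E. p * t e + (1 - p) * s e)"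
  using assms
proof (induction E rule: finite_induct)
  case (insert x F)
  have eq1: "rs_exp F p (\<lambda>X. \<Prod>e\<in>insert x F. if e \<in> X then t e else s e)
      = s x * rs_exp F p (\<lambda>X. \<Prod>e\<in>F. if e \<in> X then t e else s e)"
    unfolding rs_exp_cmult[symmetric] using insert.hyps
    by (intro rs_exp_cong) (auto simp: subset_iff)
  have eq2: "rs_exp F p (\<lambda>X. \<Prod>e\<in>insert x F. if e \<in> insert x X then t e else s e)
      = t x * rs_exp F p (\<lambda>X. \<Prod>e\<in>F. if e \<in> X then t e else s e)"
    unfolding rs_exp_cmult[symmetric]
  proof (intro rs_exp_cong)
    fix X assume "X \<subseteq> F"
    have "(\<Prod>e\<in>F. if e \<in> insert x X then t e else s e) = (\<Prod>e\<in>F. if e \<in> X then t e else s e)"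
      using insert.hyps by (intro prod.cong) auto
    then show "(\<Prod>e\<in>insert x F. if e \<in> insert x X then t e else s e) =
         t x * (\<Prod>e\<in>F. if e \<in> X then t e else s e)"
      using insert.hyps by (simp del: insert_iff add: insert_iff[of x x X])
  qed
  show ?case
    unfolding rs_exp_insert[OF insert.hyps] eq1 eq2 insert.IH
    unfolding prod.insert[OF insert.hyps] by (simp add: algebra_simps)
qed simp

text \<open>Splitting \<open>E\<close> into \<open>E \<inter> A\<close> and \<open>E - A\<close>
  gives a double expectation in which \<open>g\<close> sees only the outer sample and
  \<open>h\<close> only the inner one. Dependence on a part is expressed as invariance under
  intersection with it.\<close>

lemma rs_exp_indep:
  assumes fin: "finite E" and AB: "A \<inter> B = {}"
    and g: "\<And>X. X \<subseteq> E \<Longrightarrow> g X = g (X \<inter> A)" and h: "\<And>X. X \<subseteq> E \<Longrightarrow> h X = h (X \<inter> B)"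
  shows "rs_exp E p (\<lambda>X. g X * h X) = rs_exp E p g * rs_exp E p h"
proof -
  define F where "F = E \<inter> A"
  define F' where "F' = E - A"
  have E: "E = F \<union> F'" "F \<inter> F' = {}" "finite F" "finite F'"
    using fin by (auto simp: F_def F'_def)
  have Un: "rs_exp E p q = rs_exp F p (\<lambda>X. rs_exp F' p (\<lambda>Y. q (X \<union> Y)))" for q
    by (subst E(1), rule rs_exp_Un) (use E in auto)
  have gXY: "g (X \<union> Y) = g X" and hXY: "h (X \<union> Y) = h Y" if "X \<subseteq> F" "Y \<subseteq> F'" for X Y
  proof -
    have XY: "X \<union> Y \<subseteq> E" "X \<subseteq> E" "Y \<subseteq> E" and "(X \<union> Y) \<inter> A = X \<inter> A" "(X \<union> Y) \<inter> B = Y \<inter> B"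
      using that AB by (auto simp: F_def F'_def)
    then show "g (X \<union> Y) = g X" "h (X \<union> Y) = h Y"
      using g[OF XY(1)] g[OF XY(2)] h[OF XY(1)] h[OF XY(3)] by simp_all
  qed
  have "rs_exp E p g = rs_exp F p g"
    unfolding Un using E(4) by (intro rs_exp_cong) (simp add: gXY cong: rs_exp_cong)
  moreover have "rs_exp E p h = rs_exp F' p h"
    unfolding Un
    by (subst rs_exp_cong[where h = "\<lambda>_. rs_exp F' p h"]) (auto intro!: rs_exp_cong simp: hXY E)
  moreover have "rs_exp E p (\<lambda>X. g X * h X) = rs_exp F p (\<lambda>X. rs_exp F' p h * g X)"
    unfolding Un
    by (intro rs_exp_cong) (simp add: gXY hXY rs_exp_cmult[symmetric] mult.commute cong: rs_exp_cong)
  ultimately show ?thesis by (simp add: rs_exp_cmult)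
qed

lemma rs_exp_indep_prod:
  assumes "finite E" "finite I"
    and "\<And>i j. i \<in> I \<Longrightarrow> j \<in> I \<Longrightarrow> i \<noteq> j \<Longrightarrow> B i \<inter> B j = {}"
    and "\<And>i X. i \<in> I \<Longrightarrow> X \<subseteq> E \<Longrightarrow> g i X = g i (X \<inter> B i)"
  shows "rs_exp E p (\<lambda>X. \<Prod>i\<in>I. g i X) = (\<Prod>i\<in>I. rs_exp E p (g i))"
  using assms(2-)
proof (induction I rule: finite_induct)
  case (insert i I)
  have "rs_exp E p (\<lambda>X. g i X * (\<Prod>j\<in>I. g j X)) = rs_exp E p (g i) * rs_exp E p (\<lambda>X. \<Prod>j\<in>I. g j X)"
  proof (rule rs_exp_indep[OF assms(1), of "B i" "\<Union>j\<in>I. B j"])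
    show "B i \<inter> (\<Union>j\<in>I. B j) = {}"
    proof -
      have "B i \<inter> B j = {}" if "j \<in> I" for j
        using insert.prems(1)[of i j] insert.hyps that by auto
      then show ?thesis by blast
    qed
    show "g i X = g i (X \<inter> B i)" if "X \<subseteq> E" for X
      using insert.prems(2)[OF _ that] by simp
    show "(\<Prod>j\<in>I. g j X) = (\<Prod>j\<in>I. g j (X \<inter> (\<Union>j\<in>I. B j)))" if "X \<subseteq> E" for X
    proof (intro prod.cong refl)
      fix j assume j: "j \<in> I"
      have "g j X = g j (X \<inter> B j)" using insert.prems(2)[OF _ that] j by simp
      also have "X \<inter> B j = (X \<inter> (\<Union>j\<in>I. B j)) \<inter> B j" using j by auto
      also have "g j \<dots> = g j (X \<inter> (\<Union>j\<in>I. B j))"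
        by (rule insert.prems(2)[symmetric]) (use j that in auto)
      finally show "g j X = g j (X \<inter> (\<Union>j\<in>I. B j))" .
    qed
  qed
  then show ?case using insert by simp
qed (simp add: assms(1))

lemma rs_prob_Ex_le:
  assumes "0 \<le> p" "p \<le> 1" "finite I" "\<And>X. X \<subseteq> E \<Longrightarrow> P X \<Longrightarrow> \<exists>i\<in>I. Q i X"
  shows "rs_prob E p P \<le> (\<Sum>i\<in>I. rs_prob E p (Q i))"
  unfolding rs_exp_sum[symmetric]
proof (intro rs_exp_mono assms(1,2))
  fix X assume X: "X \<subseteq> E"
  show "of_bool (P X) \<le> (\<Sum>i\<in>I. of_bool (Q i X) :: real)"
  proof (cases "P X")
    case True
    then obtain i where i: "i \<in> I" "Q i X" using assms(4) X by blast
    have "(of_bool (Q i X) :: real) \<le> (\<Sum>i\<in>I. of_bool (Q i X))"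
      using i assms(3) by (intro member_le_sum) auto
    then show ?thesis using i True by simp
  qed (auto intro: sum_nonneg)
qed

lemma rs_prob_Ex_le_bound:
  assumes "0 \<le> p" "p \<le> 1" "finite I" "\<And>X. X \<subseteq> E \<Longrightarrow> P X \<Longrightarrow> \<exists>i\<in>I. Q i X"
    and "\<And>i. i \<in> I \<Longrightarrow> rs_prob E p (Q i) \<le> b" "real (card I) \<le> c" "0 \<le> b"
  shows "rs_prob E p P \<le> c * b"
proof -
  have "rs_prob E p P \<le> (\<Sum>i\<in>I. rs_prob E p (Q i))" by (rule rs_prob_Ex_le) (use assms in auto)
  also have "\<dots> \<le> card I * b" using sum_bounded_above[of I _ b] assms(5) by fastforce
  also have "\<dots> \<le> c * b" using assms by (intro mult_right_mono) auto
  finally show ?thesis .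
qed

lemma rs_prob_markov:
  assumes "0 \<le> p" "p \<le> 1" and "\<And>X. X \<subseteq> E \<Longrightarrow> P X \<Longrightarrow> c \<le> f X" "\<And>X. X \<subseteq> E \<Longrightarrow> 0 \<le> f X" "c > 0"
  shows "rs_prob E p P \<le> rs_exp E p f / c"
proof -
  have "rs_prob E p P \<le> rs_exp E p (\<lambda>X. (1/c) * f X)"
    by (intro rs_exp_mono assms) (use assms in \<open>auto simp: of_bool_def field_simps\<close>)
  then show ?thesis unfolding rs_exp_cmult by simp
qed

lemma rs_exp_exp_weight:
  assumes "finite E" "A \<subseteq> E" "0 \<le> p" "p \<le> 1"
  shows "rs_exp E p (\<lambda>X. exp (\<Sum>e\<in>X \<inter> A. \<theta> e)) \<le> exp (p * (\<Sum>e\<in>A. exp (\<theta> e) - 1))"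
proof -
  have finA: "finite A" using assms by (auto intro: finite_subset)
  have "rs_exp E p (\<lambda>X. exp (\<Sum>e\<in>X \<inter> A. \<theta> e))
      = rs_exp E p (\<lambda>X. \<Prod>e\<in>E. if e \<in> X then (if e \<in> A then exp (\<theta> e) else 1) else 1)"
  proof (intro rs_exp_cong)
    fix X assume X: "X \<subseteq> E"
    have "exp (\<Sum>e\<in>X \<inter> A. \<theta> e) = (\<Prod>e\<in>X \<inter> A. exp (\<theta> e))"
      using finA by (simp add: exp_sum)
    also have "\<dots> = (\<Prod>e\<in>E. if e \<in> X \<inter> A then exp (\<theta> e) else 1)"
      using assms X by (subst prod.inter_restrict[symmetric]) (auto intro!: prod.cong)
    finally show "exp (\<Sum>e\<in>X \<inter> A. \<theta> e) = (\<Prod>e\<in>E. if e \<in> X then (if e \<in> A then exp (\<theta> e) else 1) else 1)"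
      by (auto intro!: prod.cong)
  qed
  also have "\<dots> = (\<Prod>e\<in>E. p * (if e \<in> A then exp (\<theta> e) else 1) + (1 - p) * 1)"
    by (rule rs_exp_prod[OF assms(1)])
  also have "\<dots> = (\<Prod>e\<in>E. if e \<in> A then 1 + p * (exp (\<theta> e) - 1) else 1)"
    by (intro prod.cong) (auto simp: algebra_simps)
  also have "\<dots> = (\<Prod>e\<in>A. 1 + p * (exp (\<theta> e) - 1))"
    using assms by (subst prod.inter_restrict[symmetric]) (auto intro!: prod.cong)
  also have "\<dots> \<le> (\<Prod>e\<in>A. exp (p * (exp (\<theta> e) - 1)))"
  proof (intro prod_mono conjI exp_ge_add_one_self)
    fix e
    have "0 \<le> (1 - p) + p * exp (\<theta> e)" using assms by simp
    then show "0 \<le> 1 + p * (exp (\<theta> e) - 1)" by (simp add: algebra_simps)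
  qed
  also have "\<dots> = exp (p * (\<Sum>e\<in>A. exp (\<theta> e) - 1))"
    using finA by (simp add: exp_sum sum_distrib_left)
  finally show ?thesis .
qed

lemma rs_prob_upper_tail:
  assumes "finite E" "A \<subseteq> E" "0 \<le> p" "p \<le> 1" "l \<ge> 0"
  shows "rs_prob E p (\<lambda>X. s \<le> real (card (X \<inter> A))) \<le> exp (- l * s + p * card A * exp l)"
proof -
  have "rs_prob E p (\<lambda>X. s \<le> real (card (X \<inter> A))) \<le> rs_exp E p (\<lambda>X. exp (\<Sum>e\<in>X \<inter> A. l)) / exp (l * s)"
    by (intro rs_prob_markov) (use assms in \<open>auto simp: mult.commute intro!: mult_left_mono\<close>)
  also have "\<dots> \<le> exp (p * (\<Sum>e\<in>A. exp l - 1)) / exp (l * s)"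
    by (intro divide_right_mono rs_exp_exp_weight) (use assms in auto)
  also have "\<dots> = exp (p * (card A * (exp l - 1)) - l * s)"
    by (simp add: exp_diff)
  also have "\<dots> \<le> exp (- l * s + p * card A * exp l)"
    using assms by (auto simp: algebra_simps)
  finally show ?thesis .
qed

text \<open>Applied with star edges as \<open>A\<close> and the core as \<open>T\<close>. A large
  constant \<open>l\<close> brings the rate p * (1 - exp (- l)) close to \<open>p\<close>, and the
  price exp (l * s) is affordable when the number \<open>s\<close> of tolerated elements is
  small.\<close>

lemma rs_prob_sparse:
  assumes "finite E" "A \<subseteq> E" "T \<subseteq> E" "A \<inter> T = {}" "0 \<le> p" "p \<le> 1" "l \<ge> 0"
  shows "rs_prob E p (\<lambda>X. A \<subseteq> X \<and> real (card (X \<inter> T)) \<le> s)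
    \<le> p ^ card A * exp (l * s - p * (1 - exp (- l)) * card T)"
proof -
  have fin: "finite A" "finite T" using assms by (auto intro: finite_subset)
  \<comment> \<open>\<open>G\<close> vanishes unless \<open>A\<close> is contained in
    \<open>X\<close>, and otherwise has a factor exp (- l) for each element of \<open>T\<close> in
    \<open>X\<close>; so it is at least exp (- l * s) on the event.\<close>
  define G where "G X = (\<Prod>e\<in>E. if e \<in> X then (if e \<in> T then exp (- l) else 1) else (if e \<in> A then 0 else 1))" for X
  have G: "G X = exp (- l * card (X \<inter> T))" if "A \<subseteq> X" "X \<subseteq> E" for X
  proof -
    have EXT: "E \<inter> (X \<inter> T) = X \<inter> T" using that by auto
    have "G X = (\<Prod>e\<in>E. if e \<in> X \<inter> T then exp (- l) else 1)"
      unfolding G_def using that by (intro prod.cong) auto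
    also have "\<dots> = (\<Prod>e\<in>X \<inter> T. exp (- l))"
      using assms(1) EXT by (subst prod.inter_restrict[symmetric]) auto
    also have "\<dots> = exp (- l * card (X \<inter> T))"
      by (simp add: exp_of_nat_mult[symmetric] mult.commute)
    finally show ?thesis .
  qed
  have Gnn: "0 \<le> G X" for X unfolding G_def by (intro prod_nonneg) auto
  have "rs_prob E p (\<lambda>X. A \<subseteq> X \<and> real (card (X \<inter> T)) \<le> s) \<le> rs_exp E p G / exp (- l * s)"
    by (intro rs_prob_markov) (use assms Gnn in \<open>auto simp: G intro!: mult_left_mono\<close>)
  also have "rs_exp E p G = (\<Prod>e\<in>E. p * (if e \<in> T then exp (- l) else 1) + (1 - p) * (if e \<in> A then 0 else 1))"
    unfolding G_def by (rule rs_exp_prod[OF assms(1)])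
  also have "\<dots> = (\<Prod>e\<in>E. (if e \<in> A then p else 1) * (if e \<in> T then 1 - p * (1 - exp (- l)) else 1))"
    using assms(4) by (intro prod.cong) (auto simp: algebra_simps)
  also have "\<dots> = (\<Prod>e\<in>A. p) * (\<Prod>e\<in>T. 1 - p * (1 - exp (- l)))"
    unfolding prod.distrib using assms(1) Int_absorb1[OF assms(2)] Int_absorb1[OF assms(3)]
    by (simp only: prod.inter_restrict[symmetric])
  also have "\<dots> \<le> (\<Prod>e\<in>A. p) * (\<Prod>e\<in>T. exp (- (p * (1 - exp (- l)))))"
  proof (intro mult_left_mono prod_mono conjI)
    have "p * (1 - exp (- l)) \<le> 1 * 1" using assms by (intro mult_mono) auto
    then show "0 \<le> 1 - p * (1 - exp (- l))" by simp
    show "1 - p * (1 - exp (- l)) \<le> exp (- (p * (1 - exp (- l))))"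
      using exp_ge_add_one_self[of "- (p * (1 - exp (- l)))"] by simp
  qed (use assms in auto)
  also have "\<dots> / exp (- l * s) = p ^ card A * exp (l * s - p * (1 - exp (- l)) * card T)"
    (is "?lhs / _ = _")
  proof -
    have "exp (- (p * (1 - exp (- l)))) ^ card T = exp (- (p * (1 - exp (- l))) * card T)"
      by (rule exp_of_nat2_mult[symmetric])
    moreover have "exp (l * s - p * (1 - exp (- l)) * card T)
        = exp (- (p * (1 - exp (- l))) * card T) / exp (- l * s)"
      unfolding exp_diff[symmetric] by (simp add: algebra_simps)
    ultimately show ?thesis by simp
  qed
  finally show ?thesis by (simp add: divide_right_mono)
qed

lemma rs_prob_superset_le:
  assumes "finite E" "A \<subseteq> E" "0 \<le> p" "p \<le> 1"
  shows "rs_prob E p (\<lambda>X. A \<subseteq> X) \<le> p ^ card A"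
  using rs_prob_sparse[of E A "{}" p 0 0] assms by simp

section \<open>Tail bounds for random graphs\<close>

lemma card_le_fibers:
  assumes "finite T" "\<And>s. s \<in> S \<Longrightarrow> f s \<in> T" "\<And>t. t \<in> T \<Longrightarrow> real (card {s \<in> S. f s = t}) \<le> c" "finite S"
  shows "real (card S) \<le> c * real (card T)"
proof -
  have "card S = card (\<Union>t\<in>T. {s \<in> S. f s = t})"
    by (rule arg_cong[where f = card]) (use assms(2) in auto)
  also have "\<dots> \<le> (\<Sum>t\<in>T. card {s \<in> S. f s = t})"
    by (rule card_UN_le[OF assms(1)])
  finally have "real (card S) \<le> (\<Sum>t\<in>T. real (card {s \<in> S. f s = t}))"
    by (metis of_nat_le_iff of_nat_sum)
  also have "\<dots> \<le> (\<Sum>t\<in>T. c)"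
    by (intro sum_mono assms)
  finally show ?thesis by (simp add: mult.commute)
qed

lemma power_div_fact_le_exp:
  fixes x :: real
  assumes "0 \<le> x"
  shows "x ^ n / fact n \<le> exp x"
proof -
  have "sum (\<lambda>n. x ^ n /\<^sub>R fact n) {n} \<le> (\<Sum>n. x ^ n /\<^sub>R fact n)"
    using assms summable_exp_generic[of x] by (intro sum_le_suminf) auto
  then show ?thesis by (simp add: exp_def divide_inverse mult.commute)
qed

lemma binomial_le_power: "n choose r \<le> n ^ r" for n r :: nat
  by (cases "r \<le> n") (auto simp: binomial_le_pow binomial_eq_0)

lemma binomial_le_exp:
  assumes "t > 0"
  shows "real (m choose t) \<le> (exp 1 * real m / real t) ^ t"
proof -
  have "real (m choose t) * fact t \<le> real m ^ t"
    using binomial_fact_pow[of m t] by (metis of_nat_fact of_nat_le_iff of_nat_mult of_nat_power)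
  then have "real (m choose t) \<le> real m ^ t / fact t"
    by (simp add: pos_le_divide_eq)
  also have "\<dots> = (real m / t) ^ t * (real t ^ t / fact t)"
    using assms by (simp add: field_simps)
  also have "\<dots> \<le> (real m / t) ^ t * exp t"
    by (intro mult_left_mono power_div_fact_le_exp) auto
  also have "\<dots> = (exp 1 * real m / real t) ^ t"
    using exp_of_nat_mult[of t "1::real"] by (simp add: field_simps)
  finally show ?thesis .
qed

text \<open>The count is a sum over base pairs with weights at most \<open>b\<close>. As l * b \<le>
  1, the exponential is nearly linear on the range that occurs, so clumping into fibres costs only a
  factor 1 + l * b over the mean p * card U.\<close>

lemma exp_count_le:
  assumes E: "finite E" and U: "finite U" and p: "0 \<le> p" "p \<le> 1"
    and fib: "\<And>e. e \<in> E \<Longrightarrow> real (card {u \<in> U. \<tau> u = e}) \<le> b" and l: "0 \<le> l" "l * b \<le> 1" and b: "0 \<le> b"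
  shows "rs_exp E p (\<lambda>X. exp (l * card {u \<in> U. \<tau> u \<in> X})) \<le> exp (p * (l * (1 + l * b)) * card U)"
proof -
  define W where "W e = card {u \<in> U. \<tau> u = e}" for e
  have UN: "card {u \<in> U. \<tau> u \<in> X} = (\<Sum>e\<in>X. W e)" if "finite X" for X
  proof -
    have "{u \<in> U. \<tau> u \<in> X} = (\<Union>e\<in>X. {u \<in> U. \<tau> u = e})" by auto
    moreover have "card (\<Union>e\<in>X. {u \<in> U. \<tau> u = e}) = (\<Sum>e\<in>X. W e)"
      unfolding W_def by (rule card_UN_disjoint) (use that U in auto)
    ultimately show ?thesis by simp
  qed
  have "rs_exp E p (\<lambda>X. exp (l * card {u \<in> U. \<tau> u \<in> X})) = rs_exp E p (\<lambda>X. exp (\<Sum>e\<in>X \<inter> E. l * W e))"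
  proof (intro rs_exp_cong)
    fix X assume "X \<subseteq> E"
    then have "X \<inter> E = X" "finite X" using E finite_subset by auto
    then show "exp (l * card {u \<in> U. \<tau> u \<in> X}) = exp (\<Sum>e\<in>X \<inter> E. l * W e)"
      by (simp add: UN sum_distrib_left)
  qed
  also have "\<dots> \<le> exp (p * (\<Sum>e\<in>E. exp (l * W e) - 1))"
    by (rule rs_exp_exp_weight) (use E p in auto)
  also have "(\<Sum>e\<in>E. exp (l * W e) - 1) \<le> (\<Sum>e\<in>E. l * (1 + l * b) * W e)"
  proof (intro sum_mono)
    fix e assume "e \<in> E"
    then have Wb: "W e \<le> b" using fib by (simp add: W_def)
    then have lW: "l * W e \<le> l * b" using l by (intro mult_left_mono) auto
    have "exp (l * W e) \<le> 1 + l * W e + (l * W e)\<^sup>2"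
      using lW l by (intro exp_bound) auto
    also have "(l * W e)\<^sup>2 \<le> (l * b) * (l * W e)"
      unfolding power2_eq_square using lW l by (intro mult_right_mono) auto
    finally show "exp (l * W e) - 1 \<le> l * (1 + l * b) * W e" by (simp add: algebra_simps)
  qed
  also have "\<dots> = l * (1 + l * b) * card {u \<in> U. \<tau> u \<in> E}"
    by (simp add: UN E sum_distrib_left)
  also have "\<dots> \<le> l * (1 + l * b) * card U"
    using U l b by (intro mult_left_mono) (auto intro: card_mono)
  finally show ?thesis using p by (simp add: mult_left_mono mult.assoc)
qed

section \<open>Codegrees, degrees and closed pairs of the blow-ups\<close>

abbreviation pairs :: "nat \<Rightarrow> nat set set" where
  "pairs N \<equiv> [{..<N}]\<^bsup>2\<^esup>"

lemma finite_pairs [simp]: "finite (pairs N)"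
  by (simp add: finite_imp_finite_nsets)

abbreviation links :: "('v \<Rightarrow> nat) \<Rightarrow> 'v set \<Rightarrow> nat set set \<Rightarrow> nat \<Rightarrow> 'v set" where
  "links f R X d \<equiv> {u \<in> R. {f u, d} \<in> X}"

abbreviation wedges :: "('v \<Rightarrow> nat) \<Rightarrow> 'v set \<Rightarrow> nat set set \<Rightarrow> nat \<Rightarrow> ('v \<times> 'v) set" where
  "wedges f R X d \<equiv> {(u, v) \<in> R \<times> R. f u \<noteq> f v \<and> {f u, d} \<in> X \<and> {f v, d} \<in> X}"

text \<open>First moment over two vertices and \<open>g\<close> common neighbours: the 2 * g pairs
  involved are distinct.\<close>

lemma codegree_tail:
  assumes p: "0 \<le> p" "p \<le> 1"
  shows "rs_prob (pairs N) p (\<lambda>X. \<exists>a<N. \<exists>b<N. a \<noteq> b \<and> g \<le> card {d. {a, d} \<in> X \<and> {b, d} \<in> X})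
    \<le> (real N)\<^sup>2 * (real N * p\<^sup>2) ^ g"
proof -
  define I where "I = {(a, b, W). a < N \<and> b < N \<and> a \<noteq> b \<and> W \<in> [{..<N} - {a, b}]\<^bsup>g\<^esup>}"
  define Q where "Q = (\<lambda>(a, b, W) X. (\<lambda>d. {a, d}) ` W \<union> (\<lambda>d. {b, d}) ` W \<subseteq> (X :: nat set set))"
  have I: "I \<subseteq> {..<N} \<times> {..<N} \<times> [{..<N}]\<^bsup>g\<^esup>"
    unfolding I_def using nsets_mono[of "{..<N} - {_, _}" "{..<N}" g] by auto
  have finJ: "finite ({..<N} \<times> {..<N} \<times> [{..<N}]\<^bsup>g\<^esup>)"
    by (simp add: finite_imp_finite_nsets)
  have "card I \<le> N * (N * (N choose g))"
    using card_mono[OF finJ I] by (simp add: card_cartesian_product)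
  also have "\<dots> \<le> N * (N * N ^ g)"
    by (intro mult_left_mono binomial_le_power le0)
  finally have cI: "card I \<le> N\<^sup>2 * N ^ g" by (simp add: power2_eq_square)
  have "rs_prob (pairs N) p (\<lambda>X. \<exists>a<N. \<exists>b<N. a \<noteq> b \<and> g \<le> card {d. {a, d} \<in> X \<and> {b, d} \<in> X})
      \<le> real (N\<^sup>2 * N ^ g) * (p ^ (2 * g))"
  proof (rule rs_prob_Ex_le_bound[where I = I and Q = Q])
    fix X assume X: "X \<subseteq> pairs N" and "\<exists>a<N. \<exists>b<N. a \<noteq> b \<and> g \<le> card {d. {a, d} \<in> X \<and> {b, d} \<in> X}"
    then obtain a b where ab: "a < N" "b < N" "a \<noteq> b" "g \<le> card {d. {a, d} \<in> X \<and> {b, d} \<in> X}" by auto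
    obtain W where W: "W \<subseteq> {d. {a, d} \<in> X \<and> {b, d} \<in> X}" "card W = g" "finite W"
      using obtain_subset_with_card_n[OF ab(4)] by blast
    have "W \<subseteq> {..<N} - {a, b}"
    proof
      fix d assume "d \<in> W"
      then have "{a, d} \<in> pairs N" "{b, d} \<in> pairs N" using W(1) X by blast+
      then show "d \<in> {..<N} - {a, b}" by auto
    qed
    then have "(a, b, W) \<in> I" using ab W by (auto simp: I_def nsets_def)
    moreover have "Q (a, b, W) X" using W by (auto simp: Q_def)
    ultimately show "\<exists>i\<in>I. Q i X" by blast
  next
    fix i assume i: "i \<in> I"
    obtain a b W where iW: "i = (a, b, W)" by (cases i) auto
    have ab: "a < N" "b < N" "a \<noteq> b" and W: "W \<subseteq> {..<N} - {a, b}" "finite W" "card W = g"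
      using i by (auto simp: I_def iW nsets_def)
    define A where "A = (\<lambda>d. {a, d}) ` W \<union> (\<lambda>d. {b, d}) ` W"
    have "card A = card ((\<lambda>d. {a, d}) ` W) + card ((\<lambda>d. {b, d}) ` W)"
      unfolding A_def using W ab by (intro card_Un_disjoint) (auto simp: doubleton_eq_iff)
    also have "\<dots> = 2 * g"
      using W by (subst (1 2) card_image) (auto simp: inj_on_def doubleton_eq_iff)
    finally have "card A = 2 * g" .
    moreover have "A \<subseteq> pairs N" unfolding A_def using W ab by auto
    ultimately show "rs_prob (pairs N) p (Q i) \<le> p ^ (2 * g)"
      using rs_prob_superset_le[of "pairs N" A p] p by (simp add: Q_def iW A_def)
  qed (use p finite_subset[OF I finJ] cI[THEN of_nat_mono[where 'a = real]] in auto)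
  also have "\<dots> = (real N)\<^sup>2 * (real N * p\<^sup>2) ^ g"
    by (simp add: power_mult_distrib power_mult)
  finally show ?thesis .
qed

text \<open>A union bound over base vertices. The exponent compares \<open>x\<close> with the mean
  degree p * card V up to the factor 1 + l * b; this precision is needed because the degree bound
  will exceed the mean only by a constant factor close to 1.\<close>

lemma weighted_degree_tail:
  fixes f :: "'v \<Rightarrow> nat"
  assumes p: "0 \<le> p" "p \<le> 1" and V: "finite V"
    and fib: "\<And>D. real (card {u \<in> V. f u = D}) \<le> b" and l: "0 \<le> l" "l * b \<le> 1" and b: "0 \<le> b"
  shows "rs_prob (pairs N) p (\<lambda>X. \<exists>d<N. x \<le> real (card (links f V X d)))
    \<le> real N * exp (p * (l * (1 + l * b)) * card V - l * x)"
proof (rule rs_prob_Ex_le_bound[where I = "{..<N}" and Q = "\<lambda>d X. x \<le> real (card (links f V X d))"])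
  fix d assume "d \<in> {..<N}"
  \<comment> \<open>With \<open>d\<close> fixed, a pair determines its other end, so these fibres
    lie in fibres of \<open>f\<close>.\<close>
  have fib': "real (card {u \<in> V. {f u, d} = e}) \<le> b" for e
  proof -
    have "\<exists>D. {u \<in> V. {f u, d} = e} \<subseteq> {u \<in> V. f u = D}"
    proof (cases "\<exists>D. e = {D, d}")
      case True
      then show ?thesis by (auto simp: doubleton_eq_iff)
    qed auto
    then obtain D where "{u \<in> V. {f u, d} = e} \<subseteq> {u \<in> V. f u = D}" by blast
    then have "card {u \<in> V. {f u, d} = e} \<le> card {u \<in> V. f u = D}"
      using V by (intro card_mono) auto
    then show ?thesis using fib[of D] by linarith
  qed
  have "rs_prob (pairs N) p (\<lambda>X. x \<le> real (card (links f V X d)))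
      \<le> rs_exp (pairs N) p (\<lambda>X. exp (l * card (links f V X d))) / exp (l * x)"
    by (intro rs_prob_markov p) (use l in \<open>auto intro!: mult_left_mono\<close>)
  also have "\<dots> \<le> exp (p * (l * (1 + l * b)) * card V) / exp (l * x)"
    by (intro divide_right_mono exp_count_le p fib' V l b) auto
  finally show "rs_prob (pairs N) p (\<lambda>X. x \<le> real (card (links f V X d)))
      \<le> exp (p * (l * (1 + l * b)) * card V - l * x)"
    by (simp add: exp_diff)
qed (use p in auto)

text \<open>Double counting: a base pair is met with \<open>d\<close> at either of its ends, each
  time by at most \<open>b\<close> elements in the fibre over the other end.\<close>

lemma incidence_le:
  fixes f :: "'v \<Rightarrow> nat"
  assumes "finite R" "finite M" "finite A"
    and fib: "\<And>D. real (card {u \<in> R. f u = D}) \<le> b"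
    and A: "\<And>u d. u \<in> R \<Longrightarrow> d \<in> M \<Longrightarrow> {f u, d} \<in> X \<Longrightarrow> {f u, d} \<in> A"
    and X2: "X \<subseteq> pairs N"
  shows "(\<Sum>d\<in>M. real (card (links f R X d))) \<le> 2 * b * card A"
proof -
  define S where "S = (SIGMA d:M. (links f R X d))"
  have finS: "finite S" unfolding S_def using assms by auto
  have "(\<Sum>d\<in>M. real (card (links f R X d))) = real (card S)"
    unfolding S_def using assms by (simp add: card_SigmaI)
  also have "\<dots> \<le> (2 * b) * card (A \<inter> X)"
  proof (rule card_le_fibers[where f = "\<lambda>(d, u). {f u, d}"])
    show "real (card {s \<in> S. (case s of (d, u) \<Rightarrow> {f u, d}) = e}) \<le> 2 * b" if e: "e \<in> A \<inter> X" for e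
    proof -
      obtain x y where xy: "e = {x, y}" using e X2 by (auto elim!: nsets2_E)
      have "{s \<in> S. (case s of (d, u) \<Rightarrow> {f u, d}) = e} \<subseteq>
          Pair y ` {u \<in> R. f u = x} \<union> Pair x ` {u \<in> R. f u = y}"
        by (auto simp: S_def xy doubleton_eq_iff)
      then have "card {s \<in> S. (case s of (d, u) \<Rightarrow> {f u, d}) = e} \<le>
          card (Pair y ` {u \<in> R. f u = x} \<union> Pair x ` {u \<in> R. f u = y})"
        using assms by (intro card_mono) auto
      also have "\<dots> \<le> card (Pair y ` {u \<in> R. f u = x}) + card (Pair x ` {u \<in> R. f u = y})"
        by (rule card_Un_le)
      also have "\<dots> \<le> card {u \<in> R. f u = x} + card {u \<in> R. f u = y}"
        using assms by (intro add_mono card_image_le) auto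
      finally show ?thesis using fib[of x] fib[of y] by linarith
    qed
  qed (use assms finS in \<open>auto simp: S_def\<close>)
  also have "\<dots> \<le> (2 * b) * card A"
    using fib[of undefined] assms by (intro mult_left_mono) (auto intro!: card_mono intro: order.trans[OF of_nat_0_le_iff])
  finally show ?thesis .
qed

text \<open>If \<open>m\<close> base vertices have degree above \<open>T\<close> into
  \<open>R\<close>, then by \<open>incidence_le\<close> at least m * T / (2 * b) of the at most m *
  k pairs between them and the image of \<open>R\<close> are present. The factor N ^ m counts the
  choices of these vertices.\<close>

lemma large_degrees_tail:
  fixes f :: "'v \<Rightarrow> nat"
  assumes p: "0 \<le> p" "p \<le> 1" and R: "finite R" "card R \<le> k" "f ` R \<subseteq> {..<N}"
    and fib: "\<And>D. real (card {u \<in> R. f u = D}) \<le> b" and l: "0 \<le> l" and b: "0 < b"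
  shows "rs_prob (pairs N) p (\<lambda>X. m \<le> card {d\<in>{..<N}. T < real (card (links f R X d))})
    \<le> real N ^ m * exp (- l * (m * T / (2 * b)) + p * (real m * real k) * exp l)"
proof -
  define Q where "Q M X \<longleftrightarrow> (\<forall>d\<in>M. T < real (card (links f R X d)))" for M X
  have "card ([{..<N}]\<^bsup>m\<^esup>) \<le> N ^ m"
    by (simp add: binomial_le_power)
  then have cI: "real (card ([{..<N}]\<^bsup>m\<^esup>)) \<le> real N ^ m"
    by (metis of_nat_le_iff of_nat_power)
  show ?thesis
  proof (rule rs_prob_Ex_le_bound[where I = "[{..<N}]\<^bsup>m\<^esup>" and Q = Q])
    fix X assume "m \<le> card {d\<in>{..<N}. T < real (card (links f R X d))}"
    then obtain M where "M \<subseteq> {d\<in>{..<N}. T < real (card (links f R X d))}" "card M = m" "finite M"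
      using obtain_subset_with_card_n by blast
    then show "\<exists>M\<in>[{..<N}]\<^bsup>m\<^esup>. Q M X" by (intro bexI[of _ M]) (auto simp: nsets_def Q_def)
  next
    fix M assume M: "M \<in> [{..<N}]\<^bsup>m\<^esup>"
    then have finM: "finite M" and MN: "M \<subseteq> {..<N}" "card M = m" by (auto simp: nsets_def)
    define A where "A = (\<lambda>(D, d). {D, d}) ` (f ` R \<times> M) \<inter> pairs N"
    have "card A \<le> card ((\<lambda>(D, d). {D, d}) ` (f ` R \<times> M))"
      unfolding A_def using R finM by (intro card_mono) auto
    also have "\<dots> \<le> card (f ` R) * m"
      using card_image_le[of "f ` R \<times> M" "\<lambda>(D, d). {D, d}"] R finM MN by (simp add: card_cartesian_product)
    also have "\<dots> \<le> k * m" using card_image_le[of R f] R by (intro mult_right_mono) auto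
    finally have cA: "real (card A) \<le> real m * real k"
      by (metis mult.commute of_nat_le_iff of_nat_mult)
    have "rs_prob (pairs N) p (Q M) \<le> rs_prob (pairs N) p (\<lambda>X. m * T / (2 * b) \<le> real (card (X \<inter> A)))"
    proof (intro rs_exp_mono p)
      fix X assume X: "X \<subseteq> pairs N"
      have "m * T / (2 * b) \<le> real (card (X \<inter> A))" if "Q M X"
      proof -
        have "m * T = (\<Sum>d\<in>M. T)" using MN by simp
        also have "\<dots> \<le> (\<Sum>d\<in>M. real (card (links f R X d)))"
          using that by (intro sum_mono) (auto simp: Q_def less_imp_le)
        also have "(\<Sum>d\<in>M. real (card (links f R X d))) \<le> 2 * b * card (X \<inter> A)"
        proof (rule incidence_le[OF _ _ _ fib _ X])
          fix u d assume ud: "u \<in> R" "d \<in> M" "{f u, d} \<in> X"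
          then have "{f u, d} \<in> pairs N" using X by blast
          then show "{f u, d} \<in> X \<inter> A" using ud by (auto simp: A_def)
        qed (use R finM in \<open>auto simp: A_def\<close>)
        finally show ?thesis using b by (simp add: field_simps)
      qed
      then show "of_bool (Q M X) \<le> (of_bool (m * T / (2 * b) \<le> real (card (X \<inter> A))) :: real)" by auto
    qed
    also have "\<dots> \<le> exp (- l * (m * T / (2 * b)) + p * card A * exp l)"
      by (rule rs_prob_upper_tail) (use p l in \<open>auto simp: A_def\<close>)
    also have "\<dots> \<le> exp (- l * (m * T / (2 * b)) + p * (real m * real k) * exp l)"
      using cA p by (auto intro!: mult_right_mono mult_left_mono)
    finally show "rs_prob (pairs N) p (Q M) \<le> exp (- l * (m * T / (2 * b)) + p * (real m * real k) * exp l)" .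
  qed (use p cI in \<open>auto simp: finite_imp_finite_nsets\<close>)
qed

text \<open>The two prescribed edges contribute at most 2 * b to the count, and the rest of the
  count, over \<open>U'\<close>, is independent of them. This estimates one wedge under an
  exponential weight.\<close>

lemma exp_count_two_le:
  assumes E: "finite E" and U: "finite U" and p: "0 \<le> p" "p \<le> 1"
    and fib: "\<And>e. e \<in> E \<Longrightarrow> real (card {u \<in> U. \<tau> u = e}) \<le> b" and l: "0 \<le> l" "l * b \<le> 1" and b: "0 \<le> b"
    and xy: "x \<noteq> y"
  shows "rs_exp E p (\<lambda>X. of_bool (x \<in> X \<and> y \<in> X) * exp (l * card {u \<in> U. \<tau> u \<in> X}))
    \<le> p\<^sup>2 * exp (2 * (l * b)) * exp (p * (l * (1 + l * b)) * card U)"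
proof (cases "x \<in> E \<and> y \<in> E")
  case False
  have "rs_exp E p (\<lambda>X. of_bool (x \<in> X \<and> y \<in> X) * exp (l * card {u \<in> U. \<tau> u \<in> X})) = rs_exp E p (\<lambda>X. 0)"
    by (intro rs_exp_cong) (use False in auto)
  then show ?thesis using E by simp
next
  case True
  define U' where "U' = {u \<in> U. \<tau> u \<noteq> x \<and> \<tau> u \<noteq> y}"
  define g where "g X = exp (l * card {u \<in> U'. \<tau> u \<in> X})" for X
  have g_le: "exp (l * card {u \<in> U. \<tau> u \<in> X}) \<le> exp (2 * (l * b)) * g X" if "x \<in> X" "y \<in> X" for X
  proof -
    have "card {u \<in> U. \<tau> u \<in> X} = card ({u \<in> U. \<tau> u = x} \<union> ({u \<in> U. \<tau> u = y} \<union> {u \<in> U'. \<tau> u \<in> X}))"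
      using that by (intro arg_cong[where f = card]) (auto simp: U'_def)
    then have "card {u \<in> U. \<tau> u \<in> X} \<le> card {u \<in> U. \<tau> u = x} + (card {u \<in> U. \<tau> u = y} + card {u \<in> U'. \<tau> u \<in> X})"
      using card_Un_le[of "{u \<in> U. \<tau> u = x}" "{u \<in> U. \<tau> u = y} \<union> {u \<in> U'. \<tau> u \<in> X}"]
        card_Un_le[of "{u \<in> U. \<tau> u = y}" "{u \<in> U'. \<tau> u \<in> X}"] by linarith
    then have "real (card {u \<in> U. \<tau> u \<in> X}) \<le> 2 * b + card {u \<in> U'. \<tau> u \<in> X}"
      using fib[of x] fib[of y] True by linarith
    then have "l * card {u \<in> U. \<tau> u \<in> X} \<le> l * (2 * b + card {u \<in> U'. \<tau> u \<in> X})"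
      using l by (intro mult_left_mono)
    then show ?thesis by (simp add: g_def exp_add[symmetric] algebra_simps)
  qed
  have "rs_exp E p (\<lambda>X. of_bool (x \<in> X \<and> y \<in> X) * exp (l * card {u \<in> U. \<tau> u \<in> X}))
      \<le> rs_exp E p (\<lambda>X. exp (2 * (l * b)) * (of_bool ({x, y} \<subseteq> X) * g X))"
    by (intro rs_exp_mono p) (use g_le in \<open>auto simp: mult_ac\<close>)
  also have "\<dots> = exp (2 * (l * b)) * (rs_prob E p (\<lambda>X. {x, y} \<subseteq> X) * rs_exp E p g)"
    unfolding rs_exp_cmult
    by (subst rs_exp_indep[OF E, of "{x, y}" "- {x, y}"])
      (auto simp: g_def U'_def intro!: arg_cong[where f = card])
  also have "\<dots> \<le> exp (2 * (l * b)) * (p ^ card {x, y} * exp (p * (l * (1 + l * b)) * card U))"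
  proof (intro mult_left_mono mult_mono rs_prob_superset_le)
    have "rs_exp E p g \<le> exp (p * (l * (1 + l * b)) * card U')"
      unfolding g_def
    proof (rule exp_count_le)
      fix e assume "e \<in> E"
      have "card {u \<in> U'. \<tau> u = e} \<le> card {u \<in> U. \<tau> u = e}"
        using U by (intro card_mono) (auto simp: U'_def)
      then show "real (card {u \<in> U'. \<tau> u = e}) \<le> b" using fib[OF \<open>e \<in> E\<close>] by linarith
    qed (use E U p l b in \<open>auto simp: U'_def\<close>)
    also have "\<dots> \<le> exp (p * (l * (1 + l * b)) * card U)"
      using p l b U by (auto intro!: mult_left_mono card_mono simp: U'_def)
    finally show "rs_exp E p g \<le> exp (p * (l * (1 + l * b)) * card U)" .
    show "0 \<le> rs_exp E p g" by (intro rs_exp_nonneg p) (simp add: g_def)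
  qed (use True p E in auto)
  also have "\<dots> = p\<^sup>2 * exp (2 * (l * b)) * exp (p * (l * (1 + l * b)) * card U)"
    using xy by (simp add: mult_ac power2_eq_square)
  finally show ?thesis .
qed

text \<open>The number of wedges at \<open>d\<close> is quadratic in the degree, but for degrees up
  to \<open>T\<close> it is at most \<open>T\<close> times the degree; at the scale c / T
  exponential moments of the degree suffice. Only \<open>d\<close> outside the image of
  \<open>R\<close> are summed: their sets of pairs to the image are disjoint, so the contributions
  are independent.\<close>

lemma closed_pairs_tail:
  fixes f :: "'v \<Rightarrow> nat" and R :: "'v set"
  defines "dg \<equiv> \<lambda>X d. real (card (links f R X d))"
  defines "Z \<equiv> \<lambda>X d. real (card (wedges f R X d))"
  assumes p: "0 \<le> p" "p \<le> 1" and R: "finite R" "card R \<le> k"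
    and fib: "\<And>D. real (card {u \<in> R. f u = D}) \<le> b" and b: "0 \<le> b"
    and c: "0 \<le> c" "c * b \<le> 1" "2 * p * c * k \<le> 1" and T: "0 < T"
  shows "rs_prob (pairs N) p (\<lambda>X. z \<le> (\<Sum>d\<in>{..<N} - f ` R. if dg X d \<le> T then Z X d else 0))
    \<le> exp (- (c / T) * z + (c / T) * (exp 3 * (k * p)\<^sup>2) * N)"
proof -
  define l where "l = c / T"
  have l: "0 \<le> l" "l * T = c" using c T by (auto simp: l_def)
  define q where "q X d = (if dg X d \<le> T then Z X d else 0)" for X d
  define P where "P = {(u, v) \<in> R \<times> R. f u \<noteq> f v}"
  have finP: "finite P" and cP: "card P \<le> k * k"
  proof -
    show "finite P" unfolding P_def by (rule finite_subset[of _ "R \<times> R"]) (use R in auto)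
    have "card P \<le> card (R \<times> R)" unfolding P_def using R by (intro card_mono) auto
    also have "\<dots> \<le> k * k" using R by (simp add: card_cartesian_product mult_mono)
    finally show "card P \<le> k * k" .
  qed
  have ZP: "Z X d = (\<Sum>w\<in>P. of_bool ({f (fst w), d} \<in> X \<and> {f (snd w), d} \<in> X))" for X d
  proof -
    have "wedges f R X d =
        P \<inter> {(u, v). {f u, d} \<in> X \<and> {f v, d} \<in> X}" by (auto simp: P_def)
    then show ?thesis unfolding Z_def using finP
      by (simp add: case_prod_unfold of_bool_def sum.If_cases)
  qed
  have Zle: "Z X d \<le> dg X d * dg X d" for X d
  proof -
    have "card (wedges f R X d) \<le>
        card ((links f R X d) \<times> (links f R X d))"
      using R by (intro card_mono) auto
    then show ?thesis unfolding Z_def dg_def card_cartesian_product of_nat_mult[symmetric] of_nat_le_iff .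
  qed
  have one: "rs_exp (pairs N) p (\<lambda>X. exp (l * q X d)) \<le> exp (l * (exp 3 * (k * p)\<^sup>2))" for d
  proof -
    have fib': "real (card {u \<in> R. {f u, d} = e}) \<le> b" for e
    proof -
      have "\<exists>D. {u \<in> R. {f u, d} = e} \<subseteq> {u \<in> R. f u = D}"
      proof (cases "\<exists>D. e = {D, d}")
        case True
        then show ?thesis by (auto simp: doubleton_eq_iff)
      qed auto
      then obtain D where "{u \<in> R. {f u, d} = e} \<subseteq> {u \<in> R. f u = D}" by blast
      then have "card {u \<in> R. {f u, d} = e} \<le> card {u \<in> R. f u = D}"
        using R by (intro card_mono) auto
      then show ?thesis using fib[of D] by linarith
    qed
    have pt: "exp (l * q X d) \<le> 1 + l * (Z X d * exp (c * dg X d))" for X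
    proof (cases "dg X d \<le> T")
      case True
      have Z0: "0 \<le> Z X d" by (simp add: Z_def)
      have d0: "0 \<le> dg X d" by (simp add: dg_def)
      have "l * Z X d \<le> l * (dg X d * dg X d)" using Zle l by (intro mult_left_mono)
      also have "\<dots> \<le> l * (T * dg X d)" using True l d0 by (intro mult_left_mono mult_right_mono)
      finally have le: "l * Z X d \<le> c * dg X d" using l by (simp add: mult.assoc[symmetric])
      \<comment> \<open>This leads to exp y \<le> 1 + y * exp y, which keeps \<open>Z\<close> as a
        factor; its wedges carry the small probability p^2.\<close>
      have "1 + - (l * Z X d) \<le> exp (- (l * Z X d))" by (rule exp_ge_add_one_self)
      then have "exp (l * Z X d) * (1 - l * Z X d) \<le> exp (l * Z X d) * exp (- (l * Z X d))"
        by (intro mult_left_mono) auto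
      then have "exp (l * Z X d) \<le> 1 + l * Z X d * exp (l * Z X d)"
        by (simp add: exp_add[symmetric] algebra_simps)
      also have "\<dots> \<le> 1 + l * Z X d * exp (c * dg X d)"
        using le l Z0 by (intro add_left_mono mult_left_mono) auto
      finally show ?thesis using True by (simp add: q_def mult.assoc)
    next
      case False
      then show ?thesis using l by (auto simp: q_def Z_def)
    qed
    have "rs_exp (pairs N) p (\<lambda>X. exp (l * q X d)) \<le> rs_exp (pairs N) p (\<lambda>X. 1 + l * (Z X d * exp (c * dg X d)))"
      by (intro rs_exp_mono p pt)
    also have "\<dots> = 1 + l * rs_exp (pairs N) p (\<lambda>X. Z X d * exp (c * dg X d))"
      by (simp add: rs_exp_add rs_exp_cmult)
    also have "rs_exp (pairs N) p (\<lambda>X. Z X d * exp (c * dg X d)) =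
        (\<Sum>w\<in>P. rs_exp (pairs N) p (\<lambda>X. of_bool ({f (fst w), d} \<in> X \<and> {f (snd w), d} \<in> X) * exp (c * dg X d)))"
      unfolding rs_exp_sum[symmetric]
      by (intro rs_exp_cong) (simp add: ZP sum_distrib_right case_prod_unfold)
    also have "\<dots> \<le> (\<Sum>w\<in>P. exp 3 * p\<^sup>2)"
    proof (intro sum_mono)
      fix w assume w: "w \<in> P"
      have "rs_exp (pairs N) p (\<lambda>X. of_bool ({f (fst w), d} \<in> X \<and> {f (snd w), d} \<in> X) * exp (c * dg X d))
          \<le> p\<^sup>2 * exp (2 * (c * b)) * exp (p * (c * (1 + c * b)) * card R)"
        unfolding dg_def
        by (rule exp_count_two_le[where \<tau> = "\<lambda>u. {f u, d}"])
          (use w in \<open>auto simp: P_def doubleton_eq_iff intro: fib' R p c b\<close>)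
      also have "\<dots> \<le> p\<^sup>2 * exp 2 * exp 1"
      proof -
        have "p * (c * (1 + c * b)) * card R \<le> p * (c * 2) * k"
          using p c b R by (intro mult_mono mult_left_mono) auto
        then show ?thesis using c by (intro mult_mono) (auto simp: mult_ac)
      qed
      also have "\<dots> = exp 3 * p\<^sup>2" by (simp add: exp_add[symmetric])
      finally show "rs_exp (pairs N) p (\<lambda>X. of_bool ({f (fst w), d} \<in> X \<and> {f (snd w), d} \<in> X) * exp (c * dg X d))
          \<le> exp 3 * p\<^sup>2" .
    qed
    also have "(\<Sum>w\<in>P. exp 3 * p\<^sup>2) \<le> real (k * k) * (exp 3 * p\<^sup>2)"
      unfolding sum_constant using cP by (intro mult_right_mono) (auto simp del: of_nat_mult)
    also have "\<dots> = exp 3 * (k * p)\<^sup>2" by (simp add: power2_eq_square)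
    also have "1 + l * (exp 3 * (k * p)\<^sup>2) \<le> exp (l * (exp 3 * (k * p)\<^sup>2))"
      by (rule exp_ge_add_one_self)
    finally show ?thesis using l by (simp add: mult_left_mono)
  qed
  have "rs_prob (pairs N) p (\<lambda>X. z \<le> (\<Sum>d\<in>{..<N} - f ` R. q X d))
      \<le> rs_exp (pairs N) p (\<lambda>X. \<Prod>d\<in>{..<N} - f ` R. exp (l * q X d)) / exp (l * z)"
    by (intro rs_prob_markov p)
      (use l in \<open>auto simp: exp_sum[symmetric] sum_distrib_left[symmetric] intro!: mult_left_mono prod_nonneg\<close>)
  also have "rs_exp (pairs N) p (\<lambda>X. \<Prod>d\<in>{..<N} - f ` R. exp (l * q X d))
      = (\<Prod>d\<in>{..<N} - f ` R. rs_exp (pairs N) p (\<lambda>X. exp (l * q X d)))"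
  proof (rule rs_exp_indep_prod[where B = "\<lambda>d. {{D, d} | D. D \<in> f ` R}"])
    fix d X
    have eq: "{f u, d} \<in> X \<inter> {{D, d} |D. D \<in> f ` R} \<longleftrightarrow> {f u, d} \<in> X" if "u \<in> R" for u
      using that by auto
    have "dg (X \<inter> {{D, d} |D. D \<in> f ` R}) d = dg X d"
      unfolding dg_def using eq by (metis (no_types, lifting))
    moreover have "Z (X \<inter> {{D, d} |D. D \<in> f ` R}) d = Z X d"
      unfolding ZP
      by (intro sum.cong refl arg_cong[where f = of_bool] arg_cong2[where f = "(\<and>)"] eq) (auto simp: P_def)
    ultimately show "exp (l * q X d) = exp (l * q (X \<inter> {{D, d} |D. D \<in> f ` R}) d)"
      by (simp add: q_def)
  qed (auto simp: doubleton_eq_iff)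
  also have "\<dots> \<le> (\<Prod>d\<in>{..<N} - f ` R. exp (l * (exp 3 * (k * p)\<^sup>2)))"
    by (intro prod_mono conjI one rs_exp_nonneg p) auto
  also have "\<dots> = exp (l * (exp 3 * (k * p)\<^sup>2) * card ({..<N} - f ` R))"
    by (simp add: exp_of_nat2_mult[symmetric])
  also have "\<dots> \<le> exp (l * (exp 3 * (k * p)\<^sup>2) * N)"
    using l card_mono[of "{..<N}" "{..<N} - f ` R"] by (auto intro!: mult_left_mono)
  finally show ?thesis
    by (simp add: q_def l_def exp_diff exp_add exp_minus divide_right_mono field_simps)
qed

section \<open>Packings of edge-disjoint triangles\<close>

definition edge_disjoint :: "nat set set \<Rightarrow> bool" where
  "edge_disjoint F \<longleftrightarrow> (\<forall>A\<in>F. \<forall>B\<in>F. A \<noteq> B \<longrightarrow> [A]\<^bsup>2\<^esup> \<inter> [B]\<^bsup>2\<^esup> = {})"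

abbreviation edges_of :: "nat set set \<Rightarrow> nat set set" where
  "edges_of F \<equiv> (\<Union>A\<in>F. [A]\<^bsup>2\<^esup>)"

definition triangle_packing :: "nat \<Rightarrow> nat set set \<Rightarrow> nat set set \<Rightarrow> bool" where
  "triangle_packing N X F \<longleftrightarrow> F \<subseteq> [{..<N}]\<^bsup>3\<^esup> \<and> edge_disjoint F \<and> (\<forall>A\<in>F. [A]\<^bsup>2\<^esup> \<subseteq> X)"

lemma triangles_at_le:
  assumes "finite Q"
  shows "card {A \<in> [{..<N}]\<^bsup>3\<^esup>. [A]\<^bsup>2\<^esup> \<inter> [Q]\<^bsup>2\<^esup> \<noteq> {}} \<le> (card Q)\<^sup>2 * N"
proof -
  have "{A \<in> [{..<N}]\<^bsup>3\<^esup>. [A]\<^bsup>2\<^esup> \<inter> [Q]\<^bsup>2\<^esup> \<noteq> {}} \<subseteq> (\<lambda>(x, y, z). {x, y, z}) ` (Q \<times> Q \<times> {..<N})"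
  proof
    fix A assume A: "A \<in> {A \<in> [{..<N}]\<^bsup>3\<^esup>. [A]\<^bsup>2\<^esup> \<inter> [Q]\<^bsup>2\<^esup> \<noteq> {}}"
    then obtain e where "e \<in> [A]\<^bsup>2\<^esup>" "e \<in> [Q]\<^bsup>2\<^esup>" by auto
    then obtain x y where xy: "x \<in> Q" "y \<in> Q" "x \<noteq> y" "x \<in> A" "y \<in> A"
      by (auto elim!: nsets2_E simp: doubleton_eq_iff)
    have A': "A \<subseteq> {..<N}" "card A = 3" "finite A" using A by (auto simp: nsets_def)
    have "card (A - {x, y}) = 1" using A' xy by (subst card_Diff_subset) auto
    then obtain z where z: "A - {x, y} = {z}" by (auto simp: card_1_singleton_iff)
    then have "A = {x, y, z}" "z \<in> A" using xy by auto
    then show "A \<in> (\<lambda>(x, y, z). {x, y, z}) ` (Q \<times> Q \<times> {..<N})"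
      using xy A' by (intro image_eqI[of _ _ "(x, y, z)"]) auto
  qed
  then have "card {A \<in> [{..<N}]\<^bsup>3\<^esup>. [A]\<^bsup>2\<^esup> \<inter> [Q]\<^bsup>2\<^esup> \<noteq> {}} \<le> card ((\<lambda>(x, y, z). {x, y, z}) ` (Q \<times> Q \<times> {..<N}))"
    using assms by (intro card_mono) auto
  also have "\<dots> \<le> card (Q \<times> Q \<times> {..<N})" using assms by (intro card_image_le) auto
  finally show ?thesis by (simp add: card_cartesian_product power2_eq_square mult.assoc)
qed

text \<open>Edge-disjointness makes the 3 * t edges distinct, so a given packing of \<open>t\<close>
  triangles is present with probability at most p ^ (3 * t). Triangles that share edges would be
  likelier to occur together, which is why a packing is removed.\<close>

lemma triangle_packing_tail:
  assumes p: "0 \<le> p" "p \<le> 1" and Q: "finite Q" "card Q \<le> k" and t: "t > 0"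
  shows "rs_prob (pairs N) p (\<lambda>X. \<exists>F. triangle_packing N X F \<and> (\<forall>A\<in>F. [A]\<^bsup>2\<^esup> \<inter> [Q]\<^bsup>2\<^esup> \<noteq> {}) \<and> t \<le> card F)
    \<le> (exp 1 * ((real k)\<^sup>2 * N * p ^ 3) / t) ^ t"
proof -
  define Tri where "Tri = {A \<in> [{..<N}]\<^bsup>3\<^esup>. [A]\<^bsup>2\<^esup> \<inter> [Q]\<^bsup>2\<^esup> \<noteq> {}}"
  have finTri: "finite Tri" unfolding Tri_def by (simp add: finite_imp_finite_nsets)
  define I where "I = {F \<in> [Tri]\<^bsup>t\<^esup>. edge_disjoint F}"
  have "card I \<le> card ([Tri]\<^bsup>t\<^esup>)"
    unfolding I_def using finTri by (intro card_mono) (auto simp: finite_imp_finite_nsets)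
  then have "real (card I) \<le> real (card Tri choose t)" using finTri by simp
  also have "\<dots> \<le> (exp 1 * real (card Tri) / t) ^ t" by (rule binomial_le_exp[OF t])
  also have "\<dots> \<le> (exp 1 * real (k\<^sup>2 * N) / t) ^ t"
  proof -
    have "card Tri \<le> (card Q)\<^sup>2 * N" unfolding Tri_def by (rule triangles_at_le[OF Q(1)])
    also have "\<dots> \<le> k\<^sup>2 * N" using Q by (intro mult_right_mono power_mono) auto
    finally have "real (card Tri) \<le> real (k\<^sup>2 * N)" by linarith
    then show ?thesis by (intro power_mono divide_right_mono mult_left_mono) auto
  qed
  finally have cI: "real (card I) \<le> (exp 1 * real (k\<^sup>2 * N) / t) ^ t" .
  have "rs_prob (pairs N) p (\<lambda>X. \<exists>F. triangle_packing N X F \<and> (\<forall>A\<in>F. [A]\<^bsup>2\<^esup> \<inter> [Q]\<^bsup>2\<^esup> \<noteq> {}) \<and> t \<le> card F)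
      \<le> (exp 1 * real (k\<^sup>2 * N) / t) ^ t * p ^ (3 * t)"
  proof (rule rs_prob_Ex_le_bound[where I = I and Q = "\<lambda>F X. edges_of F \<subseteq> X"])
    fix X assume "\<exists>F. triangle_packing N X F \<and> (\<forall>A\<in>F. [A]\<^bsup>2\<^esup> \<inter> [Q]\<^bsup>2\<^esup> \<noteq> {}) \<and> t \<le> card F"
    then obtain F where F: "triangle_packing N X F" "\<forall>A\<in>F. [A]\<^bsup>2\<^esup> \<inter> [Q]\<^bsup>2\<^esup> \<noteq> {}" "t \<le> card F" by blast
    obtain G where G: "G \<subseteq> F" "card G = t" "finite G"
      using obtain_subset_with_card_n[OF F(3)] by blast
    have "F \<subseteq> Tri" using F by (auto simp: Tri_def triangle_packing_def)
    moreover have "edge_disjoint G"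
      unfolding edge_disjoint_def
    proof (intro ballI impI)
      fix A B assume "A \<in> G" "B \<in> G" "A \<noteq> B"
      then show "[A]\<^bsup>2\<^esup> \<inter> [B]\<^bsup>2\<^esup> = {}"
        using F(1) G(1) unfolding triangle_packing_def edge_disjoint_def by blast
    qed
    ultimately have "G \<in> I" using G by (simp add: I_def nsets_def[of Tri])
    moreover have "(\<Union>A\<in>G. [A]\<^bsup>2\<^esup>) \<subseteq> X" using F G by (auto simp: triangle_packing_def)
    ultimately show "\<exists>F\<in>I. edges_of F \<subseteq> X" by blast
  next
    fix F assume "F \<in> I"
    then have FT: "F \<subseteq> Tri" "finite F" "card F = t" "edge_disjoint F"
      by (auto simp: I_def nsets_def[of Tri])
    then have F: "F \<subseteq> [{..<N}]\<^bsup>3\<^esup>" "finite F" "card F = t" "edge_disjoint F"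
      by (auto simp: Tri_def)
    have "card (edges_of F) = (\<Sum>A\<in>F. card ([A]\<^bsup>2\<^esup>))"
      using F by (intro card_UN_disjoint) (auto simp: edge_disjoint_def intro!: finite_imp_finite_nsets simp: nsets_def)
    also have "\<dots> = (\<Sum>A\<in>F. 3)"
      by (intro sum.cong refl) (use F in \<open>auto simp: nsets_def[of _ 3] choose_two\<close>)
    also have "\<dots> = 3 * t" using F by simp
    finally have "card (edges_of F) = 3 * t" .
    moreover have "edges_of F \<subseteq> pairs N" using F by (auto simp: nsets_def)
    ultimately show "rs_prob (pairs N) p (\<lambda>X. edges_of F \<subseteq> X) \<le> p ^ (3 * t)"
      using rs_prob_superset_le[of "pairs N" "\<Union>A\<in>F. [A]\<^bsup>2\<^esup>" p] p by simp
  qed (use p cI finTri in \<open>auto simp: I_def finite_imp_finite_nsets\<close>)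
  also have "\<dots> = (exp 1 * ((real k)\<^sup>2 * N * p ^ 3) / t) ^ t"
    unfolding power_mult power_mult_distrib[symmetric] by (simp add: field_simps)
  finally show ?thesis .
qed

section \<open>Star patterns\<close>

definition closed_pair :: "nat set set \<Rightarrow> ('v \<Rightarrow> nat) \<Rightarrow> 'v \<Rightarrow> 'v \<Rightarrow> bool" where
  "closed_pair X f u v \<longleftrightarrow> (\<exists>d. {f u, d} \<in> X \<and> {f v, d} \<in> X)"

text \<open>
  A labelling \<open>\<phi>\<close> assigns to a base vertex \<open>D\<close> a neighbour \<open>\<phi> D\<close> of large degree; \<open>\<phi> D = N\<close>, which
  is not a base vertex, encodes that \<open>D\<close> has none.
\<close>

definition stray_pairs :: "nat \<Rightarrow> nat set set \<Rightarrow> ('v \<Rightarrow> nat) \<Rightarrow> 'v set \<Rightarrow> (nat \<Rightarrow> nat) \<Rightarrow> ('v \<times> 'v) set" where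
  "stray_pairs N X f R \<phi> =
    {(u, v) \<in> R \<times> R. closed_pair X f u v \<and> \<not> (\<phi> (f u) = \<phi> (f v) \<and> \<phi> (f u) < N)}"

lemma card_preimage_le:
  assumes "finite R" "finite M" "\<And>D. real (card {u \<in> R. f u = D}) \<le> b"
  shows "real (card {u \<in> R. f u \<in> M}) \<le> b * card M"
proof (rule card_le_fibers[where f = f])
  fix D assume "D \<in> M"
  have "card {s \<in> {u \<in> R. f u \<in> M}. f s = D} \<le> card {u \<in> R. f u = D}"
    using assms by (intro card_mono) auto
  then show "real (card {s \<in> {u \<in> R. f u \<in> M}. f s = D}) \<le> b" using assms(3)[of D] by linarith
qed (use assms in auto)

text \<open>\<open>M\<close> contains all base vertices of large degree, and \<open>\<phi>\<close>
  picks for a projected vertex a neighbour in \<open>M\<close>. A closed pair not explained by equal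
  labels belongs to one of five small classes: same fibre, closed through a vertex of small degree
  outside or inside the image of \<open>R\<close>, an end projected into \<open>M\<close>, an end
  projected to a vertex with two neighbours in \<open>M\<close>. The summands of the bound appear in
  this order.\<close>

lemma star_pattern:
  fixes f :: "'v \<Rightarrow> nat" and R :: "'v set" and X
  defines "dg \<equiv> \<lambda>d. real (card (links f R X d))"
  defines "Z \<equiv> \<lambda>d. real (card (wedges f R X d))"
  assumes X: "X \<subseteq> pairs N" and R: "finite R" "card R \<le> k" "f ` R \<subseteq> {..<N}"
    and fib: "\<And>D. real (card {u \<in> R. f u = D}) \<le> b"
    and large: "card {d\<in>{..<N}. T < dg d} \<le> m" "m \<le> N" and T: "0 \<le> T"
    and small: "(\<Sum>d\<in>{..<N} - f ` R. if dg d \<le> T then Z d else 0) \<le> z"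
    and edges: "real (card (X \<inter> [f ` R]\<^bsup>2\<^esup>)) \<le> e"
    and codeg: "\<And>a c. a < N \<Longrightarrow> c < N \<Longrightarrow> a \<noteq> c \<Longrightarrow> card {d. {a, d} \<in> X \<and> {c, d} \<in> X} \<le> g"
  obtains M \<phi> where "M \<in> [{..<N}]\<^bsup>m\<^esup>" "\<phi> \<in> f ` R \<rightarrow>\<^sub>E insert N M"
    "\<And>D. D \<in> f ` R \<Longrightarrow> \<phi> D < N \<Longrightarrow> D \<notin> M \<and> {D, \<phi> D} \<in> X"
    "real (card (stray_pairs N X f R \<phi>)) \<le>
       b * k + z + T * (2 * b * e) + 2 * (b * m * k) + 2 * (b * (real m * real m * real g) * k)"
proof -
  have b0: "0 \<le> b" using fib[of undefined] by linarith
  \<comment> \<open>Padding \<open>M\<close> to exactly \<open>m\<close> elements makes the patterns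
    easy to count.\<close>
  obtain M where M: "{d\<in>{..<N}. T < dg d} \<subseteq> M" "M \<subseteq> {..<N}" "card M = m"
    using exists_subset_between[of "{d\<in>{..<N}. T < dg d}" m "{..<N}"] large by auto
  have finM: "finite M" using M finite_subset by blast
  define \<phi> where "\<phi> D = (if D \<in> f ` R then
      if D \<notin> M \<and> (\<exists>d\<in>M. {D, d} \<in> X) then (SOME d. d \<in> M \<and> {D, d} \<in> X) else N else undefined)" for D
  have \<phi>some: "\<phi> D \<in> M \<and> {D, \<phi> D} \<in> X" if "D \<in> f ` R" "D \<notin> M" "d \<in> M" "{D, d} \<in> X" for D d
  proof -
    have "\<phi> D = (SOME d. d \<in> M \<and> {D, d} \<in> X)" using that by (auto simp: \<phi>_def)
    moreover have "(SOME d. d \<in> M \<and> {D, d} \<in> X) \<in> M \<and> {D, (SOME d. d \<in> M \<and> {D, d} \<in> X)} \<in> X"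
      by (rule someI[of "\<lambda>d. d \<in> M \<and> {D, d} \<in> X" d]) (use that in simp)
    ultimately show ?thesis by simp
  qed
  have \<phi>N: "\<phi> D = N" if "D \<in> f ` R" "\<not> (D \<notin> M \<and> (\<exists>d\<in>M. {D, d} \<in> X))" for D
    using that by (simp only: \<phi>_def if_True if_False)
  have fE: "\<phi> \<in> f ` R \<rightarrow>\<^sub>E insert N M"
  proof
    fix D assume D: "D \<in> f ` R"
    show "\<phi> D \<in> insert N M"
      by (cases "D \<notin> M \<and> (\<exists>d\<in>M. {D, d} \<in> X)") (use \<phi>some \<phi>N D in auto)
  qed (simp add: \<phi>_def)
  have star: "D \<notin> M \<and> {D, \<phi> D} \<in> X" if "D \<in> f ` R" "\<phi> D < N" for D
    using \<phi>N[OF that(1)] \<phi>some[OF that(1)] that(2) by auto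
  define Wd where "Wd d = wedges f R X d" for d
  have finW: "finite (Wd d)" for d
    unfolding Wd_def by (rule finite_subset[of _ "R \<times> R"]) (use R in auto)
  \<comment> \<open>A vertex outside \<open>Dbl\<close> has at most one neighbour in
    \<open>M\<close>, so its label is forced. The codegrees bound \<open>Dbl\<close>.\<close>
  define Dbl where "Dbl = (\<Union>(a, c)\<in>{(a, c) \<in> M \<times> M. a \<noteq> c}. {d. {a, d} \<in> X \<and> {c, d} \<in> X})"
  define C1 where "C1 = (SIGMA u:R. {v \<in> R. f v = f u})"
  define C2 where "C2 = (\<Union>d\<in>{d \<in> {..<N} - f ` R. dg d \<le> T}. Wd d)"
  \<comment> \<open>For \<open>d\<close> in the image of \<open>R\<close> the stars can share edges,
    so \<open>small\<close> does not cover them; these wedges are bounded through the number of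
    edges inside the image.\<close>
  define C3 where "C3 = (\<Union>d\<in>{d \<in> f ` R. dg d \<le> T}. Wd d)"
  define B where "B Y = {u \<in> R. f u \<in> Y} \<times> R \<union> R \<times> {u \<in> R. f u \<in> Y}" for Y
  have finDbl0: "{d. {a, d} \<in> X \<and> {c, d} \<in> X} \<subseteq> {..<N}" for a c
    using X by (auto dest!: subsetD)
  have finMM: "finite {(a, c) \<in> M \<times> M. a \<noteq> c}"
    by (rule finite_subset[of _ "M \<times> M"]) (use finM in auto)
  have cDbl: "real (card Dbl) \<le> real m * real m * real g"
  proof -
    have "card Dbl \<le> (\<Sum>(a, c)\<in>{(a, c) \<in> M \<times> M. a \<noteq> c}. card {d. {a, d} \<in> X \<and> {c, d} \<in> X})"
      unfolding Dbl_def using card_UN_le[of "{(a, c) \<in> M \<times> M. a \<noteq> c}" "\<lambda>(a, c). {d. {a, d} \<in> X \<and> {c, d} \<in> X}"]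
        finMM by (simp add: case_prod_unfold)
    also have "\<dots> \<le> (\<Sum>(a, c)\<in>{(a, c) \<in> M \<times> M. a \<noteq> c}. g)"
      using codeg M by (intro sum_mono) auto
    also have "\<dots> \<le> card (M \<times> M) * g"
      using card_mono[of "M \<times> M" "{(a, c) \<in> M \<times> M. a \<noteq> c}"] finM
      by (simp add: case_prod_unfold subset_iff)
    finally have "card Dbl \<le> m * m * g" using M by (simp add: card_cartesian_product)
    then show ?thesis by (metis of_nat_le_iff of_nat_mult)
  qed
  have finDbl: "finite Dbl"
  proof (rule finite_subset)
    show "Dbl \<subseteq> {..<N}" unfolding Dbl_def using finDbl0 by fast
  qed simp
  have cB: "real (card (B Y)) \<le> 2 * (b * card Y * k)" if "finite Y" for Y
  proof -
    have "card (B Y) \<le> card {u \<in> R. f u \<in> Y} * card R + card R * card {u \<in> R. f u \<in> Y}"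
      unfolding B_def by (rule order.trans[OF card_Un_le]) (simp add: card_cartesian_product)
    then have "real (card (B Y)) \<le> 2 * (real (card {u \<in> R. f u \<in> Y}) * card R)"
      by (simp add: algebra_simps flip: of_nat_mult of_nat_add)
    also have "\<dots> \<le> 2 * (b * card Y * k)"
      using card_preimage_le[OF R(1) that fib] R b0 by (intro mult_left_mono mult_mono) auto
    finally show ?thesis .
  qed
  have c1: "real (card C1) \<le> b * k"
  proof -
    have "real (card C1) = (\<Sum>u\<in>R. real (card {v \<in> R. f v = f u}))"
      unfolding C1_def using R by (simp add: card_SigmaI)
    also have "\<dots> \<le> (\<Sum>u\<in>R. b)" by (intro sum_mono fib)
    also have "\<dots> \<le> b * k" using R b0 by (simp add: mult.commute mult_left_mono)
    finally show ?thesis .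
  qed
  have c2: "real (card C2) \<le> z"
  proof -
    have "card C2 \<le> (\<Sum>d\<in>{d \<in> {..<N} - f ` R. dg d \<le> T}. card (Wd d))"
      unfolding C2_def by (rule card_UN_le) simp
    then have "real (card C2) \<le> (\<Sum>d\<in>{d \<in> {..<N} - f ` R. dg d \<le> T}. real (card (Wd d)))"
      by (metis of_nat_le_iff of_nat_sum)
    also have "\<dots> = (\<Sum>d\<in>{..<N} - f ` R. if dg d \<le> T then Z d else 0)"
      unfolding Z_def Wd_def by (rule sum.inter_filter) simp
    finally show ?thesis using small by linarith
  qed
  have c3: "real (card C3) \<le> T * (2 * b * e)"
  proof -
    have "card C3 \<le> (\<Sum>d\<in>{d \<in> f ` R. dg d \<le> T}. card (Wd d))"
      unfolding C3_def by (rule card_UN_le) (use R in simp)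
    then have "real (card C3) \<le> (\<Sum>d\<in>{d \<in> f ` R. dg d \<le> T}. real (card (Wd d)))"
      by (metis of_nat_le_iff of_nat_sum)
    also have "\<dots> \<le> (\<Sum>d\<in>{d \<in> f ` R. dg d \<le> T}. T * dg d)"
    proof (intro sum_mono)
      fix d assume d: "d \<in> {d \<in> f ` R. dg d \<le> T}"
      have "card (Wd d) \<le> card ((links f R X d) \<times> (links f R X d))"
        unfolding Wd_def using R by (intro card_mono) auto
      then have "real (card (Wd d)) \<le> dg d * dg d"
        unfolding dg_def card_cartesian_product of_nat_mult[symmetric] of_nat_le_iff .
      also have "\<dots> \<le> T * dg d" using d by (intro mult_right_mono) (auto simp: dg_def)
      finally show "real (card (Wd d)) \<le> T * dg d" .
    qed
    also have "\<dots> \<le> (\<Sum>d\<in>f ` R. T * dg d)"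
      using R T by (intro sum_mono2) (auto simp: dg_def)
    also have "\<dots> = T * (\<Sum>d\<in>f ` R. dg d)" by (simp add: sum_distrib_left)
    also have "(\<Sum>d\<in>f ` R. dg d) \<le> 2 * b * card (X \<inter> [f ` R]\<^bsup>2\<^esup>)"
      unfolding dg_def
    proof (rule incidence_le[OF _ _ _ fib _ X])
      fix u d assume ud: "u \<in> R" "d \<in> f ` R" "{f u, d} \<in> X"
      then have "{f u, d} \<in> pairs N" using X by blast
      then show "{f u, d} \<in> X \<inter> [f ` R]\<^bsup>2\<^esup>" using ud by auto
    qed (use R in \<open>auto intro: finite_imp_finite_nsets\<close>)
    also have "\<dots> \<le> 2 * b * e" using edges b0 by (intro mult_left_mono) auto
    finally show ?thesis using T by (simp add: mult_left_mono)
  qed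
  have sub: "stray_pairs N X f R \<phi> \<subseteq> (((C1 \<union> C2) \<union> C3) \<union> B M) \<union> B Dbl"
  proof
    fix w assume "w \<in> stray_pairs N X f R \<phi>"
    then obtain u v d where w: "w = (u, v)" and uv: "u \<in> R" "v \<in> R" "{f u, d} \<in> X" "{f v, d} \<in> X"
      and n: "\<not> (\<phi> (f u) = \<phi> (f v) \<and> \<phi> (f u) < N)"
      unfolding stray_pairs_def closed_pair_def by auto
    have "{f u, d} \<in> pairs N" using uv X by blast
    then have d: "d < N" by auto
    show "w \<in> (((C1 \<union> C2) \<union> C3) \<union> B M) \<union> B Dbl"
    proof (cases "f u = f v")
      case True
      then show ?thesis using w uv by (auto simp: C1_def)
    next
      case ne: False
      then have wW: "w \<in> Wd d" using w uv by (auto simp: Wd_def)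
      show ?thesis
      proof (cases "d \<in> M")
        case False
        then have dT: "dg d \<le> T" using M d by auto
        have "w \<in> C2 \<or> w \<in> C3"
        proof (cases "d \<in> f ` R")
          case True
          then have "w \<in> C3" unfolding C3_def using dT wW by blast
          then show ?thesis ..
        next
          case False
          then have "w \<in> C2" unfolding C2_def using dT wW d by blast
          then show ?thesis ..
        qed
        then show ?thesis by blast
      next
        case dM: True
        show ?thesis
        proof (cases "f u \<in> M \<or> f v \<in> M")
          case True
          then show ?thesis using w uv by (auto simp: B_def)
        next
          case False
          have u: "\<phi> (f u) \<in> M" "{f u, \<phi> (f u)} \<in> X" and v: "\<phi> (f v) \<in> M" "{f v, \<phi> (f v)} \<in> X"
            using \<phi>some[of "f u" d] \<phi>some[of "f v" d] uv dM False by auto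
          have "\<phi> (f u) < N" using u M by auto
          then have "\<phi> (f u) \<noteq> d \<or> \<phi> (f v) \<noteq> d" using n by auto
          then have "f u \<in> Dbl \<or> f v \<in> Dbl"
          proof
            assume "\<phi> (f u) \<noteq> d"
            then have "f u \<in> Dbl" unfolding Dbl_def using u dM uv
              by (intro UN_I[of "(\<phi> (f u), d)"]) (auto simp: insert_commute)
            then show ?thesis ..
          next
            assume "\<phi> (f v) \<noteq> d"
            then have "f v \<in> Dbl" unfolding Dbl_def using v dM uv
              by (intro UN_I[of "(\<phi> (f v), d)"]) (auto simp: insert_commute)
            then show ?thesis ..
          qed
          then show ?thesis using w uv by (auto simp: B_def)
        qed
      qed
    qed
  qed
  have finB: "finite (B Y)" for Y unfolding B_def using R by auto
  have fin: "finite C1" "finite C2" "finite C3"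
    unfolding C1_def C2_def C3_def using R finW by auto
  have "card (stray_pairs N X f R \<phi>) \<le> card ((((C1 \<union> C2) \<union> C3) \<union> B M) \<union> B Dbl)"
    using sub fin finB by (intro card_mono) auto
  also have "\<dots> \<le> card C1 + card C2 + card C3 + card (B M) + card (B Dbl)"
    by (meson card_Un_le order.trans add_mono order.refl)
  finally have "real (card (stray_pairs N X f R \<phi>)) \<le> card C1 + card C2 + card C3 + card (B M) + card (B Dbl)"
    by (metis of_nat_add of_nat_le_iff)
  moreover have "real (card (B Dbl)) \<le> 2 * (b * (real m * real m * real g) * k)"
    using cB[OF finDbl] cDbl b0
    by (smt (verit, best) mult_left_mono mult_right_mono of_nat_0_le_iff)
  ultimately have "real (card (stray_pairs N X f R \<phi>)) \<le>
       b * k + z + T * (2 * b * e) + 2 * (b * m * k) + 2 * (b * (real m * real m * real g) * k)"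
    using c1 c2 c3 cB[OF finM, unfolded M(3)] unfolding of_nat_add by linarith
  moreover have "M \<in> [{..<N}]\<^bsup>m\<^esup>" using M finM by (auto simp: nsets_def)
  ultimately show thesis using that fE star by blast
qed

text \<open>
  Per colour and in units of \<open>k ln k\<close>: \<open>b\<close> is the size of the projection of an independent set of
  size \<open>k\<close>, and \<open>z\<close> and \<open>y\<close> are the part of the set covered by the neighbourhoods of few vertices
  and the size of its projection, and \<open>l\<close> counts the pairs that these neighbourhoods close.
  The degree bound \<open>\<xi> < 1/2\<close> is what makes the inequality strict.
\<close>

lemma exponent_bound:
  fixes \<eta> \<xi> b y z l c0 :: real
  assumes \<eta>: "0 < \<eta>" "2 * \<eta> \<le> (1 + \<eta>) * \<xi>" and \<xi>: "0 < \<xi>" "\<xi> < 1 / 2" "(1 + \<eta>) * \<xi> \<le> 1 / 2"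
    and z: "0 \<le> z" "z \<le> 1" and y: "0 \<le> y" and b: "0 \<le> b" "b \<le> 1 - z + y" and l: "l \<le> z\<^sup>2" "l \<le> \<xi> * z"
    and c0: "c0 \<le> \<eta> * (1 - 2 * \<xi>)" "(1 + \<eta>) * c0 \<le> \<eta> * (1 - \<eta>)" "2 * (1 + \<eta>) * c0 \<le> \<eta>"
  shows "- y - (1 + \<eta>) * (b\<^sup>2 - l) / 2 \<le> 1 / 2 - b - c0 / 2"
proof -
  define K where "K = 1 + \<eta>"
  have K: "1 < K" "\<eta> = K - 1" using \<eta> by (auto simp: K_def)
  define B where "B = 1 - z + y"
  have "2 * b - 1 - 2 * y - K * (b\<^sup>2 - l) \<le> - c0"
  \<comment> \<open>2 * b - K * b^2 increases up to b = 1 / K. If the bound \<open>B\<close> on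
    \<open>b\<close> lies below this peak, \<open>b\<close> is replaced by \<open>B\<close>,
    otherwise the peak value is used.\<close>
  proof (cases "K * B \<le> 1")
    case True
    have "0 \<le> (B - b) * (2 - K * (B + b))"
    proof (intro mult_nonneg_nonneg)
      have "K * b \<le> K * B" using b K by (intro mult_left_mono) (auto simp: B_def)
      then show "0 \<le> 2 - K * (B + b)" using True by (simp add: algebra_simps)
    qed (use b in \<open>simp add: B_def\<close>)
    then have 1: "2 * b - K * b\<^sup>2 \<le> 2 * B - K * B\<^sup>2"
      by (simp add: algebra_simps power2_eq_square)
    have "(1 - z)\<^sup>2 \<le> B\<^sup>2" using z y by (intro power_mono) (auto simp: B_def)
    then have 2: "K * (1 - z)\<^sup>2 \<le> K * B\<^sup>2" using K by (intro mult_left_mono) auto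
    have 3: "2 * b - 1 - 2 * y - K * (b\<^sup>2 - l) \<le> 1 - 2 * z - K * (1 - z)\<^sup>2 + K * l"
      using 1 2 by (simp add: B_def algebra_simps)
    show ?thesis
    \<comment> \<open>At z = \<xi> the two bounds on \<open>l\<close> agree; each is used where it
      is the smaller one.\<close>
    proof (cases "z \<le> \<xi>")
      case True
      have "K * l \<le> K * z\<^sup>2" using l K by (intro mult_left_mono) auto
      then have "1 - 2 * z - K * (1 - z)\<^sup>2 + K * l \<le> - \<eta> * (1 - 2 * z)"
        by (simp add: K_def algebra_simps power2_eq_square)
      also have "\<dots> \<le> - \<eta> * (1 - 2 * \<xi>)" using True \<eta> by simp
      finally show ?thesis using 3 c0 by linarith
    next
      case False
      have "K * l \<le> K * (\<xi> * z)" using l K by (intro mult_left_mono) auto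
      then have "1 - 2 * z - K * (1 - z)\<^sup>2 + K * l \<le> - \<eta> * (1 - 2 * \<xi>) + (z - \<xi>) * (2 * \<eta> - K * z)"
        by (simp add: K_def algebra_simps power2_eq_square)
      also have "(z - \<xi>) * (2 * \<eta> - K * z) \<le> 0"
      proof (intro mult_nonneg_nonpos)
        have "K * \<xi> \<le> K * z" using False K by (intro mult_left_mono) auto
        then show "2 * \<eta> - K * z \<le> 0" using \<eta>(2) unfolding K_def by linarith
      qed (use False in simp)
      finally show ?thesis using 3 c0 by linarith
    qed
  next
    case False
    have "0 \<le> (K * b - 1)\<^sup>2" by simp
    then have "K * (2 * b - K * b\<^sup>2) \<le> 1" by (simp add: algebra_simps power2_eq_square)
    then have 1: "K * (2 * b - 1 - 2 * y - K * (b\<^sup>2 - l)) \<le> - \<eta> - 2 * K * y + K * K * l"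
      using K by (simp add: algebra_simps)
    have "K * (2 * b - 1 - 2 * y - K * (b\<^sup>2 - l)) \<le> K * (- c0)"
    proof (cases "K * z \<le> \<eta>")
      case True
      have "K * K * l \<le> K * K * z\<^sup>2" using l K by (intro mult_left_mono) auto
      also have "\<dots> = (K * z)\<^sup>2" by (simp add: power2_eq_square)
      also have "\<dots> \<le> \<eta>\<^sup>2" using True K z by (intro power_mono) auto
      finally have "K * K * l \<le> \<eta>\<^sup>2" .
      moreover have "0 \<le> K * y" using K y by simp
      ultimately show ?thesis using 1 c0(2) by (simp add: K_def algebra_simps power2_eq_square)
    next
      case zb: False
      \<comment> \<open>Past the peak many star edges are forced, and their cost 2 * K * y outweighs
        the gain from closed pairs because K * \<xi> \<le> 1 / 2.\<close>
      have "K * y \<ge> K * z - \<eta>" using False by (simp add: B_def K_def algebra_simps)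
      moreover have "K * K * l \<le> K * K * (\<xi> * z)" using l K by (intro mult_left_mono) auto
      moreover have "K * K * (\<xi> * z) = (K * \<xi>) * (K * z)" by simp
      moreover have "(K * \<xi>) * (K * z) \<le> 1 / 2 * (K * z)"
        using \<xi>(3) K(1) z unfolding K_def[symmetric] by (intro mult_right_mono) auto
      ultimately have "- \<eta> - 2 * K * y + K * K * l \<le> - \<eta> / 2"
        using zb by linarith
      then show ?thesis using 1 c0(3) by (simp add: K_def algebra_simps)
    qed
    then show ?thesis by (rule mult_left_le_imp_le) (use K in simp)
  qed
  then show ?thesis by (simp add: K_def)
qed

section \<open>The two maps and the overlay graph\<close>

lemma sum_PiE_insert:
  assumes "v \<notin> V"
  shows "(\<Sum>f\<in>insert v V \<rightarrow>\<^sub>E B. g f) = (\<Sum>f\<in>V \<rightarrow>\<^sub>E B. \<Sum>y\<in>B. g (f(v := y)))"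
proof -
  have "(\<Sum>f\<in>insert v V \<rightarrow>\<^sub>E B. g f) = (\<Sum>(y, f)\<in>B \<times> (V \<rightarrow>\<^sub>E B). g (f(v := y)))"
    unfolding PiE_insert_eq by (subst sum.reindex[OF inj_combinator[OF assms]]) (simp add: case_prod_unfold)
  also have "\<dots> = (\<Sum>y\<in>B. \<Sum>f\<in>V \<rightarrow>\<^sub>E B. g (f(v := y)))"
    by (rule sum.cartesian_product[symmetric])
  also have "\<dots> = (\<Sum>f\<in>V \<rightarrow>\<^sub>E B. \<Sum>y\<in>B. g (f(v := y)))"
    by (rule sum.swap)
  finally show ?thesis .
qed

text \<open>The images are chosen one vertex at a time: a vertex of \<open>S\<close> hits one of at
  most \<open>k\<close> values already used, at weight 1, or one of at most \<open>N\<close> new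
  values, at weight \<open>x\<close>. Intersecting \<open>S\<close> with \<open>V\<close> lets the
  induction run over the domain.\<close>

lemma sum_power_card_image_le:
  fixes x :: real
  assumes "finite V" "finite S" "card S \<le> k" "0 \<le> x"
  shows "(\<Sum>f\<in>V \<rightarrow>\<^sub>E {..<N}. x ^ card (f ` (S \<inter> V))) \<le> (\<Prod>v\<in>V. if v \<in> S then real k + real N * x else real N)"
  using assms(1)
proof (induction V rule: finite_induct)
  case (insert v V)
  have step: "(\<Sum>y\<in>{..<N}. x ^ card ((f(v := y)) ` (S \<inter> insert v V)))
      \<le> (if v \<in> S then real k + real N * x else real N) * x ^ card (f ` (S \<inter> V))" for f :: "'a \<Rightarrow> nat"
  proof (cases "v \<in> S")
    case True
    define A where "A = f ` (S \<inter> V)"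
    have finA: "finite A" using assms by (simp add: A_def)
    have "card A \<le> card (S \<inter> V)" unfolding A_def using assms by (intro card_image_le) auto
    also have "\<dots> \<le> card S" using assms by (intro card_mono) auto
    finally have cA: "card A \<le> k" using assms by simp
    have "(f(v := y)) ` (S \<inter> insert v V) = insert y A" for y
      using True insert.hyps by (auto simp: A_def)
    then have "(\<Sum>y\<in>{..<N}. x ^ card ((f(v := y)) ` (S \<inter> insert v V))) = (\<Sum>y\<in>{..<N}. x ^ card (insert y A))"
      by simp
    also have "\<dots> = (\<Sum>y\<in>{..<N}. (if y \<in> A then 1 else x) * x ^ card A)"
      by (intro sum.cong refl) (auto simp: insert_absorb finA)
    also have "\<dots> = (\<Sum>y\<in>{..<N}. if y \<in> A then 1 else x) * x ^ card A"
      by (simp add: sum_distrib_right)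
    also have "(\<Sum>y\<in>{..<N}. if y \<in> A then 1 else x) \<le> (\<Sum>y\<in>{..<N}. of_bool (y \<in> A) + x)"
      using assms by (intro sum_mono) auto
    also have "\<dots> = card ({..<N} \<inter> A) + N * x"
      by (simp add: sum.distrib of_bool_def sum.If_cases Int_def)
    also have "\<dots> \<le> k + N * x"
      using cA card_mono[OF finA, of "{..<N} \<inter> A"] by simp
    finally show ?thesis using True assms by (simp add: A_def mult_right_mono)
  next
    case False
    have "(f(v := y)) ` (S \<inter> insert v V) = f ` (S \<inter> V)" for y
      using False insert.hyps by auto
    then show ?thesis using False by simp
  qed
  have "(\<Sum>f\<in>insert v V \<rightarrow>\<^sub>E {..<N}. x ^ card (f ` (S \<inter> insert v V)))
      = (\<Sum>f\<in>V \<rightarrow>\<^sub>E {..<N}. \<Sum>y\<in>{..<N}. x ^ card ((f(v := y)) ` (S \<inter> insert v V)))"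
    by (rule sum_PiE_insert[OF insert.hyps(2)])
  also have "\<dots> \<le> (\<Sum>f\<in>V \<rightarrow>\<^sub>E {..<N}. (if v \<in> S then real k + real N * x else real N) * x ^ card (f ` (S \<inter> V)))"
    by (intro sum_mono step)
  also have "\<dots> = (if v \<in> S then real k + real N * x else real N) * (\<Sum>f\<in>V \<rightarrow>\<^sub>E {..<N}. x ^ card (f ` (S \<inter> V)))"
    by (simp add: sum_distrib_left)
  also have "\<dots> \<le> (if v \<in> S then real k + real N * x else real N) * (\<Prod>v\<in>V. if v \<in> S then real k + real N * x else real N)"
    using assms by (intro mult_left_mono insert.IH) auto
  also have "\<dots> = (\<Prod>v\<in>insert v V. if v \<in> S then real k + real N * x else real N)"
    using insert.hyps by simp
  finally show ?case .
qed simp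

lemma sum_power_card_image_subset_le:
  fixes x :: real
  assumes "finite V" "S \<subseteq> V" "card S = k" "0 \<le> x" "N > 0"
  shows "(\<Sum>f\<in>V \<rightarrow>\<^sub>E {..<N}. x ^ card (f ` S)) \<le> real N ^ card V * (real k / real N + x) ^ k"
proof -
  have finS: "finite S" using assms finite_subset by auto
  have SV: "S \<inter> V = S" using assms by auto
  have "(\<Sum>f\<in>V \<rightarrow>\<^sub>E {..<N}. x ^ card (f ` S)) \<le> (\<Prod>v\<in>V. if v \<in> S then real k + real N * x else real N)"
    using sum_power_card_image_le[OF assms(1) finS _ assms(4), of k N] assms SV by simp
  also have "\<dots> = (\<Prod>v\<in>V. real N * (if v \<in> S then real k / N + x else 1))"
    using assms by (intro prod.cong refl) (auto simp: field_simps)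
  also have "\<dots> = real N ^ card V * (\<Prod>v\<in>V. if v \<in> S then real k / N + x else 1)"
    by (simp add: prod.distrib)
  also have "(\<Prod>v\<in>V. if v \<in> S then real k / N + x else 1) = (real k / N + x) ^ k"
    using assms(1) SV assms(3) by (simp add: prod.inter_restrict[symmetric] Int_commute)
  finally show ?thesis .
qed

text \<open>A fibre size is binomial with mean card V / N. Each vertex contributes (N - 1 + exp 1) /
  N \<le> exp (2 / N) to its exponential moment, and the factor \<open>N\<close> is the union bound
  over the fibres.\<close>

lemma sum_large_fibre_le:
  fixes b :: real
  assumes V: "finite V" and N: "N > 0" and b: "0 \<le> b"
  shows "(\<Sum>f\<in>V \<rightarrow>\<^sub>E {..<N}. of_bool (\<exists>D. b < real (card {u \<in> V. f u = D})))
    \<le> real N ^ card V * (real N * exp (2 * real (card V) / N - b))"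
proof -
  have "(\<Sum>f\<in>V \<rightarrow>\<^sub>E {..<N}. of_bool (\<exists>D. b < real (card {u \<in> V. f u = D})))
      \<le> (\<Sum>f\<in>V \<rightarrow>\<^sub>E {..<N}. \<Sum>D<N. exp (real (card {u \<in> V. f u = D}) - b))"
  proof (intro sum_mono)
    fix f assume f: "f \<in> V \<rightarrow>\<^sub>E {..<N}"
    show "of_bool (\<exists>D. b < real (card {u \<in> V. f u = D})) \<le> (\<Sum>D<N. exp (real (card {u \<in> V. f u = D}) - b))"
    proof (cases "\<exists>D. b < real (card {u \<in> V. f u = D})")
      case True
      then obtain D where D: "b < real (card {u \<in> V. f u = D})" by blast
      have "{u \<in> V. f u = D} \<noteq> {}" using D b by force
      then have DN: "D < N" using f by (auto simp: PiE_iff)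
      have "1 \<le> exp (real (card {u \<in> V. f u = D}) - b)" using D by simp
      also have "\<dots> \<le> (\<Sum>D<N. exp (real (card {u \<in> V. f u = D}) - b))"
        using DN by (intro member_le_sum[where f = "\<lambda>D. exp (real (card {u \<in> V. f u = D}) - b)"]) auto
      finally show ?thesis using True by simp
    qed (auto intro: sum_nonneg)
  qed
  also have "\<dots> = (\<Sum>D<N. \<Sum>f\<in>V \<rightarrow>\<^sub>E {..<N}. exp (real (card {u \<in> V. f u = D}) - b))"
    by (rule sum.swap)
  also have "\<dots> \<le> (\<Sum>D<N. real N ^ card V * exp (2 * real (card V) / N - b))"
  proof (intro sum_mono)
    fix D assume D: "D \<in> {..<N}"
    have ex: "exp (real (card {u \<in> V. f u = D})) = (\<Prod>u\<in>V. if f u = D then exp 1 else 1)" for f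
      using V by (simp add: prod.If_cases Int_def exp_of_nat_mult[symmetric])
    have "(\<Sum>f\<in>V \<rightarrow>\<^sub>E {..<N}. exp (real (card {u \<in> V. f u = D}))) =
        (\<Prod>u\<in>V. \<Sum>y\<in>{..<N}. if y = D then exp 1 else 1)"
      unfolding ex using V by (subst prod_sum_PiE) auto
    also have "(\<Sum>y\<in>{..<N}. if y = D then exp 1 else 1) = real N - 1 + exp 1"
    proof -
      have "(\<Sum>y\<in>{..<N}. if y = D then exp 1 else (1::real)) = (\<Sum>y\<in>{..<N}. 1 + (if y = D then exp 1 - 1 else 0))"
        by (intro sum.cong) auto
      then show ?thesis using D by (simp add: sum.distrib)
    qed
    also have "(\<Prod>u\<in>V. real N - 1 + exp 1) = (real N - 1 + exp 1) ^ card V" by simp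
    also have "\<dots> \<le> (real N * exp (2 / N)) ^ card V"
    proof (intro power_mono)
      have "real N * (1 + 2 / N) \<le> real N * exp (2 / N)"
        by (intro mult_left_mono exp_ge_add_one_self) auto
      moreover have "real N * (1 + 2 / N) = real N + 2" using N by (simp add: field_simps)
      moreover have "exp 1 \<le> (3 :: real)" by (rule exp_le)
      ultimately show "real N - 1 + exp 1 \<le> real N * exp (2 / N)" by linarith
      show "0 \<le> real N - 1 + exp 1" using N by (simp add: add_nonneg_nonneg)
    qed
    also have "\<dots> = real N ^ card V * exp (2 * real (card V) / N)"
      by (simp add: power_mult_distrib exp_of_nat_mult[symmetric] mult.commute)
    finally show "(\<Sum>f\<in>V \<rightarrow>\<^sub>E {..<N}. exp (real (card {u \<in> V. f u = D}) - b))
        \<le> real N ^ card V * exp (2 * real (card V) / N - b)"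
      by (simp add: exp_diff sum_divide_distrib[symmetric] divide_right_mono)
  qed
  also have "\<dots> = real N ^ card V * (real N * exp (2 * real (card V) / N - b))" by simp
  finally show ?thesis .
qed

text \<open>
  With \<open>x = 1 / k\<close> the weight of \<open>S\<close> compensates the larger probability that a set with small
  projections is independent.
\<close>

lemma exists_spread_maps:
  fixes x b :: real and V :: "'v set"
  assumes V: "finite V" and N: "N > 0" and x: "0 < x" and b: "0 \<le> b"
    and tail: "4 * (real N * exp (2 * real (card V) / N - b)) \<le> 1" and k: "k \<le> card V"
  obtains f1 f2 where "f1 \<in> V \<rightarrow> {..<N}" "f2 \<in> V \<rightarrow> {..<N}"
    "\<And>D. real (card {u \<in> V. f1 u = D}) \<le> b" "\<And>D. real (card {u \<in> V. f2 u = D}) \<le> b"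
    "(\<Sum>S\<in>[V]\<^bsup>k\<^esup>. x ^ card (f1 ` S) * x ^ card (f2 ` S)) \<le> 4 * (real (card V choose k) * ((real k / N + x) ^ k)\<^sup>2)"
proof -
  define B where "B = real (card V choose k) * ((real k / N + x) ^ k)\<^sup>2"
  have B: "B > 0" using x k N by (auto simp: B_def intro!: mult_pos_pos zero_less_power add_nonneg_pos)
  define \<Phi> where "\<Phi> = V \<rightarrow>\<^sub>E {..<N}"
  define bad where "bad f \<longleftrightarrow> (\<exists>D. b < real (card {u \<in> V. f u = D}))" for f :: "'v \<Rightarrow> nat"
  define W where "W f1 f2 = (\<Sum>S\<in>[V]\<^bsup>k\<^esup>. x ^ card (f1 ` S) * x ^ card (f2 ` S))" for f1 f2 :: "'v \<Rightarrow> nat"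
  have card\<Phi>: "real (card \<Phi>) = real N ^ card V" and fin\<Phi>: "finite \<Phi>"
    using V by (auto simp: \<Phi>_def card_PiE finite_PiE)
  have bad_sum: "(\<Sum>f\<in>\<Phi>. of_bool (bad f)) \<le> real N ^ card V / 4"
  proof -
    have "(\<Sum>f\<in>\<Phi>. of_bool (bad f)) \<le> real N ^ card V * (real N * exp (2 * real (card V) / N - b))"
      unfolding \<Phi>_def bad_def by (rule sum_large_fibre_le[OF V N b])
    also have "\<dots> \<le> real N ^ card V * (1 / 4)" using tail by (intro mult_left_mono) auto
    finally show ?thesis by simp
  qed
  have W_sum: "(\<Sum>f1\<in>\<Phi>. \<Sum>f2\<in>\<Phi>. W f1 f2) \<le> (real N ^ card V)\<^sup>2 * B"
  proof -
    have "(\<Sum>f1\<in>\<Phi>. \<Sum>f2\<in>\<Phi>. W f1 f2) =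
        (\<Sum>f1\<in>\<Phi>. \<Sum>S\<in>[V]\<^bsup>k\<^esup>. \<Sum>f2\<in>\<Phi>. x ^ card (f1 ` S) * x ^ card (f2 ` S))"
      unfolding W_def by (intro sum.cong refl sum.swap)
    also have "\<dots> = (\<Sum>S\<in>[V]\<^bsup>k\<^esup>. \<Sum>f1\<in>\<Phi>. \<Sum>f2\<in>\<Phi>. x ^ card (f1 ` S) * x ^ card (f2 ` S))"
      by (rule sum.swap)
    also have "\<dots> = (\<Sum>S\<in>[V]\<^bsup>k\<^esup>. (\<Sum>f1\<in>\<Phi>. x ^ card (f1 ` S)) * (\<Sum>f2\<in>\<Phi>. x ^ card (f2 ` S)))"
      by (simp add: sum_product)
    also have "\<dots> \<le> (\<Sum>S\<in>[V]\<^bsup>k\<^esup>. (real N ^ card V * (real k / N + x) ^ k) * (real N ^ card V * (real k / N + x) ^ k))"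
      unfolding \<Phi>_def using V x N
      by (intro sum_mono mult_mono sum_power_card_image_subset_le) (auto simp: nsets_def intro!: sum_nonneg)
    also have "\<dots> = (real N ^ card V)\<^sup>2 * B"
      using V by (simp add: B_def power2_eq_square mult_ac)
    finally show ?thesis .
  qed
  \<comment> \<open>Averaging over all pairs of maps: each of the two fibre conditions and the
    weight condition fails for at most a quarter of the pairs.\<close>
  have "\<exists>f1\<in>\<Phi>. \<exists>f2\<in>\<Phi>. \<not> bad f1 \<and> \<not> bad f2 \<and> W f1 f2 \<le> 4 * B"
  proof (rule ccontr)
    assume neg: "\<not> ?thesis"
    have "(real N ^ card V)\<^sup>2 = (\<Sum>f1\<in>\<Phi>. \<Sum>f2\<in>\<Phi>. 1)"
      using card\<Phi> by (simp add: power2_eq_square)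
    also have "\<dots> \<le> (\<Sum>f1\<in>\<Phi>. \<Sum>f2\<in>\<Phi>. of_bool (bad f1) + of_bool (bad f2) + W f1 f2 / (4 * B))"
    proof (intro sum_mono)
      fix f1 f2 assume f: "f1 \<in> \<Phi>" "f2 \<in> \<Phi>"
      have W0: "0 \<le> W f1 f2" unfolding W_def using x by (intro sum_nonneg) auto
      show "1 \<le> of_bool (bad f1) + of_bool (bad f2) + W f1 f2 / (4 * B)"
      proof (cases "bad f1 \<or> bad f2")
        case True
        then show ?thesis using W0 B by (auto intro: add_increasing2)
      next
        case False
        then have "4 * B < W f1 f2" using neg f by force
        then show ?thesis using False B by simp
      qed
    qed
    also have "\<dots> = real (card \<Phi>) * (\<Sum>f\<in>\<Phi>. of_bool (bad f)) + real (card \<Phi>) * (\<Sum>f\<in>\<Phi>. of_bool (bad f))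
        + (\<Sum>f1\<in>\<Phi>. \<Sum>f2\<in>\<Phi>. W f1 f2) / (4 * B)"
      by (simp add: sum.distrib sum_distrib_left[symmetric] sum_divide_distrib[symmetric])
    also have "\<dots> \<le> real N ^ card V * (real N ^ card V / 4) + real N ^ card V * (real N ^ card V / 4)
        + (real N ^ card V)\<^sup>2 * B / (4 * B)"
      unfolding card\<Phi> using bad_sum W_sum B by (intro add_mono mult_left_mono divide_right_mono) auto
    also have "\<dots> = 3 / 4 * (real N ^ card V)\<^sup>2" using B by (simp add: power2_eq_square field_simps)
    finally have "(real N ^ card V)\<^sup>2 \<le> 0" by simp
    then show False using N by simp
  qed
  then obtain f1 f2 where "f1 \<in> \<Phi>" "f2 \<in> \<Phi>" "\<not> bad f1" "\<not> bad f2" "W f1 f2 \<le> 4 * B" by blast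
  then show thesis
    by (intro that[of f1 f2]) (auto simp: \<Phi>_def PiE_iff bad_def not_less W_def B_def)
qed

text \<open>A triangle of \<open>X\<close> that shares no edge with a maximal packing could be added
  to it.\<close>

lemma maximal_packing:
  assumes "X \<subseteq> pairs N"
  obtains F where "triangle_packing N X F"
    "\<And>a b c. {a, b} \<in> X \<Longrightarrow> {b, c} \<in> X \<Longrightarrow> {a, c} \<in> X \<Longrightarrow>
      {a, b} \<in> edges_of F \<or> {b, c} \<in> edges_of F \<or> {a, c} \<in> edges_of F"
proof -
  have fin: "finite {F. triangle_packing N X F}"
    by (rule finite_subset[of _ "Pow ([{..<N}]\<^bsup>3\<^esup>)"]) (auto simp: triangle_packing_def finite_imp_finite_nsets)
  have ne: "{} \<in> {F. triangle_packing N X F}" by (simp add: triangle_packing_def edge_disjoint_def)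
  obtain F where F: "triangle_packing N X F" and max: "\<And>G. triangle_packing N X G \<Longrightarrow> F \<subseteq> G \<Longrightarrow> F = G"
    using finite_has_maximal[OF fin] ne by auto
  show thesis
  proof (rule that[OF F], rule ccontr)
    fix a b c assume abc: "{a, b} \<in> X" "{b, c} \<in> X" "{a, c} \<in> X"
      and n: "\<not> ({a, b} \<in> edges_of F \<or> {b, c} \<in> edges_of F \<or> {a, c} \<in> edges_of F)"
    have "{a, b} \<in> pairs N" "{b, c} \<in> pairs N" "{a, c} \<in> pairs N" using abc assms by blast+
    then have d: "a < N" "b < N" "c < N" "a \<noteq> b" "b \<noteq> c" "a \<noteq> c" by auto
    have two: "[{a, b, c}]\<^bsup>2\<^esup> = {{a, b}, {b, c}, {a, c}}"
      using d by (auto simp: nsets_2_eq insert_commute)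
    have "triangle_packing N X (insert {a, b, c} F)"
      unfolding triangle_packing_def
    proof (intro conjI)
      show "insert {a, b, c} F \<subseteq> [{..<N}]\<^bsup>3\<^esup>"
        using F d by (auto simp: triangle_packing_def nsets_def)
      show "\<forall>A\<in>insert {a, b, c} F. [A]\<^bsup>2\<^esup> \<subseteq> X"
        using F abc two by (auto simp: triangle_packing_def)
      have abc_disj: "[{a, b, c}]\<^bsup>2\<^esup> \<inter> [A]\<^bsup>2\<^esup> = {}" if "A \<in> F" for A
        unfolding two using n that by blast
      have F_disj: "[A]\<^bsup>2\<^esup> \<inter> [B]\<^bsup>2\<^esup> = {}" if "A \<in> F" "B \<in> F" "A \<noteq> B" for A B
        using F that unfolding triangle_packing_def edge_disjoint_def by blast
      show "edge_disjoint (insert {a, b, c} F)"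
        unfolding edge_disjoint_def
      proof (intro ballI impI)
        fix A B assume AB: "A \<in> insert {a, b, c} F" "B \<in> insert {a, b, c} F" "A \<noteq> B"
        then consider "A = {a, b, c}" "B \<in> F" | "B = {a, b, c}" "A \<in> F" | "A \<in> F" "B \<in> F" by blast
        then show "[A]\<^bsup>2\<^esup> \<inter> [B]\<^bsup>2\<^esup> = {}"
          by cases (simp_all add: abc_disj F_disj AB(3) Int_commute[of _ "[{a, b, c}]\<^bsup>2\<^esup>"])
      qed
    qed
    then have "F = insert {a, b, c} F" by (rule max) auto
    then have "{a, b, c} \<in> F" by auto
    then have "{a, b} \<in> edges_of F" using two by blast
    then show False using n by simp
  qed
qed

lemma card_packing_edges_le:
  assumes F: "triangle_packing N X F" and Q: "finite Q"
    and t: "card {A \<in> F. [A]\<^bsup>2\<^esup> \<inter> [Q]\<^bsup>2\<^esup> \<noteq> {}} < t"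
  shows "card (edges_of F \<inter> [Q]\<^bsup>2\<^esup>) \<le> 3 * t"
proof -
  define G where "G = {A \<in> F. [A]\<^bsup>2\<^esup> \<inter> [Q]\<^bsup>2\<^esup> \<noteq> {}}"
  have F3: "F \<subseteq> [{..<N}]\<^bsup>3\<^esup>" using F by (simp add: triangle_packing_def)
  then have finG: "finite G"
    unfolding G_def using finite_subset[OF F3] by (simp add: finite_imp_finite_nsets)
  have "card (edges_of F \<inter> [Q]\<^bsup>2\<^esup>) \<le> card (\<Union>A\<in>G. [A]\<^bsup>2\<^esup>)"
    using finG F3 by (intro card_mono) (auto simp: G_def nsets_def[of _ 3] intro!: finite_imp_finite_nsets)
  also have "\<dots> \<le> (\<Sum>A\<in>G. card ([A]\<^bsup>2\<^esup>))" by (rule card_UN_le[OF finG])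
  also have "\<dots> = (\<Sum>A\<in>G. 3)"
    by (intro sum.cong refl) (use F3 in \<open>auto simp: G_def nsets_def[of _ 3] choose_two\<close>)
  finally show ?thesis using t by (simp add: G_def)
qed

text \<open>
  Each of the two blow-ups keeps only the pairs without a common neighbour in the other one, so a
  triangle would have to lie in a single blow-up.
\<close>

definition overlay_edges :: "nat set set \<Rightarrow> nat set set \<Rightarrow> ('v \<Rightarrow> nat) \<Rightarrow> ('v \<Rightarrow> nat) \<Rightarrow> 'v set \<Rightarrow> 'v set set" where
  "overlay_edges Y1 Y2 f1 f2 V = {{u, v} | u v. u \<in> V \<and> v \<in> V \<and> u \<noteq> v \<and>
     ({f1 u, f1 v} \<in> Y1 \<and> \<not> closed_pair Y2 f2 u v \<or> {f2 u, f2 v} \<in> Y2 \<and> \<not> closed_pair Y1 f1 u v)}"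

lemma closed_pair_commute: "closed_pair X f u v \<longleftrightarrow> closed_pair X f v u"
  by (auto simp: closed_pair_def)

lemma overlay_edges_iff:
  "{u, v} \<in> overlay_edges Y1 Y2 f1 f2 V \<longleftrightarrow> u \<in> V \<and> v \<in> V \<and> u \<noteq> v \<and>
     ({f1 u, f1 v} \<in> Y1 \<and> \<not> closed_pair Y2 f2 u v \<or> {f2 u, f2 v} \<in> Y2 \<and> \<not> closed_pair Y1 f1 u v)"
  (is "_ \<longleftrightarrow> ?P u v")
proof -
  have sym: "?P x y \<longleftrightarrow> ?P y x" for x y
    by (simp only: closed_pair_commute[of _ _ x y] insert_commute[of "f1 x" "f1 y"] insert_commute[of "f2 x" "f2 y"])
      blast
  have "{u, v} \<in> overlay_edges Y1 Y2 f1 f2 V \<longleftrightarrow> (\<exists>x y. {u, v} = {x, y} \<and> ?P x y)"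
    unfolding overlay_edges_def by blast
  also have "\<dots> \<longleftrightarrow> ?P u v"
    unfolding doubleton_eq_iff using sym by blast
  finally show ?thesis .
qed

text \<open>Two of the three edges come from the same blow-up. Their common end then closes the
  remaining pair there, so the third edge cannot come from the other blow-up, and all three project
  to a triangle of \<open>Y1\<close> or of \<open>Y2\<close>.\<close>

lemma overlay_triangle_free:
  assumes Y1: "\<And>a b c. \<not> ({a, b} \<in> Y1 \<and> {b, c} \<in> Y1 \<and> {a, c} \<in> Y1)"
    and Y2: "\<And>a b c. \<not> ({a, b} \<in> Y2 \<and> {b, c} \<in> Y2 \<and> {a, c} \<in> Y2)"
  shows "\<not> ({u, v} \<in> overlay_edges Y1 Y2 f1 f2 V \<and> {v, w} \<in> overlay_edges Y1 Y2 f1 f2 V \<and>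
    {u, w} \<in> overlay_edges Y1 Y2 f1 f2 V)"
proof -
  have c: "closed_pair X f u w" if "{f u, f v} \<in> X" "{f v, f w} \<in> X" for X and f :: "'a \<Rightarrow> nat" and u v w
    using that unfolding closed_pair_def insert_commute[of "f v" "f w"] by blast
  show ?thesis
    unfolding overlay_edges_iff
    using Y1[of "f1 u" "f1 v" "f1 w"] Y2[of "f2 u" "f2 v" "f2 w"]
      c[of f1 u v Y1 w] c[of f2 u v Y2 w] c[of f1 v u Y1 w] c[of f2 v u Y2 w] c[of f1 u w Y1 v] c[of f2 u w Y2 v]
    by (simp add: insert_commute) blast
qed

section \<open>Union bound over independent sets\<close>

lemma rs_prob_disj_le:
  assumes "0 \<le> p" "p \<le> 1"
  shows "rs_prob E p (\<lambda>X. P X \<or> Q X) \<le> rs_prob E p P + rs_prob E p Q"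
  unfolding rs_exp_add[symmetric] by (intro rs_exp_mono assms) auto

definition star_edges :: "nat \<Rightarrow> ('v \<Rightarrow> nat) \<Rightarrow> 'v set \<Rightarrow> (nat \<Rightarrow> nat) \<Rightarrow> nat set set" where
  "star_edges N f R \<phi> = (\<lambda>D. {D, \<phi> D}) ` {D \<in> f ` R. \<phi> D < N}"

definition fan :: "('v \<Rightarrow> nat) \<Rightarrow> 'v set \<Rightarrow> (nat \<Rightarrow> nat) \<Rightarrow> nat \<Rightarrow> 'v set" where
  "fan f R \<phi> d = {u \<in> R. \<phi> (f u) = d}"

text \<open>
  Few patterns exist, so a union bound over them is affordable, and a pattern determines up to few
  \<open>stray_pairs\<close> which pairs are closed.
\<close>

definition patterns :: "nat \<Rightarrow> nat \<Rightarrow> real \<Rightarrow> ('v \<Rightarrow> nat) \<Rightarrow> 'v set \<Rightarrow> (nat set \<times> (nat \<Rightarrow> nat)) set" where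
  "patterns N m x f R = {(M, \<phi>). M \<in> [{..<N}]\<^bsup>m\<^esup> \<and> \<phi> \<in> f ` R \<rightarrow>\<^sub>E insert N M \<and>
     (\<forall>D\<in>f ` R. \<phi> D < N \<longrightarrow> D \<notin> M) \<and> (\<forall>d<N. real (card (fan f R \<phi> d)) \<le> x)}"

text \<open>
  The base pairs that are neither closed by the pattern \<open>(M', \<phi>')\<close> of the other colour nor possible
  star edges of the pattern of the same colour. An independent set forces almost all of them to be
  absent.
\<close>

definition core :: "('v \<Rightarrow> nat) \<Rightarrow> 'v set \<Rightarrow> nat set \<Rightarrow> ('v \<Rightarrow> nat) \<Rightarrow> nat set \<Rightarrow> (nat \<Rightarrow> nat) \<Rightarrow> nat set set" where
  "core f R M f' M' \<phi>' = [f ` R]\<^bsup>2\<^esup> - (\<Union>d\<in>M'. [f ` fan f' R \<phi>' d]\<^bsup>2\<^esup>) - {e. e \<inter> M \<noteq> {}}"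

text \<open>The set \<open>M\<close> costs at most N ^ m and each projected vertex has at most m + 1
  labels. For \<open>m\<close> polylogarithmic in \<open>k\<close> this is exp (o(k ln k)),
  negligible against the saving in the main term.\<close>

lemma card_patterns:
  assumes R: "finite R" "card R \<le> k"
  shows "finite (patterns N m x f R)" "real (card (patterns N m x f R)) \<le> real N ^ m * (real m + 1) ^ k"
proof -
  define J where "J = (SIGMA M:[{..<N}]\<^bsup>m\<^esup>. f ` R \<rightarrow>\<^sub>E insert N M)"
  have sub: "patterns N m x f R \<subseteq> J" by (auto simp: patterns_def J_def)
  have fin: "finite ([{..<N}]\<^bsup>m\<^esup>)" by (simp add: finite_imp_finite_nsets)
  have finM: "finite M" if "M \<in> [{..<N}]\<^bsup>m\<^esup>" for M using that by (auto simp: nsets_def)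
  have finJ: "finite J"
    unfolding J_def using fin finM R by (intro finite_SigmaI finite_PiE) auto
  then show "finite (patterns N m x f R)" using sub finite_subset by blast
  have "card (patterns N m x f R) \<le> card J" using sub finJ by (intro card_mono)
  also have "card J = (\<Sum>M\<in>[{..<N}]\<^bsup>m\<^esup>. card (f ` R \<rightarrow>\<^sub>E insert N M))"
    unfolding J_def using fin finM R by (intro card_SigmaI) (auto intro!: finite_PiE)
  also have "\<dots> \<le> (\<Sum>M\<in>[{..<N}]\<^bsup>m\<^esup>. (m + 1) ^ k)"
  proof (intro sum_mono)
    fix M assume M: "M \<in> [{..<N}]\<^bsup>m\<^esup>"
    have "card (f ` R \<rightarrow>\<^sub>E insert N M) = card (insert N M) ^ card (f ` R)"
      using R by (simp add: card_PiE)
    also have "\<dots> \<le> (m + 1) ^ card (f ` R)"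
      using M by (intro power_mono) (auto simp: nsets_def card_insert_if)
    also have "\<dots> \<le> (m + 1) ^ k"
      using card_image_le[OF R(1), of f] R by (intro power_increasing) auto
    finally show "card (f ` R \<rightarrow>\<^sub>E insert N M) \<le> (m + 1) ^ k" .
  qed
  also have "\<dots> \<le> N ^ m * (m + 1) ^ k" by (simp add: binomial_le_power)
  finally have "card (patterns N m x f R) \<le> N ^ m * (m + 1) ^ k" .
  then have "real (card (patterns N m x f R)) \<le> real (N ^ m * (m + 1) ^ k)" by (simp only: of_nat_le_iff)
  then show "real (card (patterns N m x f R)) \<le> real N ^ m * (real m + 1) ^ k"
    by (simp add: add.commute)
qed

text \<open>Labels lie in \<open>M\<close> and labelled vertices do not, so a star edge has exactly
  one end in \<open>M\<close>. Hence it determines its labelled vertex, and it is not in the core,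
  whose pairs avoid \<open>M\<close>. \<open>rs_prob_sparse\<close> needs this disjointness.\<close>

lemma star_edges_pattern:
  assumes \<pi>: "(M, \<phi>) \<in> patterns N m x f R" and R: "finite R" "f ` R \<subseteq> {..<N}"
  shows "star_edges N f R \<phi> \<subseteq> pairs N"
    and "card (star_edges N f R \<phi>) = card {D \<in> f ` R. \<phi> D < N}"
    and "star_edges N f R \<phi> \<inter> core f'' R'' M f' M' \<phi>' = {}"
proof -
  have inM: "\<phi> D \<in> M \<and> D \<notin> M" if "D \<in> f ` R" "\<phi> D < N" for D
    using \<pi> that unfolding patterns_def by (auto simp: PiE_iff)
  show "star_edges N f R \<phi> \<subseteq> pairs N"
    unfolding star_edges_def
  proof
    fix e assume "e \<in> (\<lambda>D. {D, \<phi> D}) ` {D \<in> f ` R. \<phi> D < N}"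
    then obtain D where e: "e = {D, \<phi> D}" and D: "D \<in> f ` R" "\<phi> D < N" by blast
    have "D < N" using D R by auto
    moreover have "D \<noteq> \<phi> D" using inM[OF D] by auto
    ultimately show "e \<in> pairs N" using e D by simp
  qed
  show "card (star_edges N f R \<phi>) = card {D \<in> f ` R. \<phi> D < N}"
    unfolding star_edges_def
  proof (intro card_image inj_onI)
    fix D D' assume D: "D \<in> {D \<in> f ` R. \<phi> D < N}" "D' \<in> {D \<in> f ` R. \<phi> D < N}" and eq: "{D, \<phi> D} = {D', \<phi> D'}"
    then have "\<phi> D' \<in> M" "D \<notin> M" using inM by auto
    then show "D = D'" using eq by (auto simp: doubleton_eq_iff)
  qed
  show "star_edges N f R \<phi> \<inter> core f'' R'' M f' M' \<phi>' = {}"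
    unfolding star_edges_def core_def using inM by blast
qed

text \<open>As \<open>f\<close> is injective on \<open>R\<close>, a fan keeps its size under
  projection and removes at most half its squared size in pairs. The error (m + 1) * k collects the
  pairs that meet \<open>M\<close> and the linear term of the binomial coefficient.\<close>

lemma card_core_ge:
  assumes R: "finite R" "card R \<le> k" "inj_on f R" and M: "finite M" "card M = m" and M': "finite M'"
  shows "((real (card (f ` R)))\<^sup>2 - (\<Sum>d\<in>M'. (real (card (fan f' R \<phi>' d)))\<^sup>2)) / 2 - (real m + 1) * k
    \<le> real (card (core f R M f' M' \<phi>'))"
proof -
  define F where "F = (\<Union>d\<in>M'. [f ` fan f' R \<phi>' d]\<^bsup>2\<^esup>)"
  define H where "H = {e \<in> [f ` R]\<^bsup>2\<^esup>. e \<inter> M \<noteq> {}}"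
  have choose2: "real (n choose 2) = real n * (real n - 1) / 2" for n
    by (induction n) (auto simp: numeral_2_eq_2 field_simps)
  have finfR: "finite ([f ` R]\<^bsup>2\<^esup>)" using R by (simp add: finite_imp_finite_nsets)
  have finfan: "finite (fan f' R \<phi>' d)" for d using R by (simp add: fan_def)
  have finF: "finite F" unfolding F_def using M' finfan by (auto intro!: finite_imp_finite_nsets)
  have cF: "real (card F) \<le> (\<Sum>d\<in>M'. (real (card (fan f' R \<phi>' d)))\<^sup>2) / 2"
  proof -
    have "card F \<le> (\<Sum>d\<in>M'. card ([f ` fan f' R \<phi>' d]\<^bsup>2\<^esup>))"
      unfolding F_def by (rule card_UN_le[OF M'])
    then have "real (card F) \<le> (\<Sum>d\<in>M'. real (card ([f ` fan f' R \<phi>' d]\<^bsup>2\<^esup>)))"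
      by (metis of_nat_le_iff of_nat_sum)
    also have "\<dots> \<le> (\<Sum>d\<in>M'. (real (card (fan f' R \<phi>' d)))\<^sup>2 / 2)"
    proof (intro sum_mono)
      fix d
      have "card (f ` fan f' R \<phi>' d) = card (fan f' R \<phi>' d)"
        using R(3) by (intro card_image) (auto simp: fan_def inj_on_def)
      then have "real (card ([f ` fan f' R \<phi>' d]\<^bsup>2\<^esup>)) = real (card (fan f' R \<phi>' d)) * (real (card (fan f' R \<phi>' d)) - 1) / 2"
        using finfan by (simp add: choose2)
      also have "\<dots> \<le> (real (card (fan f' R \<phi>' d)))\<^sup>2 / 2"
        by (simp add: power2_eq_square algebra_simps)
      finally show "real (card ([f ` fan f' R \<phi>' d]\<^bsup>2\<^esup>)) \<le> (real (card (fan f' R \<phi>' d)))\<^sup>2 / 2" .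
    qed
    finally show ?thesis by (simp add: sum_divide_distrib)
  qed
  have cH: "real (card H) \<le> real m * k"
  proof -
    have "H \<subseteq> (\<lambda>(x, y). {x, y}) ` (M \<times> f ` R)"
    proof
      fix h assume h: "h \<in> H"
      then obtain x y where xy: "h = {x, y}" "x \<in> f ` R" "y \<in> f ` R" "x \<in> M \<or> y \<in> M"
        by (auto simp: H_def elim!: nsets2_E)
      then show "h \<in> (\<lambda>(x, y). {x, y}) ` (M \<times> f ` R)"
        by (auto intro: image_eqI[of _ _ "(x, y)"] image_eqI[of _ _ "(y, x)"])
    qed
    then have "card H \<le> card ((\<lambda>(x, y). {x, y}) ` (M \<times> f ` R))" using M R by (intro card_mono) auto
    also have "\<dots> \<le> card (M \<times> f ` R)" using M R by (intro card_image_le) auto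
    also have "\<dots> \<le> m * k"
      using card_image_le[OF R(1), of f] R M by (simp add: card_cartesian_product mult_left_mono)
    finally show ?thesis by (metis of_nat_le_iff of_nat_mult)
  qed
  have "[f ` R]\<^bsup>2\<^esup> \<subseteq> core f R M f' M' \<phi>' \<union> (F \<union> H)"
    by (auto simp: core_def F_def H_def)
  moreover have "finite (core f R M f' M' \<phi>' \<union> (F \<union> H))"
    using finfR finF by (auto simp: core_def H_def)
  ultimately have "card ([f ` R]\<^bsup>2\<^esup>) \<le> card (core f R M f' M' \<phi>' \<union> (F \<union> H))" by (intro card_mono)
  also have "\<dots> \<le> card (core f R M f' M' \<phi>') + (card F + card H)"
    by (meson card_Un_le order.trans add_mono order.refl)
  finally have "real (card ([f ` R]\<^bsup>2\<^esup>)) \<le> real (card (core f R M f' M' \<phi>')) + (real (card F) + real (card H))"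
    by (metis of_nat_add of_nat_le_iff)
  moreover have "real (card ([f ` R]\<^bsup>2\<^esup>)) = (real (card (f ` R)))\<^sup>2 / 2 - real (card (f ` R)) / 2"
    using R by (simp add: choose2 power2_eq_square right_diff_distrib diff_divide_distrib)
  moreover have "real (card (f ` R)) \<le> k" using card_image_le[OF R(1), of f] R by simp
  ultimately show ?thesis using cF cH by (simp add: algebra_simps)
qed

text \<open>\<open>exponent_bound\<close> scaled by \<open>k\<close>, with \<open>U\<close> the
  labelled elements and \<open>Y\<close> their projection. Since \<open>U\<close> projects into
  \<open>Y\<close>, the projection of \<open>S\<close> has at most k - card U + card Y elements. The
  fans partition \<open>U\<close>, so their sum of squares is at most card U times the largest fan,
  which yields both bounds on it.\<close>

lemma pattern_exponent:
  fixes \<eta> \<xi> c0 :: real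
  assumes \<eta>: "0 < \<eta>" "2 * \<eta> \<le> (1 + \<eta>) * \<xi>" and \<xi>: "0 < \<xi>" "\<xi> < 1 / 2" "(1 + \<eta>) * \<xi> \<le> 1 / 2"
    and c0: "c0 \<le> \<eta> * (1 - 2 * \<xi>)" "(1 + \<eta>) * c0 \<le> \<eta> * (1 - \<eta>)" "2 * (1 + \<eta>) * c0 \<le> \<eta>"
    and S: "finite S" "card S = k" "R \<subseteq> S" and k: "k > 0"
    and \<pi>: "(M, \<phi>) \<in> patterns N m (\<xi> * k) f R"
  shows "- real (card {D \<in> f ` R. \<phi> D < N}) -
      (1 + \<eta>) * ((real (card (f ` S)))\<^sup>2 - (\<Sum>d\<in>M. (real (card (fan f R \<phi> d)))\<^sup>2)) / (2 * k)
    \<le> k / 2 - card (f ` S) - c0 / 2 * k"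
proof -
  have M: "M \<subseteq> {..<N}" "finite M" using \<pi> by (auto simp: patterns_def nsets_def)
  have finR: "finite R" using S finite_subset by blast
  define U where "U = {u \<in> R. \<phi> (f u) < N}"
  define Y where "Y = {D \<in> f ` R. \<phi> D < N}"
  define l where "l = (\<Sum>d\<in>M. (real (card (fan f R \<phi> d)))\<^sup>2)"
  have UN: "U = (\<Union>d\<in>M. fan f R \<phi> d)"
  proof -
    have "\<phi> (f u) \<in> insert N M" if "u \<in> R" for u
      using \<pi> that by (auto simp: patterns_def PiE_iff)
    then show ?thesis using M by (auto simp: U_def fan_def)
  qed
  have finfan: "finite (fan f R \<phi> d)" for d using finR by (simp add: fan_def)
  have "card U = (\<Sum>d\<in>M. card (fan f R \<phi> d))"
    unfolding UN using M finfan by (intro card_UN_disjoint) (auto simp: fan_def)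
  then have cU: "real (card U) = (\<Sum>d\<in>M. real (card (fan f R \<phi> d)))" by simp
  have UR: "card U \<le> k"
  proof -
    have "card U \<le> card S" using S by (intro card_mono) (auto simp: U_def)
    then show ?thesis using S by simp
  qed
  have l1: "l \<le> (real (card U))\<^sup>2"
  proof -
    have "l \<le> (\<Sum>d\<in>M. real (card (fan f R \<phi> d)) * real (card U))"
      unfolding l_def power2_eq_square
    proof (intro sum_mono mult_left_mono)
      fix d assume "d \<in> M"
      then have "card (fan f R \<phi> d) \<le> card U" unfolding UN using M finfan by (intro card_mono) auto
      then show "real (card (fan f R \<phi> d)) \<le> real (card U)" by simp
    qed simp
    then show ?thesis by (simp add: sum_distrib_right[symmetric] cU[symmetric] power2_eq_square)
  qed
  have l2: "l \<le> \<xi> * k * real (card U)"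
  proof -
    have "l \<le> (\<Sum>d\<in>M. \<xi> * k * real (card (fan f R \<phi> d)))"
      unfolding l_def power2_eq_square using \<pi> M by (intro sum_mono mult_right_mono) (auto simp: patterns_def)
    then show ?thesis by (simp add: sum_distrib_left[symmetric] cU[symmetric])
  qed
  have cb: "card (f ` S) + card U \<le> k + card Y"
  proof -
    have US: "U \<subseteq> S" using S by (auto simp: U_def)
    have "f ` S \<subseteq> f ` (S - U) \<union> Y"
      using S by (auto simp: U_def Y_def)
    then have "card (f ` S) \<le> card (f ` (S - U) \<union> Y)"
      using S finR by (intro card_mono) (auto simp: Y_def)
    also have "\<dots> \<le> card (f ` (S - U)) + card Y" by (rule card_Un_le)
    also have "card (f ` (S - U)) \<le> card (S - U)" using S by (intro card_image_le) auto
    also have "card (S - U) = card S - card U" using US S finite_subset by (intro card_Diff_subset) blast+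
    finally show ?thesis using UR S by simp
  qed
  have "- (real (card Y) / k) - (1 + \<eta>) * ((real (card (f ` S)) / k)\<^sup>2 - l / (real k)\<^sup>2) / 2 \<le> 1 / 2 - real (card (f ` S)) / k - c0 / 2"
  proof (rule exponent_bound[OF \<eta> \<xi> _ _ _ _ _ _ _ c0, where z = "real (card U) / k"])
    show "real (card U) / k \<le> 1" using UR k by simp
    have "real (card (f ` S)) + real (card U) \<le> real k + real (card Y)" using cb by linarith
    then show "real (card (f ` S)) / k \<le> 1 - real (card U) / k + real (card Y) / k"
      using k by (simp add: field_simps)
    show "l / (real k)\<^sup>2 \<le> (real (card U) / k)\<^sup>2"
      unfolding power_divide using l1 by (intro divide_right_mono) auto
    show "l / (real k)\<^sup>2 \<le> \<xi> * (real (card U) / k)"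
      using l2 k by (simp add: field_simps power2_eq_square)
  qed auto
  then have "k * (- (real (card Y) / k) - (1 + \<eta>) * ((real (card (f ` S)) / k)\<^sup>2 - l / (real k)\<^sup>2) / 2)
      \<le> k * (1 / 2 - real (card (f ` S)) / k - c0 / 2)"
    by (intro mult_left_mono) auto
  moreover have "k * (- (real (card Y) / k) - (1 + \<eta>) * ((real (card (f ` S)) / k)\<^sup>2 - l / (real k)\<^sup>2) / 2)
      = - real (card Y) - (1 + \<eta>) * ((real (card (f ` S)))\<^sup>2 - l) / (2 * k)"
  proof -
    have "(real (card (f ` S)) / k)\<^sup>2 - l / (real k)\<^sup>2 = ((real (card (f ` S)))\<^sup>2 - l) / (real k)\<^sup>2"
      by (simp add: power_divide diff_divide_distrib)
    moreover have "k * (- (y / k) - (1 + \<eta>) * (W / (real k)\<^sup>2) / 2) = - y - (1 + \<eta>) * W / (2 * k)" for y W :: real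
      using k by (simp add: power2_eq_square field_simps)
    ultimately show ?thesis by simp
  qed
  moreover have "k * (1 / 2 - real (card (f ` S)) / k - c0 / 2) = k / 2 - card (f ` S) - c0 / 2 * k"
    using k by (simp add: algebra_simps)
  ultimately show ?thesis unfolding Y_def l_def by linarith
qed

text \<open>\<open>A i\<close> concerns only one sample and \<open>B i\<close> only the other, so
  their probabilities multiply.\<close>

lemma rs_exp_joint_union:
  assumes p: "0 \<le> p" "p \<le> 1" and I: "finite I"
    and P: "\<And>X Y. P X Y \<Longrightarrow> \<exists>i\<in>I. A i X \<and> B i Y"
    and b: "\<And>i. i \<in> I \<Longrightarrow> rs_prob E p (A i) * rs_prob E p (B i) \<le> b" and c: "real (card I) \<le> c" "0 \<le> b"
  shows "rs_exp E p (\<lambda>X. rs_prob E p (\<lambda>Y. P X Y)) \<le> c * b"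
proof -
  have "rs_exp E p (\<lambda>X. rs_prob E p (\<lambda>Y. P X Y)) \<le>
      rs_exp E p (\<lambda>X. rs_exp E p (\<lambda>Y. \<Sum>i\<in>I. of_bool (A i X) * of_bool (B i Y)))"
  proof (intro rs_exp_mono p)
    fix X Y
    show "of_bool (P X Y) \<le> (\<Sum>i\<in>I. of_bool (A i X) * of_bool (B i Y) :: real)"
    proof (cases "P X Y")
      case True
      then obtain i where i: "i \<in> I" "A i X" "B i Y" using P by blast
      have "of_bool (A i X) * of_bool (B i Y) \<le> (\<Sum>i\<in>I. of_bool (A i X) * of_bool (B i Y) :: real)"
        using i I by (intro member_le_sum) auto
      then show ?thesis using i True by simp
    qed (auto intro: sum_nonneg)
  qed
  also have "\<dots> = (\<Sum>i\<in>I. rs_prob E p (A i) * rs_prob E p (B i))"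
    by (simp add: rs_exp_sum rs_exp_cmult rs_exp_cmult_right)
  also have "\<dots> \<le> card I * b" using sum_bounded_above[of I _ b] b by fastforce
  also have "\<dots> \<le> c * b" using c by (intro mult_right_mono)
  finally show ?thesis .
qed

text \<open>Failures attached to a single set whose probabilities are small enough to be summed over
  all \<open>k\<close>-sets without weights.\<close>

definition crude_failure :: "nat \<Rightarrow> nat \<Rightarrow> nat \<Rightarrow> real \<Rightarrow> real \<Rightarrow> real \<Rightarrow> ('v \<Rightarrow> nat) \<Rightarrow> 'v set \<Rightarrow> nat set \<Rightarrow> nat set set \<Rightarrow> bool" where
  "crude_failure N m t T z e f R Q X \<longleftrightarrow>
     (\<exists>F. triangle_packing N X F \<and> (\<forall>A\<in>F. [A]\<^bsup>2\<^esup> \<inter> [Q]\<^bsup>2\<^esup> \<noteq> {}) \<and> t \<le> card F) \<or>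
     m \<le> card {d\<in>{..<N}. T < real (card (links f R X d))} \<or>
     z \<le> (\<Sum>d\<in>{..<N} - f ` R. if real (card (links f R X d)) \<le> T
        then real (card (wedges f R X d)) else 0) \<or>
     e \<le> real (card (X \<inter> [f ` R]\<^bsup>2\<^esup>))"

text \<open>These two properties do not refer to a \<open>k\<close>-set, so a constant failure
  probability is affordable and they can be assumed in the event studied for each set.\<close>

definition regular_sample :: "nat \<Rightarrow> nat \<Rightarrow> real \<Rightarrow> ('v \<Rightarrow> nat) \<Rightarrow> 'v set \<Rightarrow> nat set set \<Rightarrow> bool" where
  "regular_sample N g x f V X \<longleftrightarrow>
     \<not> (\<exists>a<N. \<exists>c<N. a \<noteq> c \<and> g \<le> card {d. {a, d} \<in> X \<and> {c, d} \<in> X}) \<and>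
     \<not> (\<exists>d<N. x \<le> real (card (links f V X d)))"

text \<open>
  \<open>n\<close> vertices are mapped to \<open>N\<close> base vertices with fibres of size at most \<open>b\<close>, \<open>p\<close> is the edge
  density of each base graph and \<open>\<xi> k\<close> bounds the degrees in the blow-ups. A base vertex has large
  degree into a set if it sees more than \<open>T\<close> of its elements, and fewer than \<open>m\<close> such base vertices
  are expected. The numbers \<open>g\<close>, \<open>t\<close>, \<open>z\<close>, \<open>e\<close>, \<open>w\<close> bound codegrees, edge-disjoint triangles,
  closed pairs, edges and stray pairs, \<open>s\<close> is the number of deleted edges that is tolerated, and
  \<open>l0\<close>, \<open>l1\<close>, \<open>l2\<close>, \<open>l3\<close>, \<open>c\<close> are the parameters of the exponential moment bounds.
\<close>

locale two_bites =
  fixes n k N m g t :: nat and p L \<xi> \<eta> c0 kap b T z e s w l0 l1 l2 l3 c \<delta>0 :: real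
  assumes k: "0 < k" "k \<le> n" and N: "0 < N" "m \<le> N" and t: "0 < t" "6 * real t \<le> s" and p: "0 \<le> p" "p \<le> 1"
    and L: "exp L = k" "0 \<le> L"
    and pL: "p * k \<le> kap * L" "1 \<le> kap * L" and l0: "0 \<le> l0" "p * (1 - exp (- l0)) * k = (1 + \<eta>) * L"
    and \<eta>: "0 < \<eta>" "2 * \<eta> \<le> (1 + \<eta>) * \<xi>" and \<xi>: "0 < \<xi>" "\<xi> < 1 / 2" "(1 + \<eta>) * \<xi> \<le> 1 / 2"
    and c0: "c0 \<le> \<eta> * (1 - 2 * \<xi>)" "(1 + \<eta>) * c0 \<le> \<eta> * (1 - \<eta>)" "2 * (1 + \<eta>) * c0 \<le> \<eta>"
    and b: "0 < b" and T: "0 < T"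
    and fibre_tail: "4 * (real N * exp (2 * real n / N - b)) \<le> 1"
    and codegree: "16 * ((real N)\<^sup>2 * (real N * p\<^sup>2) ^ g) \<le> 1"
    and degree: "0 \<le> l1" "l1 * b \<le> 1" "16 * (real N * exp (p * (l1 * (1 + l1 * b)) * n - l1 * (\<xi> * k))) \<le> 1"
    and packing: "(exp 1 * ((real k)\<^sup>2 * N * p ^ 3) / t) ^ t \<le> \<delta>0"
    and large: "0 \<le> l2" "real N ^ m * exp (- l2 * (m * T / (2 * b)) + p * (real m * real k) * exp l2) \<le> \<delta>0"
    and closed: "0 \<le> c" "c * b \<le> 1" "2 * p * c * k \<le> 1"
      "exp (- (c / T) * z + (c / T) * (exp 3 * (k * p)\<^sup>2) * N) \<le> \<delta>0"
    and sparse: "exp (- e + p * (real k)\<^sup>2 * exp 1) \<le> \<delta>0"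
    and stray: "0 \<le> l3" "exp (- l3 * (s / 2) + p * w * exp l3) \<le> \<delta>0"
      "b * k + z + T * (2 * b * e) + 2 * (b * m * k) + 2 * (b * (real m * real m * real g) * k) \<le> w"
    and crude_sum: "40 * (real (n choose k) * \<delta>0) \<le> 1"
    and main_sum: "16 * ((real N ^ m * (real m + 1) ^ k)\<^sup>2 *
       ((kap * L) ^ (2 * k) * exp (2 * l0 * s + 2 * (1 + \<eta>) * L * (real m + 1) + k * L * (1 - c0))) *
       (real (n choose k) * ((real k / N + 1 / k) ^ k)\<^sup>2)) \<le> 1"
begin

abbreviation "expect \<equiv> rs_exp (pairs N) p"
abbreviation "prob P \<equiv> expect (\<lambda>X. of_bool (P X))"

text \<open>The leading part is exp (k * L * (1 - c0)). The weights of all \<open>k\<close>-sets add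
  up to exp (- k * L) up to lower order, so \<open>c0\<close> is the net saving. The other factors
  are the logarithmic excess of \<open>p\<close> over 1 / k, the tolerated deletions, and the error
  terms in the sizes of the cores.\<close>

definition "main_factor = (kap * L) ^ (2 * k) * exp (2 * l0 * s + 2 * (1 + \<eta>) * L * (real m + 1) + k * L * (1 - c0))"

text \<open>The two colours have to be estimated together: the core of one colour loses the pairs
  closed by the fans of the other, and the star edges that pay for these fans belong to that other
  colour. In the sum of the two exponents the fan sums \<open>A1\<close> and \<open>A2\<close> can
  be exchanged, after which each colour stands with its own fans and \<open>pattern_exponent\<close>
  applies twice.\<close>

lemma pattern_pair_le:
  fixes f1 f2 :: "'v \<Rightarrow> nat"
  assumes S: "finite S" "card S = k" and R1: "R1 \<subseteq> S" "inj_on f1 R1" "f1 ` R1 = f1 ` S"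
    and R2: "R2 \<subseteq> S" "inj_on f2 R2" "f2 ` R2 = f2 ` S" and fN: "f1 ` S \<subseteq> {..<N}" "f2 ` S \<subseteq> {..<N}"
    and \<pi>1: "(M1, \<phi>1) \<in> patterns N m (\<xi> * k) f1 R2" and \<pi>2: "(M2, \<phi>2) \<in> patterns N m (\<xi> * k) f2 R1"
  shows "prob (\<lambda>X. star_edges N f1 R2 \<phi>1 \<subseteq> X \<and> real (card (X \<inter> core f1 R1 M1 f2 M2 \<phi>2)) \<le> s) *
      prob (\<lambda>X. star_edges N f2 R1 \<phi>2 \<subseteq> X \<and> real (card (X \<inter> core f2 R2 M2 f1 M1 \<phi>1)) \<le> s)
    \<le> main_factor * ((1 / k) ^ card (f1 ` S) * (1 / k) ^ card (f2 ` S))"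
proof -
  define y1 where "y1 = card {D \<in> f1 ` R2. \<phi>1 D < N}"
  define y2 where "y2 = card {D \<in> f2 ` R1. \<phi>2 D < N}"
  define C1 where "C1 = core f1 R1 M1 f2 M2 \<phi>2"
  define C2 where "C2 = core f2 R2 M2 f1 M1 \<phi>1"
  define q where "q = p * (1 - exp (- l0))"
  define \<alpha> where "\<alpha> = real (card (f1 ` S))"
  define \<beta> where "\<beta> = real (card (f2 ` S))"
  define A1 where "A1 = (\<Sum>d\<in>M1. (real (card (fan f1 R2 \<phi>1 d)))\<^sup>2)"
  define A2 where "A2 = (\<Sum>d\<in>M2. (real (card (fan f2 R1 \<phi>2 d)))\<^sup>2)"
  have fin: "finite R1" "finite R2"
    using finite_subset[OF R1(1) S(1)] finite_subset[OF R2(1) S(1)] by auto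
  have cR: "card R1 \<le> k" "card R2 \<le> k"
    using card_mono[OF S(1) R1(1)] card_mono[OF S(1) R2(1)] S(2) by auto
  have fR: "f1 ` R2 \<subseteq> {..<N}" "f2 ` R1 \<subseteq> {..<N}" "f1 ` R1 \<subseteq> {..<N}" "f2 ` R2 \<subseteq> {..<N}"
    using image_mono[OF R1(1), of f2] image_mono[OF R2(1), of f1] fN R1(3) R2(3) by auto
  have M: "finite M1" "card M1 = m" "finite M2" "card M2 = m"
    using \<pi>1 \<pi>2 by (auto simp: patterns_def nsets_def)
  have q0: "0 \<le> q" using p l0 by (simp add: q_def)
  have qk: "q * k = (1 + \<eta>) * L" using l0 by (simp add: q_def)
  have sub: "C1 \<subseteq> pairs N" "C2 \<subseteq> pairs N"
    unfolding C1_def C2_def core_def using nsets_mono[OF fR(3), of 2] nsets_mono[OF fR(4), of 2] by auto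
  have y: "y1 \<le> k" "y2 \<le> k"
  proof -
    have "y1 \<le> card (f1 ` R2)" unfolding y1_def using fin by (intro card_mono) auto
    also have "\<dots> \<le> card R2" using fin by (intro card_image_le)
    finally show "y1 \<le> k" using cR by simp
    have "y2 \<le> card (f2 ` R1)" unfolding y2_def using fin by (intro card_mono) auto
    also have "\<dots> \<le> card R1" using fin by (intro card_image_le)
    finally show "y2 \<le> k" using cR by simp
  qed
  have P1: "prob (\<lambda>X. star_edges N f1 R2 \<phi>1 \<subseteq> X \<and> real (card (X \<inter> C1)) \<le> s)
      \<le> p ^ y1 * exp (l0 * s - q * card C1)"
    unfolding y1_def q_def star_edges_pattern(2)[OF \<pi>1 fin(2) fR(1), symmetric]
    by (rule rs_prob_sparse[OF finite_pairs star_edges_pattern(1)[OF \<pi>1 fin(2) fR(1)] sub(1) _ p l0(1)])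
      (simp add: C1_def star_edges_pattern(3)[OF \<pi>1 fin(2) fR(1)])
  have P2: "prob (\<lambda>X. star_edges N f2 R1 \<phi>2 \<subseteq> X \<and> real (card (X \<inter> C2)) \<le> s)
      \<le> p ^ y2 * exp (l0 * s - q * card C2)"
    unfolding y2_def q_def star_edges_pattern(2)[OF \<pi>2 fin(1) fR(2), symmetric]
    by (rule rs_prob_sparse[OF finite_pairs star_edges_pattern(1)[OF \<pi>2 fin(1) fR(2)] sub(2) _ p l0(1)])
      (simp add: C2_def star_edges_pattern(3)[OF \<pi>2 fin(1) fR(2)])
  \<comment> \<open>Since kap * L \<ge> 1, its exponent can be raised from \<open>y\<close> to
    \<open>k\<close>, which makes this factor independent of the pattern.\<close>
  have py: "p ^ y \<le> (kap * L) ^ k * exp (- L * y)" if "y \<le> k" for y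
  proof -
    have "p \<le> kap * L * exp (- L)"
      using pL k L(1) by (simp add: exp_minus field_simps)
    then have "p ^ y \<le> (kap * L * exp (- L)) ^ y" using p by (intro power_mono)
    also have "\<dots> = (kap * L) ^ y * exp (- L * y)"
      by (simp add: power_mult_distrib exp_of_nat2_mult[symmetric] del: mult_minus_left)
    also have "\<dots> \<le> (kap * L) ^ k * exp (- L * y)"
      using pL that by (intro mult_right_mono power_increasing) auto
    finally show ?thesis .
  qed
  have core: "- q * card C \<le> - L * ((1 + \<eta>) * (x\<^sup>2 - A) / (2 * k)) + (1 + \<eta>) * L * (real m + 1)"
    if "(x\<^sup>2 - A) / 2 - (real m + 1) * k \<le> real (card C)" for x A :: real and C :: "nat set set"
  proof -
    have "q * ((x\<^sup>2 - A) / 2 - (real m + 1) * k) \<le> q * real (card C)"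
      using that q0 by (intro mult_left_mono)
    moreover have "q * ((x\<^sup>2 - A) / 2 - (real m + 1) * k) =
        (q * k) * ((x\<^sup>2 - A) / (2 * k)) - (q * k) * (real m + 1)"
      using k by (simp add: field_simps)
    moreover have "L * ((1 + \<eta>) * (x\<^sup>2 - A) / (2 * k)) = ((1 + \<eta>) * L) * ((x\<^sup>2 - A) / (2 * k))"
      by simp
    ultimately show ?thesis unfolding qk mult_minus_left by linarith
  qed
  have core1: "- q * card C1 \<le> - L * ((1 + \<eta>) * (\<alpha>\<^sup>2 - A2) / (2 * k)) + (1 + \<eta>) * L * (real m + 1)"
    using card_core_ge[OF fin(1) cR(1) R1(2) M(1,2,3), of f2 \<phi>2] unfolding R1(3)
    by (intro core) (simp add: C1_def \<alpha>_def A2_def)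
  have core2: "- q * card C2 \<le> - L * ((1 + \<eta>) * (\<beta>\<^sup>2 - A1) / (2 * k)) + (1 + \<eta>) * L * (real m + 1)"
    using card_core_ge[OF fin(2) cR(2) R2(2) M(3,4,1), of f1 \<phi>1] unfolding R2(3)
    by (intro core) (simp add: C2_def \<beta>_def A1_def)
  have e1: "- real y1 - (1 + \<eta>) * (\<alpha>\<^sup>2 - A1) / (2 * k) \<le> k / 2 - \<alpha> - c0 / 2 * k"
    using pattern_exponent[OF \<eta> \<xi> c0 S R2(1) k(1) \<pi>1] by (simp add: y1_def \<alpha>_def A1_def)
  have e2: "- real y2 - (1 + \<eta>) * (\<beta>\<^sup>2 - A2) / (2 * k) \<le> k / 2 - \<beta> - c0 / 2 * k"
    using pattern_exponent[OF \<eta> \<xi> c0 S R1(1) k(1) \<pi>2] by (simp add: y2_def \<beta>_def A2_def)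
  have sum12: "(1 + \<eta>) * (\<alpha>\<^sup>2 - A2) / (2 * k) + (1 + \<eta>) * (\<beta>\<^sup>2 - A1) / (2 * k) =
      (1 + \<eta>) * (\<alpha>\<^sup>2 - A1) / (2 * k) + (1 + \<eta>) * (\<beta>\<^sup>2 - A2) / (2 * k)"
    by (simp add: add_divide_distrib[symmetric] algebra_simps)
  have "- real y1 - real y2 - ((1 + \<eta>) * (\<alpha>\<^sup>2 - A2) / (2 * k) + (1 + \<eta>) * (\<beta>\<^sup>2 - A1) / (2 * k))
      \<le> k - \<alpha> - \<beta> - c0 * k"
    unfolding sum12 using e1 e2 by linarith
  then have "L * (- real y1 - real y2 - ((1 + \<eta>) * (\<alpha>\<^sup>2 - A2) / (2 * k) + (1 + \<eta>) * (\<beta>\<^sup>2 - A1) / (2 * k)))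
      \<le> L * (k - \<alpha> - \<beta> - c0 * k)"
    using L by (intro mult_left_mono)
  moreover have "- L * y1 + - L * y2 - q * card C1 - q * card C2
      \<le> 2 * (1 + \<eta>) * L * (real m + 1) + k * L * (1 - c0) + - L * \<alpha> + - L * \<beta>"
    if "L * (- real y1 - real y2 - (u1 + u2)) \<le> L * (k - \<alpha> - \<beta> - c0 * k)"
      "- q * card C1 \<le> - L * u1 + (1 + \<eta>) * L * (real m + 1)"
      "- q * card C2 \<le> - L * u2 + (1 + \<eta>) * L * (real m + 1)" for u1 u2 :: real
    using that by (simp add: algebra_simps)
  ultimately have exponent: "- L * y1 + - L * y2 - q * card C1 - q * card C2
      \<le> 2 * (1 + \<eta>) * L * (real m + 1) + k * L * (1 - c0) + - L * \<alpha> + - L * \<beta>"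
    using core1 core2 by blast
  have xpow: "(1 / real k) ^ i = exp (- L * i)" for i
  proof -
    have "1 / real k = exp (- L)" using L by (simp add: exp_minus inverse_eq_divide)
    then show ?thesis by (simp add: exp_of_nat2_mult[symmetric] del: mult_minus_left)
  qed
  have "prob (\<lambda>X. star_edges N f1 R2 \<phi>1 \<subseteq> X \<and> real (card (X \<inter> C1)) \<le> s) *
      prob (\<lambda>X. star_edges N f2 R1 \<phi>2 \<subseteq> X \<and> real (card (X \<inter> C2)) \<le> s)
      \<le> (p ^ y1 * exp (l0 * s - q * card C1)) * (p ^ y2 * exp (l0 * s - q * card C2))"
    using P1 P2 p by (intro mult_mono rs_exp_nonneg) auto
  also have "\<dots> \<le> ((kap * L) ^ k * exp (- L * y1) * exp (l0 * s - q * card C1)) *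
      ((kap * L) ^ k * exp (- L * y2) * exp (l0 * s - q * card C2))"
    using py[OF y(1)] py[OF y(2)] p pL by (intro mult_mono mult_right_mono) auto
  also have "\<dots> = (kap * L) ^ (2 * k) * exp (2 * l0 * s + (- L * y1 + - L * y2 - q * card C1 - q * card C2))"
  proof -
    have "exp (2 * l0 * s + (- L * y1 + - L * y2 - q * card C1 - q * card C2)) =
        exp (- L * y1) * exp (l0 * s - q * card C1) * (exp (- L * y2) * exp (l0 * s - q * card C2))"
      unfolding exp_add[symmetric] by (rule arg_cong[where f = exp]) simp
    moreover have "(kap * L) ^ (2 * k) = (kap * L) ^ k * (kap * L) ^ k"
      by (simp only: mult_2 power_add)
    ultimately show ?thesis by (simp only: mult_ac)
  qed
  also have "\<dots> \<le> (kap * L) ^ (2 * k) *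
      exp (2 * l0 * s + (2 * (1 + \<eta>) * L * (real m + 1) + k * L * (1 - c0) + - L * \<alpha> + - L * \<beta>))"
    using exponent pL by (intro mult_left_mono) auto
  also have "\<dots> = main_factor * ((1 / k) ^ card (f1 ` S) * (1 / k) ^ card (f2 ` S))"
    unfolding xpow main_factor_def \<alpha>_def \<beta>_def by (simp only: exp_add mult_ac add_ac)
  finally show ?thesis unfolding C1_def C2_def .
qed

lemma crude_failure_le:
  fixes f :: "'v \<Rightarrow> nat"
  assumes R: "finite R" "card R \<le> k" "f ` R \<subseteq> {..<N}" and Q: "finite Q" "card Q \<le> k"
    and fib: "\<And>D. real (card {u \<in> R. f u = D}) \<le> b"
  shows "prob (crude_failure N m t T z e f R Q) \<le> 4 * \<delta>0"
proof -
  have "prob (\<lambda>X. e \<le> real (card (X \<inter> [f ` R]\<^bsup>2\<^esup>))) \<le> exp (- 1 * e + p * card ([f ` R]\<^bsup>2\<^esup>) * exp 1)"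
    using nsets_mono[OF R(3), of 2] by (intro rs_prob_upper_tail p) auto
  also have "\<dots> \<le> exp (- e + p * (real k)\<^sup>2 * exp 1)"
  proof -
    have "card ([f ` R]\<^bsup>2\<^esup>) \<le> card (f ` R) ^ 2" using R by (simp add: binomial_le_power)
    also have "\<dots> \<le> k ^ 2" using card_image_le[OF R(1), of f] R by (intro power_mono) auto
    finally have "real (card ([f ` R]\<^bsup>2\<^esup>)) \<le> (real k)\<^sup>2"
      by (metis of_nat_le_iff of_nat_power)
    then show ?thesis using p by (auto intro!: mult_right_mono mult_left_mono)
  qed
  finally have 4: "prob (\<lambda>X. e \<le> real (card (X \<inter> [f ` R]\<^bsup>2\<^esup>))) \<le> \<delta>0"
    using sparse by linarith
  have 3: "prob (\<lambda>X. z \<le> (\<Sum>d\<in>{..<N} - f ` R. if real (card (links f R X d)) \<le> T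
        then real (card (wedges f R X d)) else 0)) \<le> \<delta>0"
    by (rule order.trans[OF closed_pairs_tail[OF p R(1,2) fib _ closed(1-3) T] closed(4)]) (use b in simp)
  have 2: "prob (\<lambda>X. m \<le> card {d\<in>{..<N}. T < real (card (links f R X d))}) \<le> \<delta>0"
    by (rule order.trans[OF large_degrees_tail[OF p R fib large(1) b] large(2)])
  have 1: "prob (\<lambda>X. \<exists>F. triangle_packing N X F \<and> (\<forall>A\<in>F. [A]\<^bsup>2\<^esup> \<inter> [Q]\<^bsup>2\<^esup> \<noteq> {}) \<and> t \<le> card F) \<le> \<delta>0"
    by (rule order.trans[OF triangle_packing_tail[OF p Q t(1)] packing])
  show ?thesis
    unfolding crude_failure_def
    by (rule order.trans[OF rs_prob_disj_le[OF p]], rule order.trans[OF add_mono[OF 1 rs_prob_disj_le[OF p]]],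
      rule order.trans[OF add_left_mono[OF add_mono[OF 2 rs_prob_disj_le[OF p]]]])
      (use 3 4 in linarith)
qed

text \<open>Outside the failures \<open>star_pattern\<close> applies. A fan consists of elements
  linked to its label, so the degree bound \<xi> * k for the blow-up also bounds the fans.\<close>

lemma pattern_exists:
  fixes f :: "'v \<Rightarrow> nat"
  assumes R: "finite R" "card R \<le> k" "f ` R \<subseteq> {..<N}" "R \<subseteq> V" "finite V"
    and fib: "\<And>D. real (card {u \<in> R. f u = D}) \<le> b"
    and X: "X \<subseteq> pairs N" and reg: "regular_sample N g (\<xi> * k) f V X" and crude: "\<not> crude_failure N m t T z e f R Q X"
  shows "\<exists>\<pi>\<in>patterns N m (\<xi> * k) f R. star_edges N f R (snd \<pi>) \<subseteq> X \<and> real (card (stray_pairs N X f R (snd \<pi>))) \<le> w"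
proof -
  have codeg: "card {d. {a, d} \<in> X \<and> {c, d} \<in> X} \<le> g" if "a < N" "c < N" "a \<noteq> c" for a c
    using reg that unfolding regular_sample_def by (meson le_cases)
  have deg: "real (card (links f V X d)) \<le> \<xi> * k" if "d < N" for d
    using reg that unfolding regular_sample_def by (meson le_cases)
  have e1: "card {d\<in>{..<N}. T < real (card (links f R X d))} \<le> m"
    and e2: "(\<Sum>d\<in>{..<N} - f ` R. if real (card (links f R X d)) \<le> T
        then real (card (wedges f R X d)) else 0) \<le> z"
    and e3: "real (card (X \<inter> [f ` R]\<^bsup>2\<^esup>)) \<le> e"
    using crude unfolding crude_failure_def by linarith+
  obtain M \<phi> where M: "M \<in> [{..<N}]\<^bsup>m\<^esup>" "\<phi> \<in> f ` R \<rightarrow>\<^sub>E insert N M"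
    and star: "\<And>D. D \<in> f ` R \<Longrightarrow> \<phi> D < N \<Longrightarrow> D \<notin> M \<and> {D, \<phi> D} \<in> X"
    and card: "real (card (stray_pairs N X f R \<phi>)) \<le>
       b * k + z + T * (2 * b * e) + 2 * (b * m * k) + 2 * (b * (real m * real m * real g) * k)"
    by (rule star_pattern[OF X R(1-3) fib e1 N(2) less_imp_le[OF T] e2 e3]) ((rule codeg; assumption), blast)
  have "real (card (fan f R \<phi> d)) \<le> \<xi> * k" if d: "d < N" for d
  proof -
    have "fan f R \<phi> d \<subseteq> (links f V X d)"
      using star R d by (auto simp: fan_def)
    then have "card (fan f R \<phi> d) \<le> card (links f V X d)" using R by (intro card_mono) auto
    then show ?thesis using deg[OF d] by linarith
  qed
  then have "(M, \<phi>) \<in> patterns N m (\<xi> * k) f R" using M star by (auto simp: patterns_def)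
  moreover have "star_edges N f R \<phi> \<subseteq> X" using star by (auto simp: star_edges_def)
  ultimately show ?thesis using card stray(3) by (intro bexI[of _ "(M, \<phi>)"]) auto
qed

end

text \<open>An edge in the core that survives the removal comes from a pair closed in the other
  colour but lying in no common fan, hence from a stray pair. Removed edges number at most 3 * t
  \<le> s / 2, and stray ones at most s / 2.\<close>

lemma card_core_le:
  fixes f f' :: "'v \<Rightarrow> nat"
  assumes X: "X \<subseteq> pairs N" and F: "triangle_packing N X F"
    and few: "\<not> (\<exists>F. triangle_packing N X F \<and> (\<forall>A\<in>F. [A]\<^bsup>2\<^esup> \<inter> [f ` S]\<^bsup>2\<^esup> \<noteq> {}) \<and> t \<le> card F)"
    and S: "finite S" "R \<subseteq> S" "f ` R = f ` S"
    and \<pi>: "(M', \<phi>') \<in> patterns N m x f' R"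
    and closed: "\<And>u v. u \<in> S \<Longrightarrow> v \<in> S \<Longrightarrow> u \<noteq> v \<Longrightarrow> {f u, f v} \<in> X - edges_of F \<Longrightarrow> closed_pair X' f' u v"
    and stray: "real (card (X \<inter> ((\<lambda>(u, v). {f u, f v}) ` stray_pairs N X' f' R \<phi>' \<inter> pairs N))) \<le> s / 2"
    and t: "6 * real t \<le> s"
  shows "real (card (X \<inter> core f R M f' M' \<phi>')) \<le> s"
proof -
  define U where "U = edges_of F"
  define Tk where "Tk = (\<lambda>(u, v). {f u, f v}) ` stray_pairs N X' f' R \<phi>' \<inter> pairs N"
  have "triangle_packing N X {A \<in> F. [A]\<^bsup>2\<^esup> \<inter> [f ` S]\<^bsup>2\<^esup> \<noteq> {}}"
    using F by (auto simp: triangle_packing_def edge_disjoint_def)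
  then have "\<not> t \<le> card {A \<in> F. [A]\<^bsup>2\<^esup> \<inter> [f ` S]\<^bsup>2\<^esup> \<noteq> {}}" using few by blast
  then have U3: "card (U \<inter> [f ` S]\<^bsup>2\<^esup>) \<le> 3 * t"
    unfolding U_def using S by (intro card_packing_edges_le[OF F]) auto
  have "X \<inter> core f R M f' M' \<phi>' \<subseteq> (U \<inter> [f ` S]\<^bsup>2\<^esup>) \<union> (X \<inter> Tk)"
  proof
    fix e assume e: "e \<in> X \<inter> core f R M f' M' \<phi>'"
    then have eS: "e \<in> [f ` S]\<^bsup>2\<^esup>" and eX: "e \<in> X" "e \<in> pairs N" using S X by (auto simp: core_def)
    obtain u v where uv: "e = {f u, f v}" "u \<in> R" "v \<in> R" "f u \<noteq> f v"
      using e by (auto simp: core_def elim!: nsets2_E)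
    show "e \<in> (U \<inter> [f ` S]\<^bsup>2\<^esup>) \<union> (X \<inter> Tk)"
    proof (cases "e \<in> U")
      case False
      have "closed_pair X' f' u v" by (rule closed) (use uv S False eX in \<open>auto simp: U_def\<close>)
      moreover have "\<not> (\<phi>' (f' u) = \<phi>' (f' v) \<and> \<phi>' (f' u) < N)"
      proof
        assume a: "\<phi>' (f' u) = \<phi>' (f' v) \<and> \<phi>' (f' u) < N"
        have "\<phi>' (f' u) \<in> insert N M'" using \<pi> uv by (auto simp: patterns_def PiE_iff)
        then have "\<phi>' (f' u) \<in> M'" using a by auto
        moreover have "e \<in> [f ` fan f' R \<phi>' (\<phi>' (f' u))]\<^bsup>2\<^esup>" using uv a by (auto simp: fan_def)
        ultimately show False using e by (auto simp: core_def)
      qed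
      ultimately have "(u, v) \<in> stray_pairs N X' f' R \<phi>'" using uv by (simp add: stray_pairs_def)
      then have "e \<in> Tk" unfolding Tk_def using uv eX by (auto intro: image_eqI[of _ _ "(u, v)"])
      then show ?thesis using eX by simp
    qed (use eS in simp)
  qed
  then have "card (X \<inter> core f R M f' M' \<phi>') \<le> card ((U \<inter> [f ` S]\<^bsup>2\<^esup>) \<union> (X \<inter> Tk))"
    using S by (intro card_mono) (auto simp: Tk_def intro!: finite_imp_finite_nsets)
  also have "\<dots> \<le> card (U \<inter> [f ` S]\<^bsup>2\<^esup>) + card (X \<inter> Tk)" by (rule card_Un_le)
  finally have "real (card (X \<inter> core f R M f' M' \<phi>')) \<le> real (card (U \<inter> [f ` S]\<^bsup>2\<^esup>)) + real (card (X \<inter> Tk))"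
    by linarith
  moreover have "real (card (U \<inter> [f ` S]\<^bsup>2\<^esup>)) \<le> 3 * real t" using U3 by linarith
  ultimately show ?thesis using stray t unfolding Tk_def by linarith
qed

context two_bites
begin

text \<open>Here \<open>P\<close> is fixed while \<open>X\<close> is random: it will be the set of
  stray pairs of the other colour. Both \<open>w\<close> and \<open>s\<close> allow few present
  edges among few pairs.\<close>

lemma stray_tail:
  fixes f :: "'v \<Rightarrow> nat" and P :: "('v \<times> 'v) set"
  assumes "finite P" "real (card P) \<le> w"
  shows "prob (\<lambda>X. s / 2 \<le> real (card (X \<inter> ((\<lambda>(u, v). {f u, f v}) ` P \<inter> pairs N)))) \<le> \<delta>0"
proof -
  have "card ((\<lambda>(u, v). {f u, f v}) ` P \<inter> pairs N) \<le> card ((\<lambda>(u, v). {f u, f v}) ` P)"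
    using assms by (intro card_mono) auto
  also have "\<dots> \<le> card P" using assms by (intro card_image_le)
  finally have c: "real (card ((\<lambda>(u, v). {f u, f v}) ` P \<inter> pairs N)) \<le> w" using assms by linarith
  have "prob (\<lambda>X. s / 2 \<le> real (card (X \<inter> ((\<lambda>(u, v). {f u, f v}) ` P \<inter> pairs N))))
      \<le> exp (- l3 * (s / 2) + p * card ((\<lambda>(u, v). {f u, f v}) ` P \<inter> pairs N) * exp l3)"
    by (intro rs_prob_upper_tail p stray(1)) auto
  also have "\<dots> \<le> exp (- l3 * (s / 2) + p * w * exp l3)"
    using c p by (auto intro!: mult_right_mono mult_left_mono)
  finally show ?thesis using stray(2) by linarith
qed

lemma irregular_le:
  fixes f :: "'v \<Rightarrow> nat"
  assumes V: "finite V" "card V = n" and fib: "\<And>D. real (card {u \<in> V. f u = D}) \<le> b"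
  shows "prob (\<lambda>X. \<not> regular_sample N g (\<xi> * k) f V X) \<le> 1 / 8"
proof -
  have "prob (\<lambda>X. \<not> regular_sample N g (\<xi> * k) f V X)
      = prob (\<lambda>X. (\<exists>a<N. \<exists>c<N. a \<noteq> c \<and> g \<le> card {d. {a, d} \<in> X \<and> {c, d} \<in> X}) \<or>
          (\<exists>d<N. \<xi> * k \<le> real (card (links f V X d))))"
    by (intro rs_exp_cong) (simp only: regular_sample_def de_Morgan_conj not_not)
  also have "\<dots> \<le> prob (\<lambda>X. \<exists>a<N. \<exists>c<N. a \<noteq> c \<and> g \<le> card {d. {a, d} \<in> X \<and> {c, d} \<in> X}) +
      prob (\<lambda>X. \<exists>d<N. \<xi> * k \<le> real (card (links f V X d)))"
    by (rule rs_prob_disj_le[OF p])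
  also have "\<dots> \<le> 1 / 16 + 1 / 16"
  proof (rule add_mono)
    show "prob (\<lambda>X. \<exists>a<N. \<exists>c<N. a \<noteq> c \<and> g \<le> card {d. {a, d} \<in> X \<and> {c, d} \<in> X}) \<le> 1 / 16"
      using codegree_tail[OF p, of N g] codegree by linarith
    have "prob (\<lambda>X. \<exists>d<N. \<xi> * k \<le> real (card (links f V X d)))
      \<le> real N * exp (p * (l1 * (1 + l1 * b)) * card V - l1 * (\<xi> * k))"
      by (rule weighted_degree_tail[OF p V(1) fib degree(1,2)]) (use b in simp)
    then show "prob (\<lambda>X. \<exists>d<N. \<xi> * k \<le> real (card (links f V X d))) \<le> 1 / 16"
      using degree(3) V(2) by simp
  qed
  finally show ?thesis by simp
qed

text \<open>If \<open>S\<close> is independent, every surviving edge of one colour on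
  \<open>S\<close> is closed in the other colour. Outside the two crude failures and the two
  excesses of edges on stray pairs, this makes both cores sparse for some pair of patterns, and
  \<open>pattern_pair_le\<close> is summed over these pairs.\<close>

lemma independent_set_tail:
  fixes f1 f2 :: "'v \<Rightarrow> nat" and Y :: "nat set set \<Rightarrow> nat set set"
  assumes V: "finite V" and f: "f1 ` V \<subseteq> {..<N}" "f2 ` V \<subseteq> {..<N}"
    and fib: "\<And>D. real (card {u \<in> V. f1 u = D}) \<le> b" "\<And>D. real (card {u \<in> V. f2 u = D}) \<le> b"
    and Y: "\<And>X. X \<subseteq> pairs N \<Longrightarrow> \<exists>F. triangle_packing N X F \<and> Y X = X - edges_of F"
    and S: "S \<subseteq> V" "card S = k"
  shows "expect (\<lambda>X1. prob (\<lambda>X2.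
      regular_sample N g (\<xi> * k) f1 V X1 \<and> regular_sample N g (\<xi> * k) f2 V X2 \<and>
      indep S (overlay_edges (Y X1) (Y X2) f1 f2 V)))
    \<le> 10 * \<delta>0 + (real N ^ m * (real m + 1) ^ k)\<^sup>2 * (main_factor * ((1 / k) ^ card (f1 ` S) * (1 / k) ^ card (f2 ` S)))"
proof -
  have finS: "finite S" using finite_subset[OF S(1) V] .
  \<comment> \<open>The pattern of each colour is taken on the representatives of the other colour,
    because its fans have to be counted in the other projection.\<close>
  obtain R1 where R1: "R1 \<subseteq> S" "inj_on f1 R1" "f1 ` R1 = f1 ` S"
    using subset_image_inj[of "f1 ` S" f1 S] by auto
  obtain R2 where R2: "R2 \<subseteq> S" "inj_on f2 R2" "f2 ` R2 = f2 ` S"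
    using subset_image_inj[of "f2 ` S" f2 S] by auto
  have fin: "finite R1" "finite R2"
    using finite_subset[OF R1(1) finS] finite_subset[OF R2(1) finS] by auto
  have cR: "card R1 \<le> k" "card R2 \<le> k"
    using card_mono[OF finS R1(1)] card_mono[OF finS R2(1)] S(2) by auto
  have RV: "R1 \<subseteq> V" "R2 \<subseteq> V" using R1(1) R2(1) S(1) by auto
  have fR: "f1 ` R2 \<subseteq> {..<N}" "f2 ` R1 \<subseteq> {..<N}"
    using image_mono[OF RV(1), of f2] image_mono[OF RV(2), of f1] f by auto
  have fS: "f1 ` S \<subseteq> {..<N}" "f2 ` S \<subseteq> {..<N}"
    using image_mono[OF S(1), of f2] image_mono[OF S(1), of f1] f by auto
  have cfS: "card (f1 ` S) \<le> k" "card (f2 ` S) \<le> k"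
    using card_image_le[OF finS, of f1] card_image_le[OF finS, of f2] S(2) by auto
  have fibR: "real (card {u \<in> R2. f1 u = D}) \<le> b" "real (card {u \<in> R1. f2 u = D}) \<le> b" for D
  proof -
    have "card {u \<in> R2. f1 u = D} \<le> card {u \<in> V. f1 u = D}" "card {u \<in> R1. f2 u = D} \<le> card {u \<in> V. f2 u = D}"
      using RV V by (auto intro!: card_mono)
    then show "real (card {u \<in> R2. f1 u = D}) \<le> b" "real (card {u \<in> R1. f2 u = D}) \<le> b"
      using fib(1)[of D] fib(2)[of D] by linarith+
  qed
  define reg1 where "reg1 = regular_sample N g (\<xi> * k) f1 V"
  define reg2 where "reg2 = regular_sample N g (\<xi> * k) f2 V"
  define Cr1 where "Cr1 = crude_failure N m t T z e f1 R2 (f1 ` S)"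
  define Cr2 where "Cr2 = crude_failure N m t T z e f2 R1 (f2 ` S)"
  define good where "good f R X \<pi> \<longleftrightarrow> \<pi> \<in> patterns N m (\<xi> * k) f R \<and>
    star_edges N f R (snd \<pi>) \<subseteq> X \<and> real (card (stray_pairs N X f R (snd \<pi>))) \<le> w" for f and R :: "'v set" and X \<pi>
  \<comment> \<open>Choosing the pattern as a function of one sample alone fixes the stray pairs
    before the other sample is drawn, as \<open>stray_tail\<close> requires.\<close>
  have "\<forall>X. \<exists>\<pi>. X \<subseteq> pairs N \<and> reg1 X \<and> \<not> Cr1 X \<longrightarrow> good f1 R2 X \<pi>"
    using pattern_exists[OF fin(2) cR(2) fR(1) RV(2) V fibR(1)] unfolding good_def reg1_def Cr1_def by blast
  then obtain pat1 where pat1: "\<And>X. X \<subseteq> pairs N \<Longrightarrow> reg1 X \<Longrightarrow> \<not> Cr1 X \<Longrightarrow> good f1 R2 X (pat1 X)"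
    using choice[of "\<lambda>X \<pi>. X \<subseteq> pairs N \<and> reg1 X \<and> \<not> Cr1 X \<longrightarrow> good f1 R2 X \<pi>"] by blast
  have "\<forall>X. \<exists>\<pi>. X \<subseteq> pairs N \<and> reg2 X \<and> \<not> Cr2 X \<longrightarrow> good f2 R1 X \<pi>"
    using pattern_exists[OF fin(1) cR(1) fR(2) RV(1) V fibR(2)] unfolding good_def reg2_def Cr2_def by blast
  then obtain pat2 where pat2: "\<And>X. X \<subseteq> pairs N \<Longrightarrow> reg2 X \<Longrightarrow> \<not> Cr2 X \<Longrightarrow> good f2 R1 X (pat2 X)"
    using choice[of "\<lambda>X \<pi>. X \<subseteq> pairs N \<and> reg2 X \<and> \<not> Cr2 X \<longrightarrow> good f2 R1 X \<pi>"] by blast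
  define P1 where "P1 X1 = stray_pairs N X1 f1 R2 (snd (pat1 X1))" for X1
  define P2 where "P2 X2 = stray_pairs N X2 f2 R1 (snd (pat2 X2))" for X2
  \<comment> \<open>The size condition is part of the event, so that its probability is small also
    for those \<open>X2\<close> where \<open>pat2\<close> is arbitrary.\<close>
  define St1 where "St1 X1 X2 \<longleftrightarrow> real (card (P2 X2)) \<le> w \<and>
    s / 2 \<le> real (card (X1 \<inter> ((\<lambda>(u, v). {f1 u, f1 v}) ` P2 X2 \<inter> pairs N)))" for X1 X2
  define St2 where "St2 X1 X2 \<longleftrightarrow> real (card (P1 X1)) \<le> w \<and>
    s / 2 \<le> real (card (X2 \<inter> ((\<lambda>(u, v). {f2 u, f2 v}) ` P1 X1 \<inter> pairs N)))" for X1 X2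
  have finP: "finite (P1 X)" "finite (P2 X)" for X
    unfolding P1_def P2_def stray_pairs_def
    by (rule finite_subset[of _ "R2 \<times> R2"], use fin in auto, rule finite_subset[of _ "R1 \<times> R1"], use fin in auto)
  define I where "I = patterns N m (\<xi> * k) f1 R2 \<times> patterns N m (\<xi> * k) f2 R1"
  define A where "A i X \<longleftrightarrow> star_edges N f1 R2 (snd (fst i)) \<subseteq> X \<and>
    real (card (X \<inter> core f1 R1 (fst (fst i)) f2 (fst (snd i)) (snd (snd i)))) \<le> s" for i X
  define B where "B i X \<longleftrightarrow> star_edges N f2 R1 (snd (snd i)) \<subseteq> X \<and>
    real (card (X \<inter> core f2 R2 (fst (snd i)) f1 (fst (fst i)) (snd (fst i)))) \<le> s" for i X
  define Main where "Main X1 X2 \<longleftrightarrow> (\<exists>i\<in>I. A i X1 \<and> B i X2)" for X1 X2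
  have cases: "Cr1 X1 \<or> Cr2 X2 \<or> St1 X1 X2 \<or> St2 X1 X2 \<or> Main X1 X2"
    if X: "X1 \<subseteq> pairs N" "X2 \<subseteq> pairs N" and reg: "reg1 X1" "reg2 X2"
      and ind: "indep S (overlay_edges (Y X1) (Y X2) f1 f2 V)" for X1 X2
  proof (rule ccontr)
    assume n: "\<not> (Cr1 X1 \<or> Cr2 X2 \<or> St1 X1 X2 \<or> St2 X1 X2 \<or> Main X1 X2)"
    have g1: "good f1 R2 X1 (pat1 X1)" and g2: "good f2 R1 X2 (pat2 X2)"
      using pat1[OF X(1) reg(1)] pat2[OF X(2) reg(2)] n by auto
    obtain F1 where F1: "triangle_packing N X1 F1" "Y X1 = X1 - edges_of F1" using Y[OF X(1)] by blast
    obtain F2 where F2: "triangle_packing N X2 F2" "Y X2 = X2 - edges_of F2" using Y[OF X(2)] by blast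
    have ind': "{u, v} \<notin> overlay_edges (Y X1) (Y X2) f1 f2 V" if "u \<in> S" "v \<in> S" "u \<noteq> v" for u v
      using ind that unfolding indep_def by blast
    have c1: "closed_pair X2 f2 u v" if "u \<in> S" "v \<in> S" "u \<noteq> v" "{f1 u, f1 v} \<in> X1 - edges_of F1" for u v
    proof -
      have "closed_pair (Y X2) f2 u v"
        using ind'[OF that(1-3)] that S(1) unfolding overlay_edges_iff F1(2) by blast
      then show ?thesis unfolding closed_pair_def F2(2) by blast
    qed
    have c2: "closed_pair X1 f1 u v" if "u \<in> S" "v \<in> S" "u \<noteq> v" "{f2 u, f2 v} \<in> X2 - edges_of F2" for u v
    proof -
      have "closed_pair (Y X1) f1 u v"
        using ind'[OF that(1-3)] that S(1) unfolding overlay_edges_iff F2(2) by blast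
      then show ?thesis unfolding closed_pair_def F1(2) by blast
    qed
    have "real (card (X1 \<inter> core f1 R1 (fst (pat1 X1)) f2 (fst (pat2 X2)) (snd (pat2 X2)))) \<le> s"
    proof (rule card_core_le[OF X(1) F1(1) _ finS R1(1,3) _ c1])
      show "\<not> (\<exists>F. triangle_packing N X1 F \<and> (\<forall>A\<in>F. [A]\<^bsup>2\<^esup> \<inter> [f1 ` S]\<^bsup>2\<^esup> \<noteq> {}) \<and> t \<le> card F)"
        using n unfolding Cr1_def crude_failure_def by blast
      show "(fst (pat2 X2), snd (pat2 X2)) \<in> patterns N m (\<xi> * k) f2 R1" using g2 by (simp add: good_def)
      show "real (card (X1 \<inter> ((\<lambda>(u, v). {f1 u, f1 v}) ` stray_pairs N X2 f2 R1 (snd (pat2 X2)) \<inter> pairs N))) \<le> s / 2"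
        using n g2 unfolding St1_def P2_def good_def by linarith
    qed (use t in auto)
    moreover have "real (card (X2 \<inter> core f2 R2 (fst (pat2 X2)) f1 (fst (pat1 X1)) (snd (pat1 X1)))) \<le> s"
    proof (rule card_core_le[OF X(2) F2(1) _ finS R2(1,3) _ c2])
      show "\<not> (\<exists>F. triangle_packing N X2 F \<and> (\<forall>A\<in>F. [A]\<^bsup>2\<^esup> \<inter> [f2 ` S]\<^bsup>2\<^esup> \<noteq> {}) \<and> t \<le> card F)"
        using n unfolding Cr2_def crude_failure_def by blast
      show "(fst (pat1 X1), snd (pat1 X1)) \<in> patterns N m (\<xi> * k) f1 R2" using g1 by (simp add: good_def)
      show "real (card (X2 \<inter> ((\<lambda>(u, v). {f2 u, f2 v}) ` stray_pairs N X1 f1 R2 (snd (pat1 X1)) \<inter> pairs N))) \<le> s / 2"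
        using n g1 unfolding St2_def P1_def good_def by linarith
    qed (use t in auto)
    ultimately have "Main X1 X2"
      unfolding Main_def I_def A_def B_def using g1 g2
      by (intro bexI[of _ "(pat1 X1, pat2 X2)"]) (auto simp: good_def)
    then show False using n by simp
  qed
  have "expect (\<lambda>X1. prob (\<lambda>X2. reg1 X1 \<and> reg2 X2 \<and>
        indep S (overlay_edges (Y X1) (Y X2) f1 f2 V)))
      \<le> expect (\<lambda>X1. expect (\<lambda>X2. of_bool (Cr1 X1) + of_bool (Cr2 X2) +
        of_bool (St1 X1 X2) + of_bool (St2 X1 X2) + of_bool (Main X1 X2)))"
  proof (intro rs_exp_mono p)
    fix X1 X2 assume X: "X1 \<subseteq> pairs N" "X2 \<subseteq> pairs N"
    show "of_bool (reg1 X1 \<and> reg2 X2 \<and> indep S (overlay_edges (Y X1) (Y X2) f1 f2 V)) \<le>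
        (of_bool (Cr1 X1) + of_bool (Cr2 X2) + of_bool (St1 X1 X2) + of_bool (St2 X1 X2) + of_bool (Main X1 X2) :: real)"
      using cases[OF X] by (auto simp: of_bool_def)
  qed
  also have "\<dots> = prob Cr1 + prob Cr2
      + expect (\<lambda>X2. prob (\<lambda>X1. St1 X1 X2))
      + expect (\<lambda>X1. prob (\<lambda>X2. St2 X1 X2))
      + expect (\<lambda>X1. prob (\<lambda>X2. Main X1 X2))"
    unfolding rs_exp_add by (simp add: rs_exp_swap[of _ _ _ _ "\<lambda>X1 X2. of_bool (St1 X1 X2)"])
  also have "\<dots> \<le> 4 * \<delta>0 + 4 * \<delta>0 + \<delta>0 + \<delta>0 + (real N ^ m * (real m + 1) ^ k)\<^sup>2 *
      (main_factor * ((1 / k) ^ card (f1 ` S) * (1 / k) ^ card (f2 ` S)))"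
  proof (intro add_mono)
    show "prob Cr1 \<le> 4 * \<delta>0"
      unfolding Cr1_def by (rule crude_failure_le[OF fin(2) cR(2) fR(1) finite_imageI[OF finS] cfS(1) fibR(1)])
    show "prob Cr2 \<le> 4 * \<delta>0"
      unfolding Cr2_def by (rule crude_failure_le[OF fin(1) cR(1) fR(2) finite_imageI[OF finS] cfS(2) fibR(2)])
    have \<delta>0: "0 \<le> \<delta>0" using order.trans[OF exp_ge_zero stray(2)] .
    have "prob (\<lambda>X1. St1 X1 X2) \<le> \<delta>0" for X2
    proof (cases "real (card (P2 X2)) \<le> w")
      case True
      then show ?thesis unfolding St1_def using stray_tail[OF finP(2) True, of f1] by simp
    qed (simp add: St1_def \<delta>0)
    then have "expect (\<lambda>X2. prob (\<lambda>X1. St1 X1 X2)) \<le> expect (\<lambda>_. \<delta>0)"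
      by (intro rs_exp_mono p)
    then show "expect (\<lambda>X2. prob (\<lambda>X1. St1 X1 X2)) \<le> \<delta>0" by simp
    have "prob (\<lambda>X2. St2 X1 X2) \<le> \<delta>0" for X1
    proof (cases "real (card (P1 X1)) \<le> w")
      case True
      then show ?thesis unfolding St2_def using stray_tail[OF finP(1) True, of f2] by simp
    qed (simp add: St2_def \<delta>0)
    then have "expect (\<lambda>X1. prob (\<lambda>X2. St2 X1 X2)) \<le> expect (\<lambda>_. \<delta>0)"
      by (intro rs_exp_mono p)
    then show "expect (\<lambda>X1. prob (\<lambda>X2. St2 X1 X2)) \<le> \<delta>0" by simp
    show "expect (\<lambda>X1. prob (\<lambda>X2. Main X1 X2)) \<le> (real N ^ m * (real m + 1) ^ k)\<^sup>2 *
        (main_factor * ((1 / k) ^ card (f1 ` S) * (1 / k) ^ card (f2 ` S)))"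
    proof (rule rs_exp_joint_union[OF p, where I = I and A = A and B = B])
      show "finite I" unfolding I_def using card_patterns(1) fin cR by blast
      have "real (card I) = real (card (patterns N m (\<xi> * k) f1 R2)) * real (card (patterns N m (\<xi> * k) f2 R1))"
        by (simp add: I_def card_cartesian_product)
      also have "\<dots> \<le> (real N ^ m * (real m + 1) ^ k) * (real N ^ m * (real m + 1) ^ k)"
        by (intro mult_mono card_patterns(2) fin cR) auto
      finally show "real (card I) \<le> (real N ^ m * (real m + 1) ^ k)\<^sup>2" by (simp add: power2_eq_square)
      show "0 \<le> main_factor * ((1 / k) ^ card (f1 ` S) * (1 / k) ^ card (f2 ` S))"
        using pL by (auto simp: main_factor_def intro!: mult_nonneg_nonneg)
      fix i assume "i \<in> I"
      then obtain M1 \<phi>1 M2 \<phi>2 where i: "i = ((M1, \<phi>1), (M2, \<phi>2))"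
        and \<pi>: "(M1, \<phi>1) \<in> patterns N m (\<xi> * k) f1 R2" "(M2, \<phi>2) \<in> patterns N m (\<xi> * k) f2 R1"
        unfolding I_def by (metis SigmaE surj_pair)
      show "prob (A i) * prob (B i) \<le>
          main_factor * ((1 / k) ^ card (f1 ` S) * (1 / k) ^ card (f2 ` S))"
        using pattern_pair_le[OF finS S(2) R1 R2 fS \<pi>] unfolding A_def B_def i by simp
    qed (simp add: Main_def)
  qed
  finally show ?thesis unfolding reg1_def reg2_def by simp
qed

text \<open>The expected failures add up to at most 3 / 4: 1 / 8 for each irregular sample, 1 / 4
  for the terms in \<open>\<delta>0\<close> and 1 / 4 for the main terms, whose weights were made
  small by the choice of the maps.\<close>

theorem triangle_free_graph_exists:
  obtains E where "E \<subseteq> [{..<n}]\<^bsup>2\<^esup>"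
    "\<And>u v w. \<not> ({u, v} \<in> E \<and> {v, w} \<in> E \<and> {u, w} \<in> E)"
    "\<And>S. S \<subseteq> {..<n} \<Longrightarrow> card S = k \<Longrightarrow> \<not> indep S E"
proof -
  define V where "V = {..<n}"
  have V: "finite V" "card V = n" by (auto simp: V_def)
  have x: "0 < 1 / real k" using k by simp
  obtain f1 f2 where f: "f1 \<in> V \<rightarrow> {..<N}" "f2 \<in> V \<rightarrow> {..<N}"
    and fib: "\<And>D. real (card {u \<in> V. f1 u = D}) \<le> b" "\<And>D. real (card {u \<in> V. f2 u = D}) \<le> b"
    and W: "(\<Sum>S\<in>[V]\<^bsup>k\<^esup>. (1 / k) ^ card (f1 ` S) * (1 / k) ^ card (f2 ` S)) \<le>
      4 * (real (card V choose k) * ((real k / N + 1 / k) ^ k)\<^sup>2)"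
    by (rule exists_spread_maps[OF V(1) N(1) x, of b k]) (use fibre_tail k b V in auto)
  have f': "f1 ` V \<subseteq> {..<N}" "f2 ` V \<subseteq> {..<N}" using f by auto
  define Good where "Good X F \<longleftrightarrow> triangle_packing N X F \<and> (\<forall>a b c. \<not> ({a, b} \<in> X - edges_of F \<and>
      {b, c} \<in> X - edges_of F \<and> {a, c} \<in> X - edges_of F))" for X F
  have "\<exists>F. Good X F" if X: "X \<subseteq> pairs N" for X
  proof -
    obtain F where F: "triangle_packing N X F"
      and hit: "\<And>a b c. {a, b} \<in> X \<Longrightarrow> {b, c} \<in> X \<Longrightarrow> {a, c} \<in> X \<Longrightarrow>
        {a, b} \<in> edges_of F \<or> {b, c} \<in> edges_of F \<or> {a, c} \<in> edges_of F"
      by (rule maximal_packing[OF X]) blast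
    show ?thesis
      unfolding Good_def
    proof (intro exI[of _ F] conjI F allI notI)
      fix a b c
      assume "{a, b} \<in> X - edges_of F \<and> {b, c} \<in> X - edges_of F \<and> {a, c} \<in> X - edges_of F"
      then show False using hit[of a b c] unfolding Diff_iff by argo
    qed
  qed
  then obtain F where F: "\<And>X. X \<subseteq> pairs N \<Longrightarrow> Good X (F X)" by metis
  define Y where "Y X = X - edges_of (F X)" for X
  have Y: "\<exists>F. triangle_packing N X F \<and> Y X = X - edges_of F" if "X \<subseteq> pairs N" for X
    using F[OF that] unfolding Y_def Good_def by blast
  define reg1 where "reg1 = regular_sample N g (\<xi> * k) f1 V"
  define reg2 where "reg2 = regular_sample N g (\<xi> * k) f2 V"
  define G where "G X1 X2 = overlay_edges (Y X1) (Y X2) f1 f2 V" for X1 X2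
  define bad where "bad S X1 X2 \<longleftrightarrow> reg1 X1 \<and> reg2 X2 \<and> indep S (G X1 X2)" for S X1 X2
  define Fail where "Fail X1 X2 \<longleftrightarrow> \<not> reg1 X1 \<or> \<not> reg2 X2 \<or> (\<exists>S\<in>[V]\<^bsup>k\<^esup>. bad S X1 X2)" for X1 X2
  have finVk: "finite ([V]\<^bsup>k\<^esup>)" using V by (simp add: finite_imp_finite_nsets)
  have "expect (\<lambda>X1. prob (\<lambda>X2. Fail X1 X2))
      \<le> expect (\<lambda>X1. expect (\<lambda>X2. of_bool (\<not> reg1 X1) + of_bool (\<not> reg2 X2) +
        (\<Sum>S\<in>[V]\<^bsup>k\<^esup>. of_bool (bad S X1 X2))))"
  proof (intro rs_exp_mono p)
    fix X1 X2
    show "of_bool (Fail X1 X2) \<le> (of_bool (\<not> reg1 X1) + of_bool (\<not> reg2 X2) +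
        (\<Sum>S\<in>[V]\<^bsup>k\<^esup>. of_bool (bad S X1 X2)) :: real)"
    proof (cases "\<exists>S\<in>[V]\<^bsup>k\<^esup>. bad S X1 X2")
      case True
      then obtain S where S: "S \<in> [V]\<^bsup>k\<^esup>" "bad S X1 X2" by blast
      have "of_bool (bad S X1 X2) \<le> (\<Sum>S\<in>[V]\<^bsup>k\<^esup>. of_bool (bad S X1 X2) :: real)"
        using S finVk by (intro member_le_sum[of S _ "\<lambda>S. of_bool (bad S X1 X2)"]) auto
      moreover have "0 \<le> of_bool (\<not> reg1 X1) + (of_bool (\<not> reg2 X2) :: real)" by simp
      ultimately show ?thesis using S(2) by (simp add: of_bool_def)
    next
      case False
      have "0 \<le> (\<Sum>S\<in>[V]\<^bsup>k\<^esup>. of_bool (bad S X1 X2) :: real)" by (intro sum_nonneg) auto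
      then show ?thesis using False by (auto simp: Fail_def)
    qed
  qed
  also have "\<dots> = prob (\<lambda>X. \<not> reg1 X) + prob (\<lambda>X. \<not> reg2 X) +
      (\<Sum>S\<in>[V]\<^bsup>k\<^esup>. expect (\<lambda>X1. prob (\<lambda>X2. bad S X1 X2)))"
    unfolding rs_exp_add rs_exp_sum by simp
  also have "\<dots> \<le> 1 / 8 + 1 / 8 + (\<Sum>S\<in>[V]\<^bsup>k\<^esup>. 10 * \<delta>0 + (real N ^ m * (real m + 1) ^ k)\<^sup>2 *
      (main_factor * ((1 / k) ^ card (f1 ` S) * (1 / k) ^ card (f2 ` S))))"
    unfolding reg1_def reg2_def bad_def G_def
    by (intro add_mono irregular_le[OF V fib(1)] irregular_le[OF V fib(2)] sum_mono
      independent_set_tail[OF V(1) f' fib Y]) (auto simp: nsets_def)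
  also have "\<dots> = 1 / 4 + 10 * (real (n choose k) * \<delta>0) + (real N ^ m * (real m + 1) ^ k)\<^sup>2 * main_factor *
      (\<Sum>S\<in>[V]\<^bsup>k\<^esup>. (1 / k) ^ card (f1 ` S) * (1 / k) ^ card (f2 ` S))"
    using V by (simp add: sum.distrib sum_distrib_left mult.assoc)
  also have "\<dots> \<le> 1 / 4 + 1 / 4 + (real N ^ m * (real m + 1) ^ k)\<^sup>2 * main_factor *
      (4 * (real (n choose k) * ((real k / N + 1 / k) ^ k)\<^sup>2))"
    using W crude_sum pL unfolding V(2) by (intro add_mono mult_left_mono) (auto simp: main_factor_def)
  also have "\<dots> \<le> 3 / 4"
    using main_sum unfolding main_factor_def by (simp add: mult_ac)
  finally have small: "expect (\<lambda>X1. prob (\<lambda>X2. Fail X1 X2)) \<le> 3 / 4" .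
  have "\<exists>X1\<subseteq>pairs N. \<exists>X2\<subseteq>pairs N. \<not> Fail X1 X2"
  proof (rule ccontr)
    assume "\<not> ?thesis"
    then have "expect (\<lambda>X1. prob (\<lambda>X2. Fail X1 X2))
        = expect (\<lambda>X1. expect (\<lambda>X2. 1))"
      by (intro rs_exp_cong) auto
    then show False using small by simp
  qed
  then obtain X1 X2 where X: "X1 \<subseteq> pairs N" "X2 \<subseteq> pairs N" "\<not> Fail X1 X2" by blast
  show thesis
  proof (rule that)
    show "G X1 X2 \<subseteq> [{..<n}]\<^bsup>2\<^esup>" unfolding G_def overlay_edges_def V_def by auto
    show "\<not> ({u, v} \<in> G X1 X2 \<and> {v, w} \<in> G X1 X2 \<and> {u, w} \<in> G X1 X2)" for u v w
      unfolding G_def Y_def by (rule overlay_triangle_free) (use F[OF X(1)] F[OF X(2)] in \<open>unfold Good_def, blast\<close>)+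
    show "\<not> indep S (G X1 X2)" if "S \<subseteq> {..<n}" "card S = k" for S
    proof -
      have "S \<in> [V]\<^bsup>k\<^esup>" using that finite_subset[OF that(1)] by (simp add: nsets_def V_def)
      then show ?thesis using X(3) unfolding Fail_def bad_def by blast
    qed
  qed
qed

end

section \<open>Asymptotics\<close>

lemma triangle_free_graph_eventually:
  fixes d :: real
  assumes d: "0 < d" "d \<le> 1 / 4"
  defines "n \<equiv> \<lambda>k. nat \<lfloor>(1 / 2 - d) * ((real k)\<^sup>2 / ln (real k))\<rfloor>"
  shows "\<forall>\<^sub>F k in sequentially. \<exists>E \<subseteq> [{..<n k}]\<^bsup>2\<^esup>.
    (\<forall>u v w. \<not> ({u, v} \<in> E \<and> {v, w} \<in> E \<and> {u, w} \<in> E)) \<and>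
    (\<forall>S \<subseteq> {..<n k}. card S = k \<longrightarrow> \<not> indep S E)"
proof -
  \<comment> \<open>\<open>\<eta>\<close> is the surplus in the density; \<open>\<xi>\<close> lies
    strictly between 1 / 2 and the mean degree divided by \<open>k\<close>, and c0 = \<eta> * (1 - 2
    * \<xi>). \<open>kap\<close> makes up for the factor 1 - exp (- l0) = 1 - d / 8.
    \<open>s0\<close> limits the deletion cost 2 * l0 * s to a quarter of the saving c0 * k * L.
    Then \<open>l3\<close> and \<open>\<epsilon>\<close> are what the tail of the stray edges
    requires.\<close>
  define \<eta> where "\<eta> = d / 4"
  define \<xi> where "\<xi> = 1 / 2 - d / 2"
  define c0 where "c0 = d\<^sup>2 / 4"
  define c1 where "c1 = 1 / 2 - d"
  define l0 where "l0 = ln (8 / d)"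
  define kap where "kap = (1 + d / 4) / (1 - d / 8)"
  define s0 where "s0 = c0 / (8 * l0)"
  define l3 where "l3 = 12 / s0"
  define \<epsilon> where "\<epsilon> = exp (- l3) / 8"
  have l0: "0 < l0" "exp (- l0) = d / 8"
    using d by (simp_all add: l0_def exp_minus)
  have c0: "0 < c0" using d by (simp add: c0_def)
  have s0: "0 < s0" using c0 l0 by (simp add: s0_def)
  have \<epsilon>: "0 < \<epsilon>" by (simp add: \<epsilon>_def)
  have "0 \<le> l3" using s0 by (simp add: l3_def)
  then have "exp (- l3) \<le> 1" by simp
  then have \<epsilon>1: "\<epsilon> \<le> 1" unfolding \<epsilon>_def by linarith
  have c1: "0 < c1" "c1 \<le> 1 / 2" using d by (simp_all add: c1_def)
  have kap: "1 \<le> kap" "kap \<le> 1 + d / 2" "kap \<le> 9 / 8"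
  proof -
    show "1 \<le> kap" using d by (simp add: kap_def field_simps)
    have "d * d \<le> d * (1 / 4)" using d by (intro mult_left_mono) auto
    then show "kap \<le> 1 + d / 2" using d by (simp add: kap_def field_simps)
    then show "kap \<le> 9 / 8" using d by linarith
  qed
  have dd: "d * d \<le> d / 4" using mult_left_mono[OF d(2), of d] d by simp
  \<comment> \<open>Every growth comparison needed below, for a real variable so that
    \<open>real_asymp\<close> applies.\<close>
  define large_enough where "large_enough x \<longleftrightarrow> 1 \<le> x \<and> 8 \<le> ln x \<and> 3 * exp 5 \<le> ln x \<and> 5120 / \<epsilon> \<le> ln x \<and>
      8 * exp 3 / \<epsilon> \<le> ln x \<and> 144 / s0 * exp (48 / s0) \<le> ln x \<and> ln x ^ 3 \<le> x\<^sup>2 \<and>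
      ln x ^ 6 + 1 \<le> x\<^sup>2 / ln x ^ 3 \<and> x + 1 \<le> c1 * (x\<^sup>2 / ln x) \<and>
      4 * ln x ^ 2 + 16 * ln x ^ 8 + 64 * ln x ^ 15 \<le> \<epsilon> * x \<and>
      16 * (x\<^sup>2 * exp (- (d\<^sup>2 / 128 * (x / (ln x)\<^sup>2)))) \<le> 1 \<and> 4 * ln x ^ 7 + 4 * ln x ^ 7 * sqrt x \<le> x * ln x \<and>
      12 \<le> s0 * (x * ln x) \<and>
      8 * ln x ^ 7 + 2 * x * ln (2 * ln x ^ 6 + 1) + 2 * x * ln (2 * ln x) +
      4 * ln x * (2 * ln x ^ 6 + 1) + x + 2 * x * ln (ln x ^ 3 + 1) + 4 \<le> 3 / 4 * c0 * (x * ln x)" for x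
  have d2: "0 < d\<^sup>2 / 128" using d by simp
  have "\<forall>\<^sub>F x in at_top. large_enough x"
    unfolding large_enough_def by (intro eventually_conj; use d2 \<epsilon> c0 s0 c1(1) in real_asymp)
  from eventually_compose_filterlim[OF this filterlim_real_sequentially] show ?thesis
  proof (rule eventually_mono)
    fix k :: nat
    define x where "x = real k"
    define L where "L = ln x"
    assume "large_enough (real k)"
    then have x1: "1 \<le> x" and L8: "8 \<le> L" and L5: "3 * exp 5 \<le> L" and L\<epsilon>: "5120 / \<epsilon> \<le> L"
      and L\<epsilon>': "8 * exp 3 / \<epsilon> \<le> L" and Ls: "144 / s0 * exp (48 / s0) \<le> L" and Lx: "L ^ 3 \<le> x\<^sup>2"
      and mN0: "L ^ 6 + 1 \<le> x\<^sup>2 / L ^ 3" and kn0: "x + 1 \<le> c1 * (x\<^sup>2 / L)"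
      and poly: "4 * L ^ 2 + 16 * L ^ 8 + 64 * L ^ 15 \<le> \<epsilon> * x"
      and deg0: "16 * (x\<^sup>2 * exp (- (d\<^sup>2 / 128 * (x / L\<^sup>2)))) \<le> 1"
      and large0: "4 * L ^ 7 + 4 * L ^ 7 * sqrt x \<le> x * L" and s12: "12 \<le> s0 * (x * L)"
      and main0: "8 * L ^ 7 + 2 * x * ln (2 * L ^ 6 + 1) + 2 * x * ln (2 * L) +
        4 * L * (2 * L ^ 6 + 1) + x + 2 * x * ln (L ^ 3 + 1) + 4 \<le> 3 / 4 * c0 * (x * L)"
      unfolding large_enough_def x_def[symmetric] L_def[symmetric] by auto
    have x0: "0 < x" and L0: "0 < L" using x1 L8 by auto
    have k0: "0 < k" using x0 by (simp add: x_def)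
    have eL: "exp L = x" using x0 by (simp add: L_def)
    define n' where "n' = n k"
    \<comment> \<open>With this \<open>N\<close>, N * p^2 is of order 1 / L and the mean fibre size
      is at most L^2 / 2, a fraction of \<open>b\<close>. \<open>T\<close> solves T * (2 * b * e) =
      2 * \<epsilon> * x^2. The power in \<open>m\<close> is chosen so that l2 * (m * T / (2 * b))
      has order x * L^2, more than the x * L needed. \<open>\<delta>0\<close> beats the number of
      \<open>k\<close>-sets, at most exp (2 * x * L).\<close>
    define N where "N = nat \<lceil>x\<^sup>2 / L ^ 3\<rceil>"
    define m where "m = nat \<lceil>L ^ 6\<rceil>"
    define g where "g = nat \<lceil>L\<rceil>"
    define p where "p = kap * L / x"
    define b where "b = 4 * L\<^sup>2"
    define T where "T = \<epsilon> * x / (32 * L ^ 3)"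
    define c where "c = 1 / (4 * L\<^sup>2)"
    define z where "z = \<epsilon> * x\<^sup>2"
    define e where "e = 8 * (x * L)"
    define s where "s = s0 * (x * L)"
    define t where "t = nat \<lfloor>s / 6\<rfloor>"
    define w where "w = 4 * \<epsilon> * x\<^sup>2"
    define l1 where "l1 = d / 4 / b"
    \<comment> \<open>A parameter growing with \<open>L\<close> gains the extra factor
      \<open>L\<close>, while exp l2 = sqrt x still keeps the mean term below x * L.\<close>
    define l2 where "l2 = L / 2"
    define \<delta>0 where "\<delta>0 = exp (- 4 * (x * L))"
    have Np: "x\<^sup>2 / L ^ 3 \<le> N" "N \<le> 2 * (x\<^sup>2 / L ^ 3)" "N \<le> x\<^sup>2" "0 < N"
    proof -
      have q: "1 \<le> x\<^sup>2 / L ^ 3" using Lx L0 by (simp add: field_simps)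
      have "N = \<lceil>x\<^sup>2 / L ^ 3\<rceil>" using q by (simp add: N_def)
      then have N': "real N = of_int \<lceil>x\<^sup>2 / L ^ 3\<rceil>" by linarith
      show "x\<^sup>2 / L ^ 3 \<le> N" unfolding N' by (rule le_of_int_ceiling)
      show 2: "N \<le> 2 * (x\<^sup>2 / L ^ 3)" unfolding N' using ceiling_correct[of "x\<^sup>2 / L ^ 3"] q by linarith
      have "2 \<le> L ^ 3" using power_mono[OF L8, of 3] by simp
      then have "2 * (x\<^sup>2 / L ^ 3) \<le> x\<^sup>2" using L0 x0 by (simp add: field_simps)
      then show "N \<le> x\<^sup>2" using 2 by linarith
      have "1 \<le> real N" using \<open>x\<^sup>2 / L ^ 3 \<le> N\<close> q by linarith
      then show "0 < N" by simp
    qed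
    have L6: "1 \<le> L ^ 6" using L8 by (intro one_le_power) simp
    have mp: "L ^ 6 \<le> m" "m \<le> L ^ 6 + 1" "m \<le> 2 * L ^ 6"
    proof -
      have "m = \<lceil>L ^ 6\<rceil>" using L6 by (simp add: m_def)
      then have m': "real m = of_int \<lceil>L ^ 6\<rceil>" by linarith
      show "L ^ 6 \<le> m" unfolding m' by (rule le_of_int_ceiling)
      show "m \<le> L ^ 6 + 1" unfolding m' using ceiling_correct[of "L ^ 6"] by linarith
      then show "m \<le> 2 * L ^ 6" using L6 by linarith
    qed
    have Nm: "real N ^ m \<le> exp (4 * L ^ 7)"
    proof -
      have "real N ^ m \<le> (x\<^sup>2) ^ m" using Np by (intro power_mono) auto
      also have "\<dots> = exp (2 * L * m)"
        unfolding exp_of_nat2_mult by (simp add: eL[symmetric] power2_eq_square exp_add[symmetric])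
      also have "\<dots> \<le> exp (4 * L ^ 7)"
        using mult_left_mono[OF mp(3), of "2 * L"] L0 by (simp add: power_Suc[symmetric] eval_nat_numeral)
      finally show "real N ^ m \<le> exp (4 * L ^ 7)" .
    qed
    have gp: "L \<le> g" "g \<le> 2 * L"
    proof -
      have "g = \<lceil>L\<rceil>" using L0 by (simp add: g_def)
      then have g': "real g = of_int \<lceil>L\<rceil>" by linarith
      show "L \<le> g" unfolding g' by (rule le_of_int_ceiling)
      show "g \<le> 2 * L" unfolding g' using ceiling_correct[of L] L8 by linarith
    qed
    have np: "n' \<le> c1 * (x\<^sup>2 / L)" "k \<le> n'" "n' \<le> x\<^sup>2"
    proof -
      have n': "n' = nat \<lfloor>c1 * (x\<^sup>2 / L)\<rfloor>" by (simp add: n'_def n_def c1_def x_def L_def)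
      have q: "0 \<le> c1 * (x\<^sup>2 / L)" using kn0 x0 by linarith
      show 1: "n' \<le> c1 * (x\<^sup>2 / L)" unfolding n' using q by (simp add: of_nat_nat)
      have "int k \<le> \<lfloor>c1 * (x\<^sup>2 / L)\<rfloor>" using kn0 by (simp add: le_floor_iff x_def)
      then show "k \<le> n'" unfolding n' by linarith
      have "x\<^sup>2 / L \<le> x\<^sup>2 / 1" using L8 x0 by (intro divide_left_mono) auto
      then have "c1 * (x\<^sup>2 / L) \<le> 1 * x\<^sup>2" using c1 L0 by (intro mult_mono) auto
      then show "n' \<le> x\<^sup>2" using 1 by linarith
    qed
    have p0: "0 < p" using kap L0 x0 by (simp add: p_def)
    have px: "p * x = kap * L" using x0 by (simp add: p_def)
    have p1: "p \<le> 1"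
    proof -
      have "L ^ 1 \<le> L ^ 15" using L8 by (intro power_increasing) auto
      moreover have "\<epsilon> * x \<le> 1 * x" using x0 by (intro mult_right_mono) (auto simp: \<epsilon>1)
      moreover have "0 \<le> L ^ 2" "0 \<le> L ^ 8" using L0 by auto
      ultimately have "2 * L \<le> x" using poly L0 unfolding power_one_right mult_1 by linarith
      moreover have "kap * L \<le> 2 * L" using kap L0 by (intro mult_right_mono) auto
      ultimately show ?thesis using x0 by (simp add: p_def)
    qed
    have Npp: "N * p\<^sup>2 \<le> 3 / L"
    proof -
      have "N * p\<^sup>2 \<le> 2 * (x\<^sup>2 / L ^ 3) * p\<^sup>2" using Np by (intro mult_right_mono) auto
      also have "\<dots> = 2 * kap\<^sup>2 / L" using x0 L0 by (simp add: p_def field_simps power2_eq_square power3_eq_cube)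
      also have "\<dots> \<le> 3 / L"
      proof -
        have "kap\<^sup>2 \<le> (9 / 8)\<^sup>2" using kap by (intro power_mono) auto
        then show ?thesis using L0 by (intro divide_right_mono) (auto simp: power2_eq_square)
      qed
      finally show ?thesis .
    qed
    have xL: "0 < x * L" using x0 L0 by simp
    have s_pos: "0 < s" "12 \<le> s" using s0 xL s12 by (auto simp: s_def)
    have tp: "6 * real t \<le> s" "s / 12 \<le> t" "0 < t"
    proof -
      have "t = \<lfloor>s / 6\<rfloor>" using s_pos by (simp add: t_def)
      then have t': "real t = of_int \<lfloor>s / 6\<rfloor>" by linarith
      show "6 * real t \<le> s" "s / 12 \<le> t" unfolding t' using floor_correct[of "s / 6"] s_pos by linarith+
      then show "0 < t" using s_pos by linarith
    qed
    have "two_bites n' k N m g t p L \<xi> \<eta> c0 kap b T z e s w l0 l1 l2 l3 c \<delta>0"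
    proof
      show "0 < k" "k \<le> n'" "0 < N" "0 < t" "6 * real t \<le> s" "0 \<le> p" "p \<le> 1" "exp L = k" "0 \<le> L"
        using k0 np Np tp p0 p1 eL L0 by (auto simp: x_def)
      show "m \<le> N" using mp mN0 Np by linarith
      show "p * k \<le> kap * L" using px by (simp add: x_def)
      have "1 * 1 \<le> kap * L" using kap L8 by (intro mult_mono) auto
      then show "1 \<le> kap * L" by simp
      show "0 \<le> l0" using l0 by simp
      have "p * (1 - exp (- l0)) * k = (p * x) * (1 - d / 8)" by (simp add: l0 x_def)
      also have "\<dots> = (1 + \<eta>) * L" using d by (simp add: px kap_def \<eta>_def)
      finally show "p * (1 - exp (- l0)) * k = (1 + \<eta>) * L" .
      show "0 < \<eta>" "0 < \<xi>" "\<xi> < 1 / 2" using d by (auto simp: \<eta>_def \<xi>_def)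
      show "2 * \<eta> \<le> (1 + \<eta>) * \<xi>" "(1 + \<eta>) * \<xi> \<le> 1 / 2" "c0 \<le> \<eta> * (1 - 2 * \<xi>)"
        "(1 + \<eta>) * c0 \<le> \<eta> * (1 - \<eta>)" "2 * (1 + \<eta>) * c0 \<le> \<eta>"
      proof -
        have ddd: "d * (d * d) \<le> d * d / 4" using mult_left_mono[OF dd, of d] d by simp
        have eqs: "(1 + \<eta>) * \<xi> = 1 / 2 - 3 * d / 8 - d * d / 8" "2 * \<eta> = d / 2"
          "\<eta> * (1 - 2 * \<xi>) = d * d / 4" "c0 = d * d / 4" "(1 + \<eta>) * c0 = d * d / 4 + d * (d * d) / 16"
          "\<eta> * (1 - \<eta>) = d / 4 - d * d / 16" "2 * (1 + \<eta>) * c0 = d * d / 2 + d * (d * d) / 8" "\<eta> = d / 4"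
          by (simp_all add: \<eta>_def \<xi>_def c0_def power2_eq_square field_simps)
        have "0 \<le> d * d" by simp
        then show "2 * \<eta> \<le> (1 + \<eta>) * \<xi>" "(1 + \<eta>) * \<xi> \<le> 1 / 2"
          using d dd unfolding eqs(1,2) by linarith+
        show "c0 \<le> \<eta> * (1 - 2 * \<xi>)" unfolding eqs(3,4) by simp
        show "(1 + \<eta>) * c0 \<le> \<eta> * (1 - \<eta>)" unfolding eqs(5,6) using d dd ddd by linarith
        show "2 * (1 + \<eta>) * c0 \<le> \<eta>" unfolding eqs(7) unfolding eqs(8) using d dd ddd by linarith
      qed
      show "0 < b" "0 < T" using L0 x0 \<epsilon> by (auto simp: b_def T_def)
      show "4 * (real N * exp (2 * real n' / N - b)) \<le> 1"
      proof -
        have "2 * real n' \<le> x\<^sup>2 / L"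
        proof -
          have "c1 * (x\<^sup>2 / L) \<le> 1 / 2 * (x\<^sup>2 / L)" using c1 L0 by (intro mult_right_mono) auto
          then show ?thesis using np by linarith
        qed
        then have "2 * real n' / N \<le> (x\<^sup>2 / L) / N" by (intro divide_right_mono) auto
        also have "\<dots> \<le> (x\<^sup>2 / L) / (x\<^sup>2 / L ^ 3)"
          using Np L0 x0 by (intro divide_left_mono) (auto intro!: divide_pos_pos mult_pos_pos)
        also have "\<dots> = L\<^sup>2" using L0 x0 by (simp add: power2_eq_square power3_eq_cube)
        finally have "2 * real n' / N - b \<le> - 3 * L\<^sup>2" by (simp add: b_def)
        then have "real N * exp (2 * real n' / N - b) \<le> x\<^sup>2 * exp (- 3 * L\<^sup>2)"
          using Np by (intro mult_mono) auto
        also have "\<dots> = exp (2 * L - 3 * L\<^sup>2)"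
          by (simp add: eL[symmetric] power2_eq_square exp_add[symmetric])
        also have "\<dots> \<le> exp (- 3)"
        proof -
          have "8 * L \<le> L\<^sup>2" using L8 by (simp add: power2_eq_square)
          then show ?thesis using L8 by (simp del: exp_minus)
        qed
        also have "\<dots> \<le> 1 / 4"
        proof -
          have "1 + (3 :: real) \<le> exp 3" by (rule exp_ge_add_one_self)
          then show ?thesis by (simp add: exp_minus field_simps)
        qed
        finally show ?thesis by simp
      qed
      show "16 * ((real N)\<^sup>2 * (real N * p\<^sup>2) ^ g) \<le> 1"
      proof -
        \<comment> \<open>As g \<ge> L, the \<open>g\<close>-th power is at most x^(-5), which beats
          the x^4 from the choice of two vertices.\<close>
        have "3 / L \<le> exp (- 5)" using L5 L0 by (simp add: exp_minus field_simps)
        then have "(real N * p\<^sup>2) ^ g \<le> exp (- 5) ^ g" using Npp by (intro power_mono) auto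
        also have "\<dots> = exp (- 5 * real g)" by (rule exp_of_nat2_mult[symmetric])
        also have "\<dots> \<le> exp (- 5 * L)" using gp by simp
        finally have "(real N)\<^sup>2 * (real N * p\<^sup>2) ^ g \<le> (x\<^sup>2)\<^sup>2 * exp (- 5 * L)"
          using Np by (intro mult_mono power_mono) auto
        also have "\<dots> = exp (- L)"
          by (simp add: eL[symmetric] power2_eq_square exp_add[symmetric])
        also have "\<dots> \<le> 1 / 16"
        proof -
          have "(16 :: real) \<le> (1 + 3) ^ 2" by simp
          also have "\<dots> \<le> exp 3 ^ 2" by (intro power_mono exp_ge_add_one_self) auto
          also have "\<dots> = exp 6" by (simp add: exp_of_nat2_mult[symmetric])
          also have "\<dots> \<le> exp L" using L8 by simp
          finally show ?thesis using L0 by (simp add: exp_minus field_simps)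
        qed
        finally show ?thesis by simp
      qed
      show "0 \<le> l1" "l1 * b \<le> 1" using d L0 by (auto simp: l1_def b_def)
      show "16 * (real N * exp (p * (l1 * (1 + l1 * b)) * n' - l1 * (\<xi> * k))) \<le> 1"
      proof -
        \<comment> \<open>The mean degree is at most (1 / 2 - 3 * d / 4) * x, the degree bound (1 /
          2 - d / 2) * x. The factor 1 + l1 * b = 1 + d / 4 uses up at most half of the gap; the
          rest leaves an exponent of order x / L^2.\<close>
        have lb: "l1 * b = d / 4" using L0 by (simp add: l1_def b_def)
        have pn: "p * n' \<le> (1 / 2 - 3 * d / 4) * x"
        proof -
          have "p * n' \<le> p * (c1 * (x\<^sup>2 / L))" using np p0 by (intro mult_left_mono) auto
          also have "\<dots> = kap * c1 * x" using x0 L0 by (simp add: p_def power2_eq_square field_simps)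
          also have "\<dots> \<le> ((1 + d / 2) * c1) * x" using kap c1 x0 by (intro mult_right_mono) auto
          also have "\<dots> \<le> (1 / 2 - 3 * d / 4) * x"
            using x0 d by (intro mult_right_mono) (auto simp: c1_def algebra_simps)
          finally show ?thesis .
        qed
        have "(1 + d / 4) * (p * n') \<le> (1 + d / 4) * ((1 / 2 - 3 * d / 4) * x)"
          using pn d by (intro mult_left_mono) auto
        also have "\<dots> \<le> (1 / 2 - 5 * d / 8) * x"
          unfolding mult.assoc[symmetric] using d x0 by (intro mult_right_mono) (auto simp: algebra_simps)
        finally have "l1 * ((1 + d / 4) * (p * n')) \<le> l1 * ((1 / 2 - 5 * d / 8) * x)"
          using d by (intro mult_left_mono) (auto simp: l1_def b_def)
        moreover have "p * (l1 * (1 + l1 * b)) * n' = l1 * ((1 + d / 4) * (p * n'))" by (simp add: lb)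
        ultimately have "p * (l1 * (1 + l1 * b)) * n' \<le> l1 * ((1 / 2 - 5 * d / 8) * x)" by linarith
        then have "p * (l1 * (1 + l1 * b)) * n' - l1 * (\<xi> * k) \<le> l1 * ((1 / 2 - 5 * d / 8) * x) - l1 * (\<xi> * x)"
          by (simp add: x_def)
        also have "\<dots> = - (d\<^sup>2 / 128 * (x / L\<^sup>2))"
          using L0 by (simp add: \<xi>_def l1_def b_def field_simps power2_eq_square)
        finally have "real N * exp (p * (l1 * (1 + l1 * b)) * n' - l1 * (\<xi> * k))
            \<le> x\<^sup>2 * exp (- (d\<^sup>2 / 128 * (x / L\<^sup>2)))"
          using Np by (intro mult_mono) auto
        then show ?thesis using deg0 by linarith
      qed
      show "(exp 1 * ((real k)\<^sup>2 * N * p ^ 3) / t) ^ t \<le> \<delta>0"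
      proof -
        \<comment> \<open>This quantity is O(x) whereas \<open>t\<close> has order x * L, so the
          base of the power is O(1 / L) and eventually below exp (- 48 / s0).\<close>
        have "(real k)\<^sup>2 * N * p ^ 3 = x * (p * x) * (N * p\<^sup>2)"
          by (simp add: x_def power2_eq_square power3_eq_cube)
        also have "\<dots> \<le> x * (p * x) * (3 / L)" using Npp x0 p0 by (intro mult_left_mono) auto
        also have "\<dots> = 3 * kap * x" using L0 by (simp add: px)
        finally have "exp 1 * ((real k)\<^sup>2 * N * p ^ 3) \<le> 3 * (3 * kap * x)"
          by (rule mult_mono[OF exp_le]) (use p0 in auto)
        also have "\<dots> \<le> 12 * x" using kap x0 by simp
        finally have "exp 1 * ((real k)\<^sup>2 * N * p ^ 3) / t \<le> 12 * x / t"
          by (intro divide_right_mono) auto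
        also have "\<dots> \<le> 12 * x / (s / 12)" using tp s_pos x0 by (intro divide_left_mono) auto
        also have "\<dots> = 144 / (s0 * L)" using x0 L0 s0 by (simp add: s_def field_simps)
        finally have "exp 1 * ((real k)\<^sup>2 * N * p ^ 3) / t \<le> 144 / (s0 * L)" .
        also have "\<dots> \<le> exp (- (48 / s0))"
          using Ls s0 L0 by (simp add: exp_minus field_simps)
        finally have "(exp 1 * ((real k)\<^sup>2 * N * p ^ 3) / t) ^ t \<le> exp (- (48 / s0)) ^ t"
          using p0 by (intro power_mono) auto
        also have "\<dots> = exp (- (48 / s0) * t)" by (rule exp_of_nat2_mult[symmetric])
        also have "\<dots> \<le> exp (- (48 / s0) * (s / 12))"
        proof -
          have "48 / s0 * (s / 12) \<le> 48 / s0 * t" using tp s0 by (intro mult_left_mono) auto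
          then show ?thesis by simp
        qed
        also have "- (48 / s0) * (s / 12) = - 4 * (x * L)" using s0 by (simp add: s_def)
        finally show ?thesis by (simp add: \<delta>0_def)
      qed
      show "0 \<le> l2" "0 \<le> c" "c * b \<le> 1" using L0 by (auto simp: l2_def c_def b_def)
      show "real N ^ m * exp (- l2 * (m * T / (2 * b)) + p * (real m * real k) * exp l2) \<le> \<delta>0"
      proof -
        have 2: "exp l2 = sqrt x"
        proof -
          have "exp l2 ^ 2 = x" by (simp add: l2_def exp_of_nat2_mult[symmetric] eL)
          then show ?thesis by (metis exp_ge_zero real_sqrt_unique)
        qed
        have 3: "p * (real m * real k) * exp l2 \<le> 4 * L ^ 7 * sqrt x"
        proof -
          have "p * (real m * real k) = kap * L * m" using px by (simp add: x_def mult_ac)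
          also have "\<dots> \<le> 2 * L * (2 * L ^ 6)" using kap L0 mp by (intro mult_mono) auto
          also have "\<dots> = 4 * L ^ 7" by (simp add: eval_nat_numeral)
          finally show ?thesis unfolding 2 using x0 by (intro mult_right_mono) auto
        qed
        have 4: "10 * (x * L) \<le> l2 * (m * T / (2 * b))"
        proof -
          have "10 * (x * L) \<le> (\<epsilon> * L) * (x * L) / 512"
          proof -
            have "5120 \<le> \<epsilon> * L" using L\<epsilon> \<epsilon> by (simp add: field_simps)
            then have "5120 * (x * L) \<le> (\<epsilon> * L) * (x * L)" using xL by (intro mult_right_mono) auto
            then show ?thesis by simp
          qed
          also have "\<dots> = L ^ 6 * (\<epsilon> * x / (512 * L ^ 4))"
            using L0 by (simp add: field_simps eval_nat_numeral)
          also have "\<dots> \<le> m * (\<epsilon> * x / (512 * L ^ 4))"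
            using mp \<epsilon> x0 L0 by (intro mult_right_mono) auto
          also have "\<dots> = l2 * (m * T / (2 * b))"
            using L0 by (simp add: l2_def T_def b_def field_simps eval_nat_numeral)
          finally show ?thesis .
        qed
        have "real N ^ m * exp (- l2 * (m * T / (2 * b)) + p * (real m * real k) * exp l2)
            \<le> exp (4 * L ^ 7) * exp (- 10 * (x * L) + 4 * L ^ 7 * sqrt x)"
          using Nm 3 4 by (intro mult_mono) auto
        also have "\<dots> \<le> exp (- 4 * (x * L))"
          unfolding exp_add[symmetric] exp_le_cancel_iff using large0 xL by linarith
        finally show ?thesis by (simp add: \<delta>0_def)
      qed
      have "2 * p * c * k = 2 * (kap * L) * c" using px by (simp add: x_def)
      also have "\<dots> \<le> 2 * (2 * L) * c" using kap L0 by (intro mult_right_mono mult_left_mono) (auto simp: c_def)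
      also have "\<dots> = 1 / L" using L0 by (simp add: c_def power2_eq_square)
      also have "\<dots> \<le> 1" using L8 by simp
      finally show "2 * p * c * k \<le> 1" .
      show "exp (- (c / T) * z + (c / T) * (exp 3 * (k * p)\<^sup>2) * N) \<le> \<delta>0"
      proof -
        \<comment> \<open>\<open>z\<close> contributes 8 * (x * L) to the exponent; the mean term,
          from (k * p)^2 * N = O(x^2 * L^2 * N / x^2) wedges, is at most 3 * x * L.\<close>
        have cT: "c / T = 8 * L / (\<epsilon> * x)" using L0 x0 \<epsilon> by (simp add: c_def T_def field_simps eval_nat_numeral)
        have cz: "c / T * z = 8 * (x * L)" unfolding cT z_def using \<epsilon> x0 by (simp add: power2_eq_square)
        have "(c / T) * (exp 3 * (k * p)\<^sup>2) * N = (8 * L * x / \<epsilon>) * exp 3 * (N * p\<^sup>2)"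
          unfolding cT using x0 \<epsilon> by (simp add: x_def power2_eq_square)
        also have "\<dots> \<le> (8 * L * x / \<epsilon>) * exp 3 * (3 / L)"
          using Npp L0 x0 \<epsilon> by (intro mult_left_mono) auto
        also have "\<dots> = 3 * x * (8 * exp 3 / \<epsilon>)" using L0 by simp
        also have "\<dots> \<le> 3 * x * L" using L\<epsilon>' x0 by (intro mult_left_mono) auto
        finally show ?thesis
          unfolding \<delta>0_def exp_le_cancel_iff mult_minus_left cz using xL by linarith
      qed
      show "exp (- e + p * (real k)\<^sup>2 * exp 1) \<le> \<delta>0"
      proof -
        have "p * (real k)\<^sup>2 * exp 1 = (p * x) * x * exp 1" by (simp add: x_def power2_eq_square)
        also have "\<dots> = kap * exp 1 * (x * L)" by (simp add: px)
        also have "\<dots> \<le> 9 / 8 * 3 * (x * L)" using kap exp_le xL by (intro mult_right_mono mult_mono) auto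
        finally show ?thesis
          unfolding \<delta>0_def e_def exp_le_cancel_iff using xL by linarith
      qed
      show "0 \<le> l3" using s0 by (simp add: l3_def)
      show "exp (- l3 * (s / 2) + p * w * exp l3) \<le> \<delta>0"
      proof -
        have 1: "l3 * (s / 2) = 6 * (x * L)" using s0 by (simp add: l3_def s_def)
        have "p * w * exp l3 = (p * x) * x * 4 * (\<epsilon> * exp l3)" by (simp add: w_def power2_eq_square)
        also have "\<epsilon> * exp l3 = 1 / 8" by (simp add: \<epsilon>_def exp_minus)
        also have "(p * x) * x * 4 * (1 / 8) = kap * (x * L) / 2" by (simp add: px)
        also have "\<dots> \<le> 2 * (x * L) / 2" using kap xL by (intro divide_right_mono mult_right_mono) auto
        finally show ?thesis
          unfolding \<delta>0_def exp_le_cancel_iff mult_minus_left 1 using xL by linarith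
      qed
      show "b * k + z + T * (2 * b * e) + 2 * (b * m * k) + 2 * (b * (real m * real m * real g) * k) \<le> w"
      proof -
        have 1: "T * (2 * b * e) = 2 * (\<epsilon> * x\<^sup>2)" using L0 by (simp add: T_def b_def e_def field_simps eval_nat_numeral)
        have 2: "2 * (b * m * k) \<le> 16 * L ^ 8 * x"
        proof -
          have "2 * (b * m * k) = 8 * L\<^sup>2 * m * x" by (simp add: b_def x_def)
          also have "\<dots> \<le> 8 * L\<^sup>2 * (2 * L ^ 6) * x" using mp x0 by (intro mult_right_mono mult_left_mono) auto
          also have "\<dots> = 16 * L ^ 8 * x" by (simp add: eval_nat_numeral)
          finally show ?thesis .
        qed
        have 3: "2 * (b * (real m * real m * real g) * k) \<le> 64 * L ^ 15 * x"
        proof -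
          have "real m * real m * real g \<le> (2 * L ^ 6) * (2 * L ^ 6) * (2 * L)"
            using mp gp L0 by (intro mult_mono) auto
          then have "8 * L\<^sup>2 * (real m * real m * real g) * x \<le> 8 * L\<^sup>2 * ((2 * L ^ 6) * (2 * L ^ 6) * (2 * L)) * x"
            using x0 by (intro mult_right_mono mult_left_mono) auto
          also have "\<dots> = 64 * L ^ 15 * x" by (simp add: eval_nat_numeral)
          finally show ?thesis by (simp add: b_def x_def)
        qed
        have "(4 * L ^ 2 + 16 * L ^ 8 + 64 * L ^ 15) * x \<le> \<epsilon> * x * x" using poly x0 by (intro mult_right_mono) auto
        then have "4 * L\<^sup>2 * x + 16 * L ^ 8 * x + 64 * L ^ 15 * x \<le> \<epsilon> * x\<^sup>2"
          by (simp add: algebra_simps power2_eq_square)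
        moreover have "b * k = 4 * L\<^sup>2 * x" by (simp add: b_def x_def)
        moreover have "w = 4 * (\<epsilon> * x\<^sup>2)" by (simp add: w_def)
        ultimately show ?thesis using 1 2 3 unfolding z_def by linarith
      qed
      have n_pow: "real n' ^ k \<le> exp (2 * (x * L))"
      proof -
        have "real n' ^ k \<le> (x\<^sup>2) ^ k" using np by (intro power_mono) auto
        also have "\<dots> = exp (2 * L * k)"
          unfolding exp_of_nat2_mult by (simp add: eL[symmetric] power2_eq_square exp_add[symmetric])
        finally show ?thesis by (simp add: x_def mult_ac)
      qed
      show "40 * (real (n' choose k) * \<delta>0) \<le> 1"
      proof -
        have "real (n' choose k) \<le> real (n' ^ k)" using binomial_le_power[of n' k] by (simp only: of_nat_le_iff)
        then have "real (n' choose k) \<le> exp (2 * (x * L))" using n_pow unfolding of_nat_power by linarith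
        then have "real (n' choose k) * \<delta>0 \<le> exp (2 * (x * L)) * \<delta>0" by (intro mult_right_mono) (auto simp: \<delta>0_def)
        also have "\<dots> = exp (- 2 * (x * L))" by (simp add: \<delta>0_def exp_add[symmetric])
        also have "\<dots> \<le> exp (- 8)"
        proof -
          have "1 * 8 \<le> x * L" using x1 L8 by (intro mult_mono) auto
          then show ?thesis unfolding exp_le_cancel_iff by linarith
        qed
        also have "\<dots> \<le> 1 / 40"
        proof -
          have "(40 :: real) \<le> (1 + 4) ^ 2 * (1 + 4)" by simp
          also have "\<dots> \<le> (1 + 2) ^ 4 * 2" by simp
          also have "\<dots> \<le> (1 + 1) ^ 8" by simp
          also have "\<dots> \<le> exp 1 ^ 8" by (intro power_mono exp_ge_add_one_self) auto
          also have "\<dots> = exp 8" by (simp add: exp_of_nat2_mult[symmetric])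
          finally show ?thesis by (simp add: exp_minus field_simps)
        qed
        finally show ?thesis by simp
      qed
      show "16 * ((real N ^ m * (real m + 1) ^ k)\<^sup>2 *
         ((kap * L) ^ (2 * k) * exp (2 * l0 * s + 2 * (1 + \<eta>) * L * (real m + 1) + k * L * (1 - c0))) *
         (real (n' choose k) * ((real k / N + 1 / k) ^ k)\<^sup>2)) \<le> 1"
      proof -
        have 1: "(real N ^ m)\<^sup>2 \<le> exp (8 * L ^ 7)"
        proof -
          have "(real N ^ m)\<^sup>2 \<le> (exp (4 * L ^ 7))\<^sup>2" using Nm by (intro power_mono) auto
          then show ?thesis by (simp add: exp_of_nat2_mult[symmetric])
        qed
        have pw: "y ^ k \<le> exp (x * ln a)" if "0 \<le> y" "y \<le> a" "0 < a" for y a :: real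
        proof -
          have "y ^ k \<le> a ^ k" using that by (intro power_mono)
          also have "\<dots> = exp (ln a * k)" unfolding exp_of_nat2_mult using that by simp
          finally show ?thesis by (simp add: x_def mult.commute)
        qed
        have sq: "y\<^sup>2 \<le> exp (2 * r)" if "0 \<le> y" "y \<le> exp r" for y r :: real
          using power_mono[OF that(2,1), of 2] by (simp add: exp_of_nat2_mult[symmetric] mult.commute)
        have 2: "((real m + 1) ^ k)\<^sup>2 \<le> exp (2 * (x * ln (2 * L ^ 6 + 1)))"
          by (intro sq pw) (use mp L0 in \<open>auto intro: add_nonneg_pos\<close>)
        have 3: "(kap * L) ^ (2 * k) \<le> exp (2 * (x * ln (2 * L)))"
        proof -
          have "((kap * L) ^ k)\<^sup>2 \<le> exp (2 * (x * ln (2 * L)))"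
            by (intro sq pw) (use kap L0 in auto)
          then show ?thesis by (simp add: power_mult[symmetric] mult.commute)
        qed
        have 4: "2 * l0 * s = c0 / 4 * (x * L)" using l0 by (simp add: s_def s0_def)
        have 5: "2 * (1 + \<eta>) * L * (real m + 1) \<le> 4 * L * (2 * L ^ 6 + 1)"
          using mp L0 d by (intro mult_mono) (auto simp: \<eta>_def)
        have 45: "exp (2 * l0 * s + 2 * (1 + \<eta>) * L * (real m + 1) + k * L * (1 - c0))
            \<le> exp (c0 / 4 * (x * L) + 4 * L * (2 * L ^ 6 + 1) + x * L * (1 - c0))"
          unfolding exp_le_cancel_iff 4 x_def[symmetric] using 5 by linarith
        have 6: "real (n' choose k) \<le> exp (x + x * L)"
        proof -
          have "real (n' choose k) \<le> (exp 1 * real n' / real k) ^ k" by (rule binomial_le_exp[OF k0])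
          also have "\<dots> \<le> exp (x * ln (exp 1 * x))"
          proof (rule pw)
            show "exp 1 * real n' / real k \<le> exp 1 * x"
              using np x0 by (simp add: x_def field_simps power2_eq_square)
          qed (use x0 in auto)
          also have "x * ln (exp 1 * x) = x + x * L" using x0 by (simp add: ln_mult L_def algebra_simps)
          finally show ?thesis .
        qed
        have L31: "0 < L ^ 3 + 1" using L0 by (simp add: add_pos_pos)
        have 7: "((real k / N + 1 / k) ^ k)\<^sup>2 \<le> exp (2 * (x * ln (L ^ 3 + 1) - x * L))"
        proof (intro sq)
          have "(real k / N + 1 / k) ^ k \<le> exp (x * ln ((L ^ 3 + 1) / x))"
          proof (rule pw)
            have "x / N \<le> x / (x\<^sup>2 / L ^ 3)"
              using Np L0 x0 by (intro divide_left_mono) (auto intro!: divide_pos_pos mult_pos_pos)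
            also have "\<dots> = L ^ 3 / x" using x0 by (simp add: power2_eq_square)
            finally show "real k / N + 1 / k \<le> (L ^ 3 + 1) / x" by (simp add: x_def add_divide_distrib)
          qed (use L0 x0 in \<open>auto intro!: divide_pos_pos add_pos_pos\<close>)
          also have "x * ln ((L ^ 3 + 1) / x) = x * ln (L ^ 3 + 1) - x * L"
            using x0 L31 by (simp add: ln_div L_def[symmetric] right_diff_distrib)
          finally show "(real k / N + 1 / k) ^ k \<le> exp (x * ln (L ^ 3 + 1) - x * L)" .
        qed auto
        have 8: "(16 :: real) \<le> exp 4"
        proof -
          have "(16 :: real) = (1 + 1) ^ 4" by simp
          also have "\<dots> \<le> exp 1 ^ 4" by (intro power_mono exp_ge_add_one_self) auto
          also have "\<dots> = exp 4" by (simp add: exp_of_nat2_mult[symmetric])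
          finally show ?thesis .
        qed
        \<comment> \<open>In units of x * L the exponents are 1 - c0 and c0 / 4 from the main
          factor, 1 from the binomial coefficient and - 2 from the two projections. The total - 3 /
          4 * c0 absorbs all lower order terms.\<close>
        have "16 * ((real N ^ m * (real m + 1) ^ k)\<^sup>2 *
           ((kap * L) ^ (2 * k) * exp (2 * l0 * s + 2 * (1 + \<eta>) * L * (real m + 1) + k * L * (1 - c0))) *
           (real (n' choose k) * ((real k / N + 1 / k) ^ k)\<^sup>2))
          \<le> exp 4 * ((exp (8 * L ^ 7) * exp (2 * (x * ln (2 * L ^ 6 + 1)))) *
           (exp (2 * (x * ln (2 * L))) * exp (c0 / 4 * (x * L) + 4 * L * (2 * L ^ 6 + 1) + x * L * (1 - c0))) *
           (exp (x + x * L) * exp (2 * (x * ln (L ^ 3 + 1) - x * L))))"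
          unfolding power_mult_distrib[of "real N ^ m"]
          by (intro mult_mono 1 2 3 45 6 7 8) (use kap L0 in \<open>auto intro!: mult_nonneg_nonneg\<close>)
        also have "\<dots> = exp (8 * L ^ 7 + 2 * x * ln (2 * L ^ 6 + 1) + 2 * x * ln (2 * L) +
            4 * L * (2 * L ^ 6 + 1) + x + 2 * x * ln (L ^ 3 + 1) + 4 - 3 / 4 * c0 * (x * L))"
          unfolding exp_add[symmetric] by (rule arg_cong[where f = exp]) (simp add: algebra_simps)
        also have "\<dots> \<le> exp 0" using main0 by (subst exp_le_cancel_iff) linarith
        finally show ?thesis by simp
      qed
    qed
    then obtain E where "E \<subseteq> [{..<n'}]\<^bsup>2\<^esup>" "\<And>u v w. \<not> ({u, v} \<in> E \<and> {v, w} \<in> E \<and> {u, w} \<in> E)"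
      "\<And>S. S \<subseteq> {..<n'} \<Longrightarrow> card S = k \<Longrightarrow> \<not> indep S E"
      by (rule two_bites.triangle_free_graph_exists) blast
    then show "\<exists>E \<subseteq> [{..<n k}]\<^bsup>2\<^esup>. (\<forall>u v w. \<not> ({u, v} \<in> E \<and> {v, w} \<in> E \<and> {u, w} \<in> E)) \<and>
        (\<forall>S \<subseteq> {..<n k}. card S = k \<longrightarrow> \<not> indep S E)"
      unfolding n'_def by blast
  qed
qed

section \<open>From the graphs to the Ramsey number\<close>

theorem theorem1p2:
  shows "\<forall>\<delta>::real. \<delta> > 0 \<longrightarrow>
    (\<exists>k0::nat. \<forall>k\<ge>k0. real (ramsey_number 3 k) \<ge> (1/2 - \<delta>) * ((real k)\<^sup>2 / ln (real k)))"
proof (intro allI impI)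
  fix \<delta> :: real assume \<delta>: "\<delta> > 0"
  \<comment> \<open>The construction assumes d \<le> 1 / 4; a smaller \<open>d\<close> only
    strengthens the bound.\<close>
  define d where "d = min \<delta> (1 / 4)"
  have d: "0 < d" "d \<le> 1 / 4" "d \<le> \<delta>" using \<delta> by (auto simp: d_def)
  define n where "n k = nat \<lfloor>(1 / 2 - d) * ((real k)\<^sup>2 / ln (real k))\<rfloor>" for k :: nat
  obtain k0 where k0: "\<And>k. k \<ge> k0 \<Longrightarrow> \<exists>E \<subseteq> [{..<n k}]\<^bsup>2\<^esup>.
      (\<forall>u v w. \<not> ({u, v} \<in> E \<and> {v, w} \<in> E \<and> {u, w} \<in> E)) \<and>
      (\<forall>S \<subseteq> {..<n k}. card S = k \<longrightarrow> \<not> indep S E)"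
    using triangle_free_graph_eventually[OF d(1,2)] unfolding eventually_sequentially n_def by blast
  show "\<exists>k0::nat. \<forall>k\<ge>k0. real (ramsey_number 3 k) \<ge> (1/2 - \<delta>) * ((real k)\<^sup>2 / ln (real k))"
  proof (intro exI[of _ "max k0 2"] allI impI)
    fix k assume "max k0 2 \<le> k"
    then have k: "k \<ge> k0" "k \<ge> 2" by auto
    obtain E where tri: "\<And>u v w. \<not> ({u, v} \<in> E \<and> {v, w} \<in> E \<and> {u, w} \<in> E)"
      and ind: "\<And>S. S \<subseteq> {..<n k} \<Longrightarrow> card S = k \<Longrightarrow> \<not> indep S E"
      using k0[OF k(1)] by blast
    \<comment> \<open>All r \<le> n k are excluded by restricting the one graph to its first
      \<open>r\<close> vertices, so monotonicity of \<open>ramsey_arrows\<close> in its first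
      argument need not be proved.\<close>
    have not_arrows: "\<not> ramsey_arrows r 3 k" if r: "r \<le> n k" for r
    proof
      assume "ramsey_arrows r 3 k"
      then have "\<exists>S \<subseteq> {..<r}. card S = 3 \<and> clique S (E \<inter> [{..<r}]\<^bsup>2\<^esup>) \<or> card S = k \<and> indep S (E \<inter> [{..<r}]\<^bsup>2\<^esup>)"
        unfolding ramsey_arrows_def by (elim allE[of _ "{..<r}"] allE[of _ "E \<inter> [{..<r}]\<^bsup>2\<^esup>"]) auto
      then obtain S where S: "S \<subseteq> {..<r}" and
        alt: "card S = 3 \<and> clique S (E \<inter> [{..<r}]\<^bsup>2\<^esup>) \<or> card S = k \<and> indep S (E \<inter> [{..<r}]\<^bsup>2\<^esup>)" by blast
      from alt show False
      proof
        assume a: "card S = 3 \<and> clique S (E \<inter> [{..<r}]\<^bsup>2\<^esup>)"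
        then obtain u v w where "S = {u, v, w}" "u \<noteq> v" "v \<noteq> w" "u \<noteq> w"
          by (auto simp: card_3_iff)
        then have "{u, v} \<in> E" "{v, w} \<in> E" "{u, w} \<in> E" using a by (auto simp: clique_def)
        then show False using tri by blast
      next
        assume a: "card S = k \<and> indep S (E \<inter> [{..<r}]\<^bsup>2\<^esup>)"
        then have "indep S E" using S by (auto simp: indep_def)
        moreover have "S \<subseteq> {..<n k}" using S r by auto
        ultimately show False using ind a by blast
      qed
    qed
    have "n k < ramsey_number 3 k"
      using not_arrows ramsey_arrows_ramsey_number[of 3 k] not_le by blast
    moreover have "(1 / 2 - d) * ((real k)\<^sup>2 / ln (real k)) < real (n k) + 1"
      unfolding n_def by linarith
    moreover have "(1/2 - \<delta>) * ((real k)\<^sup>2 / ln (real k)) \<le> (1 / 2 - d) * ((real k)\<^sup>2 / ln (real k))"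
      using d k by (intro mult_right_mono) auto
    ultimately show "real (ramsey_number 3 k) \<ge> (1/2 - \<delta>) * ((real k)\<^sup>2 / ln (real k))" by linarith
  qed
qed

end
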